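(* Let $D=\mathrm{diag}\{d_1,\dots,d_p\}<0$, and let $\varphi$ and $\widetilde\varphi$ be the Weyl functions of the canonical systems with Hamiltonians $H$ and $\widetilde H$, respectively, where $H,\widetilde H\in\mathcal H(D)$. Let $l>0$ and suppose that on some ray $\Im z/\Re z=c$ in $\mathbb C_+$ the relations $$e^{-iza}\big(\varphi(z)-\widetilde\varphi(z)\big)=O(1)\qquad(z\to\infty)$$ hold for all $a<l$. Then $$H(x)\equiv\widetilde H(x)\quad\text{for}\quad 0<x<l/d,\qquad d:=\max_{1\le k\le p}|d_k|.$$
   Context: Notation: $J=\begin{bmatrix}0&I_p\\ I_p&0\end{bmatrix}$; $|D|=\mathrm{diag}\{|d_1|,\dots,|d_p|\}$; $\mathbb C_+$ is the open upper half-plane; $L^2_p(0,l)$ is the space of $\mathbb C^p$-valued square-summable functions. Hamiltonians are understood up to equality almost everywhere. The canonical system with Hamiltonian $H$ is $\frac{d}{dx}w(x,z)=izJH(x)w(x,z)$, $x\ge0$. Class $\mathcal H(D)$ (for $D<0$): let $k(x)=\{k_{ij}(x)\}_{i,j=1}^p$ be a $p\times p$ matrix function with $k\in L^2_{p\times p}(0,r)$ for all $0<r<\infty$, $k(-x)=k(x)^*$, and such that for all $0<r<\infty$ the operators $$S_r=I+\int_0^r\{k_{ij}(d_jt-d_ix)\}_{i,j=1}^p\,\cdot\,dt$$ in $L^2_p(0,r)$ are positive, bounded and boundedly invertible. Then $S_r^{-1}=E_r^*E_r$ with $E_r=I+\int_0^xE(x,t)\,\cdot\,dt$ bounded in $L_p^2(0,r)$,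 where $E(x,t)$ is a Hilbert–Schmidt kernel (not depending on $r$). Put $$s(x)=\tfrac12I_p+|D|^{-1}\int_0^xk(t)dt,\quad \Pi(x)=\Big[D\{s_{ij}(|d_i|x)\}_{i,j=1}^p\quad I_p\Big],\quad \beta(x)=(E_r\Pi)(x)\ (x<r),\quad H(x)=\beta(x)^*\beta(x)$$ (with $E_r$ applied columnwise). The class $\mathcal H(D)$ consists of all Hamiltonians $H(x)$, $0<x<\infty$, obtained in this way from such $k$. Weyl function: let $w$ be the fundamental solution of the canonical system normalized by $w(0,z)=I_{2p}$. The Weyl function is the (unique, for $H\in\mathcal H(D)$) $p\times p$ holomorphic matrix function $\varphi$ in $\mathbb C_+$ satisfying $$\int_0^\infty[\,I_p\ \ i\varphi(z)^*\,]\,w(x,z)^*H(x)w(x,z)\begin{bmatrix}I_p\\ -i\varphi(z)\end{bmatrix}dx<\infty,\qquad z\in\mathbb C_+.$$ *)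

theory Defs
  imports "HOL-Complex_Analysis.Complex_Analysis" "HOL-Library.Landau_Symbols"
begin

section \<open>Complex matrices\<close>

text \<open>
  A matrix with rows indexed by \<open>'m\<close> and columns indexed by \<open>'n\<close> has type
  \<open>complex ^ 'n ^ 'm\<close>.  The index type of \<open>p\<close>-vectors is \<open>'p\<close>, that of \<open>2p\<close>-vectors is
  \<open>'p + 'p\<close>.  Multiplication by a scalar \<open>c\<close> is written \<open>mat c ** A\<close>.
\<close>

definition hermconj :: "complex ^ 'n ^ 'm \<Rightarrow> complex ^ 'm ^ 'n" where
  "hermconj A = (\<chi> i j. cnj (A $ j $ i))"

definition diagmat :: "('n \<Rightarrow> real) \<Rightarrow> complex ^ 'n ^ 'n" where
  "diagmat d = (\<chi> i j. if i = j then complex_of_real (d i) else 0)"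

definition hcat :: "complex ^ 'a ^ 'm \<Rightarrow> complex ^ 'b ^ 'm \<Rightarrow> complex ^ ('a + 'b) ^ 'm" where
  "hcat A B = (\<chi> i j. case j of Inl a \<Rightarrow> A $ i $ a | Inr b \<Rightarrow> B $ i $ b)"

definition vcat :: "complex ^ 'n ^ 'a \<Rightarrow> complex ^ 'n ^ 'b \<Rightarrow> complex ^ 'n ^ ('a + 'b)" where
  "vcat A B = (\<chi> i j. case i of Inl a \<Rightarrow> A $ a $ j | Inr b \<Rightarrow> B $ b $ j)"

definition Jmat :: "complex ^ ('p :: finite + 'p) ^ ('p + 'p)" where
  "Jmat = vcat (hcat 0 (mat 1)) (hcat (mat 1) 0)"


section \<open>Operators in \<open>L\<^sup>2\<^sub>p(0,r)\<close>\<close>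

text \<open>
  Elements of \<open>L\<^sup>2\<^sub>p(0,r)\<close> are represented by functions on the real line that are measurable and
  square summable on \<open>(0,r)\<close>; two of them are identified when they agree almost everywhere on
  \<open>(0,r)\<close>.  The norm on \<open>complex ^ 'p\<close> is the Euclidean one, and the norm on
  \<open>complex ^ 'n ^ 'm\<close> is the Frobenius (Hilbert--Schmidt) norm.
\<close>

definition square_summable_on ::
    "('a :: euclidean_space \<Rightarrow> 'b :: euclidean_space) \<Rightarrow> 'a set \<Rightarrow> bool"
    (infixr "square'_summable'_on" 46) where
  "f square_summable_on A \<longleftrightarrow>
     f \<in> borel_measurable (lebesgue_on A) \<and> integrable (lebesgue_on A) (\<lambda>x. (norm (f x))\<^sup>2)"

definition L2 :: "real \<Rightarrow> (real \<Rightarrow> complex ^ 'p) set" where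
  "L2 r = {f. f square_summable_on {0<..<r}}"

definition L2_eq :: "real \<Rightarrow> (real \<Rightarrow> complex ^ 'p) \<Rightarrow> (real \<Rightarrow> complex ^ 'p) \<Rightarrow> bool" where
  "L2_eq r f g \<longleftrightarrow> (AE x in lebesgue_on {0<..<r}. f x = g x)"

definition L2_inner :: "real \<Rightarrow> (real \<Rightarrow> complex ^ 'p) \<Rightarrow> (real \<Rightarrow> complex ^ 'p) \<Rightarrow> complex" where
  "L2_inner r f g = (LINT x|lebesgue_on {0<..<r}. (\<Sum>i\<in>UNIV. f x $ i * cnj (g x $ i)))"

definition L2_norm :: "real \<Rightarrow> (real \<Rightarrow> complex ^ 'p) \<Rightarrow> real" where
  "L2_norm r f = sqrt (LINT x|lebesgue_on {0<..<r}. (norm (f x))\<^sup>2)"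

type_synonym 'p operator = "(real \<Rightarrow> complex ^ 'p) \<Rightarrow> (real \<Rightarrow> complex ^ 'p)"

definition bounded_op :: "real \<Rightarrow> ('p :: finite) operator \<Rightarrow> bool" where
  "bounded_op r T \<longleftrightarrow>
     (\<forall>f\<in>L2 r. T f \<in> L2 r) \<and>
     (\<forall>f\<in>L2 r. \<forall>g\<in>L2 r. L2_eq r f g \<longrightarrow> L2_eq r (T f) (T g)) \<and>
     (\<forall>f\<in>L2 r. \<forall>g\<in>L2 r. L2_eq r (T (\<lambda>x. f x + g x)) (\<lambda>x. T f x + T g x)) \<and>
     (\<forall>c. \<forall>f\<in>L2 r. L2_eq r (T (\<lambda>x. c *s f x)) (\<lambda>x. c *s T f x)) \<and>
     (\<exists>B. \<forall>f\<in>L2 r. L2_norm r (T f) \<le> B * L2_norm r f)"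

definition positive_op :: "real \<Rightarrow> ('p :: finite) operator \<Rightarrow> bool" where
  "positive_op r T \<longleftrightarrow>
     (\<forall>f\<in>L2 r. L2_inner r (T f) f \<in> \<real> \<and> Re (L2_inner r (T f) f) \<ge> 0)"

definition inverse_op :: "real \<Rightarrow> ('p :: finite) operator \<Rightarrow> 'p operator \<Rightarrow> bool" where
  "inverse_op r T R \<longleftrightarrow>
     bounded_op r R \<and> (\<forall>f\<in>L2 r. L2_eq r (R (T f)) f \<and> L2_eq r (T (R f)) f)"

definition adjoint_op :: "real \<Rightarrow> ('p :: finite) operator \<Rightarrow> 'p operator \<Rightarrow> bool" where
  "adjoint_op r T R \<longleftrightarrow>
     bounded_op r R \<and> (\<forall>f\<in>L2 r. \<forall>g\<in>L2 r. L2_inner r (T f) g = L2_inner r f (R g))"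


section \<open>The class \<open>\<H>(D)\<close>, \<open>D = diag (d\<^sub>1, \<dots>, d\<^sub>p)\<close>\<close>

definition S_op :: "real ^ 'p \<Rightarrow> (real \<Rightarrow> complex ^ 'p ^ 'p) \<Rightarrow> real \<Rightarrow> 'p operator" where
  "S_op d k r f = (\<lambda>x. f x +
     (LINT t|lebesgue_on {0<..<r}. (\<chi> i j. k (d $ j * t - d $ i * x) $ i $ j) *v f t))"

text \<open>The lower triangular operator \<open>E\<^sub>r\<close>; its values on \<open>(0,r)\<close> are given by the same formula
  for every \<open>r\<close>.\<close>

definition E_op :: "(real \<Rightarrow> real \<Rightarrow> complex ^ 'p ^ 'p) \<Rightarrow> 'p operator" where
  "E_op E f = (\<lambda>x. f x + (LINT t|lebesgue_on {0<..<x}. E x t *v f t))"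

definition admissible_kernel :: "real ^ 'p \<Rightarrow> (real \<Rightarrow> complex ^ 'p ^ 'p) \<Rightarrow> bool" where
  "admissible_kernel d k \<longleftrightarrow>
     (\<forall>r>0. k square_summable_on {0<..<r}) \<and>
     (AE x in lebesgue. k (- x) = hermconj (k x)) \<and>
     (\<forall>r>0. bounded_op r (S_op d k r) \<and> positive_op r (S_op d k r) \<and>
            (\<exists>R. inverse_op r (S_op d k r) R))"

definition triangular_factor ::
    "real ^ 'p \<Rightarrow> (real \<Rightarrow> complex ^ 'p ^ 'p) \<Rightarrow> (real \<Rightarrow> real \<Rightarrow> complex ^ 'p ^ 'p) \<Rightarrow> bool" where
  "triangular_factor d k E \<longleftrightarrow>
     (\<forall>r>0. (\<lambda>(x, t). E x t) square_summable_on {(x, t). 0 < t \<and> t < x \<and> x < r} \<and>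
            bounded_op r (E_op E) \<and>
            (\<exists>E'. adjoint_op r (E_op E) E' \<and> inverse_op r (S_op d k r) (E' \<circ> E_op E)))"

definition s_fun :: "real ^ 'p \<Rightarrow> (real \<Rightarrow> complex ^ 'p ^ 'p) \<Rightarrow> real \<Rightarrow> complex ^ 'p ^ 'p" where
  "s_fun d k x = mat (1/2) +
     diagmat (\<lambda>i. inverse \<bar>d $ i\<bar>) ** (LINT t|lebesgue_on {0<..<x}. k t)"

definition Pi_fun ::
    "real ^ 'p \<Rightarrow> (real \<Rightarrow> complex ^ 'p ^ 'p) \<Rightarrow> real \<Rightarrow> complex ^ ('p + 'p) ^ 'p" where
  "Pi_fun d k x =
     hcat (diagmat (\<lambda>i. d $ i) ** (\<chi> i j. s_fun d k (\<bar>d $ i\<bar> * x) $ i $ j)) (mat 1)"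

definition beta_fun ::
    "real ^ 'p \<Rightarrow> (real \<Rightarrow> complex ^ 'p ^ 'p) \<Rightarrow> (real \<Rightarrow> real \<Rightarrow> complex ^ 'p ^ 'p) \<Rightarrow>
     real \<Rightarrow> complex ^ ('p + 'p) ^ 'p" where
  "beta_fun d k E x = (\<chi> i j. E_op E (\<lambda>t. column j (Pi_fun d k t)) x $ i)"

definition class_H :: "real ^ 'p \<Rightarrow> (real \<Rightarrow> complex ^ ('p + 'p) ^ ('p + 'p)) set" where
  "class_H d = {H. \<exists>k E. admissible_kernel d k \<and> triangular_factor d k E \<and>
     (AE x in lebesgue_on {0<..}. H x = hermconj (beta_fun d k E x) ** beta_fun d k E x)}"


section \<open>Canonical systems and Weyl functions\<close>

text \<open>
  The Hamiltonian is only locally summable, so \<open>w' = i z J H w\<close>, \<open>w(0,z) = I\<close> is understood in the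
  usual sense of an absolutely continuous \<open>w(\<cdot>,z)\<close> satisfying the equation almost everywhere,
  i.e. as the corresponding integral equation.
\<close>

definition fundamental_solution ::
    "(real \<Rightarrow> complex ^ ('p :: finite + 'p) ^ ('p + 'p)) \<Rightarrow>
     (real \<Rightarrow> complex \<Rightarrow> complex ^ ('p + 'p) ^ ('p + 'p)) \<Rightarrow> bool" where
  "fundamental_solution H w \<longleftrightarrow>
     (\<forall>z. \<forall>x\<ge>0.
        integrable (lebesgue_on {0<..<x}) (\<lambda>t. mat (\<i> * z) ** Jmat ** H t ** w t z) \<and>
        w x z = mat 1 + (LINT t|lebesgue_on {0<..<x}. mat (\<i> * z) ** Jmat ** H t ** w t z))"

text \<open>The matrix integrand below is pointwise nonnegative for a nonnegative \<open>H\<close>, so that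
  finiteness of its integral is integrability.\<close>

definition weyl_function ::
    "(real \<Rightarrow> complex ^ ('p + 'p) ^ ('p + 'p)) \<Rightarrow> (complex \<Rightarrow> complex ^ 'p ^ 'p) \<Rightarrow> bool" where
  "weyl_function H \<phi> \<longleftrightarrow>
     (\<forall>i j. (\<lambda>z. \<phi> z $ i $ j) holomorphic_on {z. Im z > 0}) \<and>
     (\<exists>w. fundamental_solution H w \<and>
        (\<forall>z. Im z > 0 \<longrightarrow>
           integrable (lebesgue_on {0<..})
             (\<lambda>x. hcat (mat 1) (mat \<i> ** hermconj (\<phi> z)) ** hermconj (w x z) ** H x **
                  w x z ** vcat (mat 1) (mat (- \<i>) ** \<phi> z))))"

end

(*
  Write A = i D \<integral>\<^sub>0\<^sup>x, \<beta> = E \<Pi> and H = \<beta>\<^sup>* \<beta>.  The operator identity A S - S A\<^sup>* = i \<Pi> J \<Pi>\<^sup>* together with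
  S\<^sup>-\<^sup>1 = E\<^sup>* E gives the triangular model E A = i \<beta> J (\<integral>\<^sub>0\<^sup>x \<beta>\<^sup>* E).  Hence \<beta> w v = E u, where w is the
  fundamental solution and u = (I - z A)\<^sup>-\<^sup>1 \<Pi> v is explicit, and the Weyl condition says that
  \<langle>S\<^sub>r\<^sup>-\<^sup>1 u, u\<rangle> is bounded in r.  Pairing u with shifts of a fixed bump, for which \<langle>S f, f\<rangle> does not grow,
  yields \<phi> as a conditionally convergent Laplace transform of the primitive of k.  Two Weyl functions
  that are close on a ray then have kernels k whose difference has a truncated Laplace transform of
  exponential type that is bounded on the ray and on a half-plane; by Phragmen--Lindelof and Liouville it
  is constant, so the kernels agree on (-l, l).  Finally \<integral>\<^sub>0\<^sup>r H = \<Pi>\<^sup>* S\<^sub>r\<^sup>-\<^sup>1 \<Pi> depends only on k on this interval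
  as long as r d \<le> l.
*)
theory Submission
  imports Defs "HOL-Real_Asymp.Real_Asymp"
begin

text \<open>The obstacle is the lack of regularity. The kernel \<open>k\<close> is locally square
  summable without any growth bound, so nothing makes the Laplace transform of its primitive
  converge beforehand. The Weyl condition has to supply this, and it only bounds the increments of
  \<open>Vf\<close> over steps of length one; the resulting linear growth is then beaten by the
  decay of exp(i z y). The factor E is known only through S^-1 = E' E, so differentiation in r is
  replaced by identities between integrals that hold for every r. The pairing works because <u, f> =
  <S^-1 u, S f> is controlled by <S^-1 u, u> and <S f, f>, while a bump in a single component sees
  only a diagonal entry of the kernel, which depends on x - t. The function \<phi> enters through
  the initial vector v, a column of (I, -i \<phi>): then Pi v is D/2 - i \<phi> minus the primitive
  of k, all on the scale y = |d_i| x. The Laplace transform of the primitive must therefore balance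
  that of the constant D/2 - i \<phi>. The factor d arises because S_r evaluates k at d_j t - d_i x
  with 0 < x, t < r, that is, inside (-d r, d r).\<close>

no_notation fps_nth (infixl \<open>$\<close> 75)

section \<open>Integration on intervals\<close>

abbreviation Iv :: "real \<Rightarrow> real measure" where
  "Iv r \<equiv> lebesgue_on {0<..<r}"

lemma finite_measure_Iv: "finite_measure (Iv r)"
  by (metis box_real(1) finite_measure_lebesgue_on lmeasurable_box)

lemma sigma_finite_Iv: "sigma_finite_measure (Iv r)"
  by (rule finite_measure.axioms(1)[OF finite_measure_Iv])

lemma pair_sigma_finite_Iv: "pair_sigma_finite (Iv r) (Iv s)"
  by (simp add: pair_sigma_finite_def sigma_finite_Iv)

lemma integrable_Iv_mono:
  fixes f :: "real \<Rightarrow> 'a::{banach, second_countable_topology}"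
  assumes "integrable (Iv r) f" "x \<le> r"
  shows "integrable (Iv x) f"
proof -
  have "set_integrable lebesgue {0<..<r} f"
    using assms(1) by (simp add: set_integrable_def integrable_restrict_space)
  then have "set_integrable lebesgue {0<..<x} f"
    by (rule set_integrable_subset) (use assms in auto)
  then show ?thesis
    by (simp add: set_integrable_def integrable_restrict_space)
qed

lemma measurable_Iv_mono:
  assumes "f \<in> borel_measurable (Iv r)" "x \<le> r"
  shows "f \<in> borel_measurable (Iv x)"
proof -
  have "f \<in> borel_measurable (restrict_space (Iv r) {0<..<x})"
    using assms(1) by (rule measurable_restrict_space1)
  then show ?thesis
    using assms by (simp add: restrict_restrict_space Int_absorb1 greaterThanLessThan_subseteq_greaterThanLessThan)
qed

lemma AE_Iv_mono: 
  assumes "AE x in Iv r. P x" "s \<le> r" shows "AE x in Iv s. P x"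
  using assms by (auto simp: AE_restrict_space_iff elim!: AE_mp)

lemma integral_Iv_indicator:
  fixes f :: "real \<Rightarrow> 'a::{banach, second_countable_topology}"
  assumes "x \<le> r"
  shows "integral\<^sup>L (Iv x) f = (LINT t|Iv r. indicator {0<..<x} t *\<^sub>R f t)"
proof -
  have "Iv x = restrict_space (Iv r) {0<..<x}"
    using assms by (simp add: restrict_restrict_space Int_absorb1 greaterThanLessThan_subseteq_greaterThanLessThan)
  moreover have "{0<..<x} \<inter> space (Iv r) \<in> sets (Iv r)"
    by (auto simp: sets_restrict_space)
  ultimately show ?thesis
    by (simp add: integral_restrict_space)
qed

lemma integrable_indicator_Iv:
  fixes f :: "real \<Rightarrow> 'a::{banach, second_countable_topology}"
  assumes "integrable (Iv r) f" "A \<in> sets borel"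
  shows "integrable (Iv r) (\<lambda>t. indicator A t *\<^sub>R f t)"
  using assms(1)
proof (rule Bochner_Integration.integrable_bound)
  have "A \<in> sets lebesgue" using assms(2) by simp
  then have "indicator A \<in> borel_measurable (Iv r)"
    by (metis borel_measurable_indicator measurable_restrict_space1)
  then show "(\<lambda>t. indicator A t *\<^sub>R f t) \<in> borel_measurable (Iv r)"
    using assms by (intro borel_measurable_scaleR) (auto)
qed (auto simp: indicator_def)

lemma integrable_Iv_bound:
  fixes f :: "real \<Rightarrow> 'a::{banach, second_countable_topology}"
  assumes "f \<in> borel_measurable (Iv r)" "\<And>x. 0 < x \<Longrightarrow> x < r \<Longrightarrow> norm (f x) \<le> B"
  shows "integrable (Iv r) f"
  using finite_measure.integrable_const_bound[OF finite_measure_Iv _ assms(1), of B] assms(2)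
  by (simp add: AE_restrict_space_iff)

lemma continuous_measurable_Iv:
  fixes f :: "real \<Rightarrow> 'a::topological_space"
  assumes "continuous_on UNIV f" shows "f \<in> borel_measurable (Iv r)"
proof -
  have "f \<in> borel_measurable borel" using assms by (rule borel_measurable_continuous_onI)
  then have "f \<in> borel_measurable lebesgue" by (simp add: measurable_completion)
  then show ?thesis by (rule measurable_restrict_space1)
qed

lemma continuous_on_measurable_Iv:
  fixes f :: "real \<Rightarrow> 'a::euclidean_space"
  assumes "continuous_on {0..r} f" shows "f \<in> borel_measurable (Iv r)"
  by (rule continuous_imp_measurable_on_sets_lebesgue) 
     (auto intro: continuous_on_subset[OF assms])

lemma continuous_integrable_Iv:
  fixes f :: "real \<Rightarrow> 'a::euclidean_space"
  assumes "continuous_on {0..r} f" shows "integrable (Iv r) f"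
proof -
  have "bounded (f ` {0..r})" using assms compact_continuous_image compact_imp_bounded by blast
  then obtain B where "\<And>x. x \<in> {0..r} \<Longrightarrow> norm (f x) \<le> B" unfolding bounded_iff by (metis imageI)
  then show ?thesis by (intro integrable_Iv_bound[OF continuous_on_measurable_Iv[OF assms], of B]) auto
qed

lemma integrable_continuous_mult_Iv:
  fixes g u :: "real \<Rightarrow> 'a::{real_normed_field, euclidean_space}"
  assumes g: "continuous_on {0..r} g" and u: "integrable (Iv r) u"
  shows "integrable (Iv r) (\<lambda>t. g t * u t)"
proof -
  have "bounded (g ` {0..r})" by (intro compact_imp_bounded compact_continuous_image g) auto
  then obtain B where B: "\<forall>y\<in>g ` {0..r}. norm y \<le> B" unfolding bounded_iff by blast
  have "integrable (Iv r) (\<lambda>t. of_real B * u t)" using u by simp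
  then show ?thesis
  proof (rule Bochner_Integration.integrable_bound)
    show "(\<lambda>t. g t * u t) \<in> borel_measurable (Iv r)"
      by (intro borel_measurable_times continuous_on_measurable_Iv g borel_measurable_integrable u)
    show "AE t in Iv r. norm (g t * u t) \<le> norm (of_real B * u t)"
    proof (rule AE_I2)
      fix t assume "t \<in> space (Iv r)"
      then have "norm (g t) \<le> B" by (intro bspec[OF B] imageI) auto
      then show "norm (g t * u t) \<le> norm (of_real B * u t)"
        by (simp add: norm_mult mult_right_mono)
    qed
  qed
qed

lemma Iv_eq_Icc:
  fixes f :: "real \<Rightarrow> 'a::euclidean_space"
  shows "integrable (Iv r) f \<longleftrightarrow> integrable (lebesgue_on {0..r}) f"
    and "integral\<^sup>L (Iv r) f = integral\<^sup>L (lebesgue_on {0..r}) f"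
proof -
  show *: "integrable (Iv r) f \<longleftrightarrow> integrable (lebesgue_on {0..r}) f"
    using absolutely_integrable_on_Icc_iff_Ioo[of 0 r f]
    by (simp add: set_integrable_def integrable_restrict_space)
  show "integral\<^sup>L (Iv r) f = integral\<^sup>L (lebesgue_on {0..r}) f"
  proof (cases "integrable (Iv r) f")
    case True
    with * show ?thesis
      by (simp add: lebesgue_integral_eq_integral integral_open_interval_real)
  qed (use * in \<open>simp add: not_integrable_integral_eq\<close>)
qed

lemma continuous_on_indefinite_Iv:
  fixes f :: "real \<Rightarrow> 'a::euclidean_space"
  assumes "integrable (Iv r) f"
  shows "continuous_on {0..r} (\<lambda>x. integral\<^sup>L (Iv x) f)"
  unfolding Iv_eq_Icc(2) using assms by (intro indefinite_integral_continuous_real) (simp add: Iv_eq_Icc)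

section \<open>Fubini on rectangles and integration by parts\<close>

lemma integrable_bounded_product_Iv:
  fixes f g :: "real \<Rightarrow> complex" and h :: "real \<Rightarrow> real \<Rightarrow> complex"
  assumes f: "integrable (Iv r) f" and g: "integrable (Iv s) g"
    and h: "case_prod h \<in> borel_measurable (Iv r \<Otimes>\<^sub>M Iv s)"
    and B: "\<And>x y. 0 < x \<Longrightarrow> x < r \<Longrightarrow> 0 < y \<Longrightarrow> y < s \<Longrightarrow> norm (h x y) \<le> B"
  shows "integrable (Iv r \<Otimes>\<^sub>M Iv s) (\<lambda>(x, y). h x y * (f x * g y))"
proof -
  interpret pair_sigma_finite "Iv r" "Iv s" by (rule pair_sigma_finite_Iv)
  have [measurable]: "f \<in> borel_measurable (Iv r)" "g \<in> borel_measurable (Iv s)"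
    using f g by auto
  have "integrable (Iv r \<Otimes>\<^sub>M Iv s) (\<lambda>p. f (fst p) * g (snd p))"
  proof (rule Fubini_integrable)
    have "(\<lambda>x. \<integral> y. norm (f x * g y) \<partial>Iv s) = (\<lambda>x. norm (f x) * (\<integral> y. norm (g y) \<partial>Iv s))"
      by (simp add: norm_mult)
    moreover have "integrable (Iv r) (\<lambda>x. norm (f x) * (\<integral> y. norm (g y) \<partial>Iv s))"
      using f by simp
    ultimately show "integrable (Iv r) (\<lambda>x. \<integral> y. norm (f (fst (x, y)) * g (snd (x, y))) \<partial>Iv s)"
      by simp
  qed (use g in auto)
  then have "integrable (Iv r \<Otimes>\<^sub>M Iv s) (\<lambda>p. B * (f (fst p) * g (snd p)))" 
    using integrable_mult_right by blast
  then show ?thesis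
  proof (rule Bochner_Integration.integrable_bound)
    show "(\<lambda>(x, y). h x y * (f x * g y)) \<in> borel_measurable (Iv r \<Otimes>\<^sub>M Iv s)"
      using h unfolding case_prod_beta' by measurable
    show "AE p in Iv r \<Otimes>\<^sub>M Iv s. norm (case p of (x, y) \<Rightarrow> h x y * (f x * g y)) \<le> norm (B * (f (fst p) * g (snd p)))"
    proof (rule AE_I2)
      fix p assume "p \<in> space (Iv r \<Otimes>\<^sub>M Iv s)"
      then have "norm (h (fst p) (snd p)) \<le> B" by (auto simp: space_pair_measure intro: B)
      then have "norm (h (fst p) (snd p)) \<le> \<bar>B\<bar>" by linarith
      then show "norm (case p of (x, y) \<Rightarrow> h x y * (f x * g y)) \<le> norm (B * (f (fst p) * g (snd p)))"
        by (simp add: case_prod_beta' norm_mult mult_right_mono)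
    qed
  qed
qed

lemma Fubini_Iv:
  fixes f g :: "real \<Rightarrow> complex" and h :: "real \<Rightarrow> real \<Rightarrow> complex"
  assumes f: "integrable (Iv r) f" and g: "integrable (Iv s) g"
    and h: "case_prod h \<in> borel_measurable (Iv r \<Otimes>\<^sub>M Iv s)"
    and B: "\<And>x y. 0 < x \<Longrightarrow> x < r \<Longrightarrow> 0 < y \<Longrightarrow> y < s \<Longrightarrow> norm (h x y) \<le> B"
  shows "(LINT x|Iv r. (LINT y|Iv s. h x y * g y) * f x) = (LINT y|Iv s. (LINT x|Iv r. h x y * f x) * g y)"
    and "integrable (Iv r) (\<lambda>x. (LINT y|Iv s. h x y * g y) * f x)"
    and "integrable (Iv s) (\<lambda>y. (LINT x|Iv r. h x y * f x) * g y)"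
proof -
  interpret pair_sigma_finite "Iv r" "Iv s" by (rule pair_sigma_finite_Iv)
  note I = integrable_bounded_product_Iv[OF f g h B]
  have 1: "(LINT y|Iv s. h x y * (f x * g y)) = (LINT y|Iv s. h x y * g y) * f x" for x
    unfolding integral_mult_left_zero[symmetric] by (simp add: mult_ac)
  have 2: "(LINT x|Iv r. h x y * (f x * g y)) = (LINT x|Iv r. h x y * f x) * g y" for y
    unfolding integral_mult_left_zero[symmetric] by (simp add: mult_ac)
  show "(LINT x|Iv r. (LINT y|Iv s. h x y * g y) * f x) = (LINT y|Iv s. (LINT x|Iv r. h x y * f x) * g y)"
    using Fubini_integral[OF I] by (simp add: 1 2)
  show "integrable (Iv r) (\<lambda>x. (LINT y|Iv s. h x y * g y) * f x)"
    using integrable_fst[OF I] by (simp add: 1)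
  show "integrable (Iv s) (\<lambda>y. (LINT x|Iv r. h x y * f x) * g y)"
    using integrable_snd[OF I] by (simp add: 2)
qed

text \<open>Integration by parts for primitives of functions that are merely integrable: the product
  is an integral over the square, which is cut along its diagonal. It replaces the product rule
  wherever two primitives are multiplied.\<close>

lemma product_of_integrals_Iv:
  fixes f g :: "real \<Rightarrow> complex"
  assumes f: "integrable (Iv r) f" and g: "integrable (Iv r) g"
  shows "(LINT x|Iv r. f x) * (LINT x|Iv r. g x) = 
      (LINT x|Iv r. (LINT y|Iv x. g y) * f x) + (LINT x|Iv r. (LINT y|Iv x. f y) * g x)"
    and "integrable (Iv r) (\<lambda>x. (LINT y|Iv x. g y) * f x)"
proof -
  have fgm: "(\<lambda>p. fst p) \<in> measurable (Iv r \<Otimes>\<^sub>M Iv r) borel" "(\<lambda>p. snd p) \<in> measurable (Iv r \<Otimes>\<^sub>M Iv r) borel"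
    using measurable_compose[OF measurable_fst[of "Iv r" "Iv r"] continuous_measurable_Iv[of "\<lambda>x. x" r]]
      measurable_compose[OF measurable_snd[of "Iv r" "Iv r"] continuous_measurable_Iv[of "\<lambda>x. x" r]]
    by (auto simp: continuous_on_id)
  define h :: "real \<Rightarrow> real \<Rightarrow> complex" where "h x y = (if y < x then 1 else 0)" for x y
  \<comment> \<open>The diagonal is given to \<open>h'\<close>, so that \<open>h + h' = 1\<close>
    holds everywhere. The extra point x = y is null and is discarded in the proof of
    \<open>H'\<close>.\<close>
  define h' :: "real \<Rightarrow> real \<Rightarrow> complex" where "h' x y = (if y < x then 0 else 1)" for x y
  have hm: "case_prod h \<in> borel_measurable (Iv r \<Otimes>\<^sub>M Iv r)" "case_prod h' \<in> borel_measurable (Iv r \<Otimes>\<^sub>M Iv r)"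
    unfolding h_def h'_def case_prod_beta' using fgm by measurable
  have hB: "norm (h x y) \<le> 1" "norm (h' x y) \<le> 1" for x y by (auto simp: h_def h'_def)
  have H: "(LINT y|Iv r. h x y * g y) = (LINT y|Iv x. g y)" if "x \<in> {0<..<r}" for x g
    using that by (subst integral_Iv_indicator[of x r]) (auto simp: h_def indicator_def intro!: Bochner_Integration.integral_cong)
  have H': "(LINT x|Iv r. h' x y * f x) = (LINT x|Iv y. f x)" if "y \<in> {0<..<r}" for y
  proof -
    have "{0..y} \<inter> {0<..<r} = {0<..y}" using that by auto
    have "(LINT x|Iv r. h' x y * f x) = (LINT x|Iv r. indicator {0<..y} x *\<^sub>R f x)"
      by (intro Bochner_Integration.integral_cong) (auto simp: h'_def indicator_def)
    also have "\<dots> = (LINT x|Iv r. indicator {0<..<y} x *\<^sub>R f x)"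
    proof (rule integral_cong_AE)
      have "AE x in lebesgue. x \<noteq> y" by (simp add: AE_completion AE_lborel_singleton)
      then have "AE x in Iv r. x \<noteq> y" by (auto simp: AE_restrict_space_iff elim!: eventually_mono)
      then show "AE x in Iv r. indicat_real {0<..y} x *\<^sub>R f x = indicat_real {0<..<y} x *\<^sub>R f x"
        by eventually_elim (auto simp: indicator_def)
    qed (use f in \<open>auto intro!: borel_measurable_integrable[OF integrable_indicator_Iv]\<close>)
    also have "\<dots> = (LINT x|Iv y. f x)" using that by (intro integral_Iv_indicator[symmetric]) auto
    finally show ?thesis .
  qed
  note F = Fubini_Iv[OF f g hm(1) hB(1)] Fubini_Iv[OF f g hm(2) hB(2)]
  have h1: "h x y + h' x y = 1" for x y by (simp add: h_def h'_def)
  have int: "integrable (Iv r) (\<lambda>y. h x y * g y)" "integrable (Iv r) (\<lambda>y. h' x y * g y)" for x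
  proof -
    have "(\<lambda>y. h x y * g y) = (\<lambda>y. indicator {..<x} y *\<^sub>R g y)" "(\<lambda>y. h' x y * g y) = (\<lambda>y. indicator {x..} y *\<^sub>R g y)"
      by (auto simp: h_def h'_def indicator_def)
    then show "integrable (Iv r) (\<lambda>y. h x y * g y)" "integrable (Iv r) (\<lambda>y. h' x y * g y)"
      using integrable_indicator_Iv[OF g] by auto
  qed
  have "(LINT x|Iv r. f x) * (LINT x|Iv r. g x) = (LINT x|Iv r. (LINT y|Iv r. (h x y + h' x y) * g y) * f x)"
    by (simp add: h1)
  also have "\<dots> = (LINT x|Iv r. (LINT y|Iv r. h x y * g y) * f x + (LINT y|Iv r. h' x y * g y) * f x)"
    using int by (simp add: distrib_right)
  also have "\<dots> = (LINT x|Iv r. (LINT y|Iv r. h x y * g y) * f x) + (LINT x|Iv r. (LINT y|Iv r. h' x y * g y) * f x)"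
    by (intro Bochner_Integration.integral_add F)
  also have "\<dots> = (LINT x|Iv r. (LINT y|Iv r. h x y * g y) * f x) + (LINT y|Iv r. (LINT x|Iv r. h' x y * f x) * g y)"
    using F by simp
  also have "\<dots> = (LINT x|Iv r. (LINT y|Iv x. g y) * f x) + (LINT x|Iv r. (LINT y|Iv x. f y) * g x)"
    by (intro arg_cong2[where f="(+)"] Bochner_Integration.integral_cong) (simp_all add: H H')
  finally show "(LINT x|Iv r. f x) * (LINT x|Iv r. g x) = 
      (LINT x|Iv r. (LINT y|Iv x. g y) * f x) + (LINT x|Iv r. (LINT y|Iv x. f y) * g x)" .
  have "integrable (Iv r) (\<lambda>x. (LINT y|Iv x. g y) * f x) \<longleftrightarrow> integrable (Iv r) (\<lambda>x. (LINT y|Iv r. h x y * g y) * f x)"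
    by (intro Bochner_Integration.integrable_cong) (simp_all add: H)
  then show "integrable (Iv r) (\<lambda>x. (LINT y|Iv x. g y) * f x)" using F by simp
qed

text \<open>A Lebesgue measurable function composed with an affine map of two variables need not be
  measurable for the product sigma-algebra, whereas a Borel function stays measurable. The Fubini
  arguments for k and for E therefore pass through such a representative.\<close>

lemma borel_representative:
  fixes f :: "'a::euclidean_space \<Rightarrow> 'b::euclidean_space"
  assumes f: "f \<in> borel_measurable lebesgue"
  obtains g where "g \<in> borel_measurable borel" "AE x in lebesgue. f x = g x"
proof -
  have "\<exists>g\<in>borel_measurable lborel. AE x in lborel. f x \<bullet> b = g x" if "b \<in> Basis" for b
    by (intro completion_ex_borel_measurable_real borel_measurable_inner f) auto
  then obtain g where g: "\<And>b. b \<in> Basis \<Longrightarrow> g b \<in> borel_measurable borel"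
    "\<And>b. b \<in> Basis \<Longrightarrow> AE x in lborel. f x \<bullet> b = g b x"
    by (metis measurable_lborel2)
  have "(\<lambda>x. \<Sum>b\<in>Basis. g b x *\<^sub>R b) \<in> borel_measurable borel"
    using g(1) by (intro borel_measurable_sum borel_measurable_scaleR) auto
  moreover have "AE x in lborel. \<forall>b\<in>Basis. f x \<bullet> b = g b x"
    by (intro AE_finite_allI g) auto
  then have "AE x in lborel. f x = (\<Sum>b\<in>Basis. g b x *\<^sub>R b)"
    by eventually_elim (metis (no_types, lifting) euclidean_representation sum.cong)
  then have "AE x in lebesgue. f x = (\<Sum>b\<in>Basis. g b x *\<^sub>R b)" by (rule AE_completion)
  ultimately show ?thesis by (rule that)
qed

text \<open>Half-lines are an intersection-stable generator of the Borel sets, and the sets over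
  which the function, extended by zero, has integral zero are closed under complements and countable
  disjoint unions. Hence the integral vanishes over every Borel set, which forces the density to be
  null.\<close>

lemma AE_zero_of_integrals_Iv:
  fixes f :: "real \<Rightarrow> complex"
  assumes f: "integrable (Iv r) f" and 0: "\<And>x. 0 < x \<Longrightarrow> x \<le> r \<Longrightarrow> (LINT t|Iv x. f t) = 0"
  shows "AE x in Iv r. f x = 0"
proof -
  have all0: "(LINT t|Iv x. f t) = 0" if "x \<le> r" for x
    using 0[of x] that by (cases "0 < x") auto
  let ?f = "\<lambda>x. indicator {0<..<r} x *\<^sub>R f x"
  have fi: "integrable lebesgue ?f"
    using f by (simp add: integrable_restrict_space)
  obtain g where g: "g \<in> borel_measurable borel" and fg: "AE x in lebesgue. ?f x = g x"
    using borel_representative borel_measurable_integrable[OF fi] by metis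
  have gL: "g \<in> borel_measurable lebesgue" using g by (simp add: measurable_completion)
  have gi: "integrable lborel g"
    using integrable_cong_AE_imp[OF fi gL] fg g by (simp add: integrable_completion)
  have eq: "(LINT t|lborel. indicator A t *\<^sub>R g t) = (LINT t|Iv r. indicator A t *\<^sub>R f t)" if "A \<in> sets borel" for A
  proof -
    have A: "indicator A \<in> borel_measurable borel" using that by simp
    have "A \<in> sets lebesgue" using that by simp
    then have AL: "indicat_real A \<in> borel_measurable lebesgue" by (rule borel_measurable_indicator)
    have "(LINT t|lborel. indicator A t *\<^sub>R g t) = (LINT t|lebesgue. indicator A t *\<^sub>R g t)"
      by (rule integral_completion[symmetric]) (use A g in \<open>simp only: measurable_lborel2, intro borel_measurable_scaleR\<close>)
    also have "\<dots> = (LINT t|lebesgue. indicator A t *\<^sub>R ?f t)"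
    proof (rule integral_cong_AE)
      show "AE x in lebesgue. indicator A x *\<^sub>R g x = indicator A x *\<^sub>R ?f x"
        using fg by eventually_elim simp
    qed (intro borel_measurable_scaleR AL gL borel_measurable_integrable[OF fi])+
    also have "\<dots> = (LINT t|Iv r. indicator A t *\<^sub>R f t)"
      by (simp add: integral_restrict_space mult_ac)
    finally show ?thesis .
  qed
  have si: "set_integrable lborel A g" if "A \<in> sets borel" for A
    unfolding set_integrable_def using that gi 
    by (rule_tac Bochner_Integration.integrable_bound[OF gi]) (use g in \<open>auto simp: indicator_def\<close>)
  have "AE x in lborel. g x = 0"
  proof (rule sigma_finite_measure.density_zero[OF sigma_finite_lborel gi])
    fix A :: "real set" assume "A \<in> sets lborel"
    then have A: "A \<in> sigma_sets UNIV (range (\<lambda>a::real. {..<a}))"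
      by (simp add: borel_Iio)
    have "Int_stable (range (\<lambda>a::real. {..<a}))"
    proof (rule Int_stableI)
      fix A B :: "real set" assume "A \<in> range (\<lambda>a. {..<a})" "B \<in> range (\<lambda>a. {..<a})"
      then obtain a b where "A = {..<a}" "B = {..<b}" by auto
      then have "A \<inter> B = {..<min a b}" by auto
      then show "A \<inter> B \<in> range (\<lambda>a. {..<a})" by auto
    qed
    moreover have "range (\<lambda>a::real. {..<a}) \<subseteq> Pow UNIV" by simp
    ultimately have "A \<in> sets borel \<and> set_lebesgue_integral lborel A g = 0"
      using A
    proof (induction rule: sigma_sets_induct_disjoint)
      case (basic A)
      then obtain a where A: "A = {..<a}" by auto
      have "(LINT t|Iv r. indicator A t *\<^sub>R f t) = (LINT t|Iv r. indicator {0<..<min a r} t *\<^sub>R f t)"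
        by (intro Bochner_Integration.integral_cong) (auto simp: A indicator_def)
      also have "\<dots> = 0" using all0[of "min a r"] integral_Iv_indicator[of "min a r" r f] by simp
      finally show ?case using eq[of A] by (simp add: A set_lebesgue_integral_def)
    next
      case (compl A)
      have UN: "set_lebesgue_integral lborel UNIV g = 0"
        using eq[of UNIV] all0[of r] by (simp add: set_lebesgue_integral_def)
      have "set_lebesgue_integral lborel (A \<union> (UNIV - A)) g = set_lebesgue_integral lborel A g + set_lebesgue_integral lborel (UNIV - A) g"
        using compl.IH by (intro set_integral_Un si) auto
      then show ?case using compl UN sets.Diff[of UNIV borel A] by simp
    next
      case (union A)
      have "set_lebesgue_integral lborel (\<Union>i. A i) g = (\<Sum>i. set_lebesgue_integral lborel (A i) g)"
        using union by (intro lebesgue_integral_countable_add si) (auto simp: disjoint_family_on_def)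
      then show ?case using union by auto
    qed (auto simp: set_lebesgue_integral_def)
    then show "set_lebesgue_integral lborel A g = 0" by simp
  qed
  then have "AE x in lebesgue. g x = 0" by (rule AE_completion)
  with fg have "AE x in lebesgue. x \<in> {0<..<r} \<longrightarrow> f x = 0"
    by eventually_elim (auto simp: indicator_def)
  then show ?thesis by (simp add: AE_restrict_space_iff)
qed

lemma AE_eq_of_integrals_Iv:
  fixes f g :: "real \<Rightarrow> complex"
  assumes "integrable (Iv r) f" "integrable (Iv r) g" 
    and "\<And>x. 0 < x \<Longrightarrow> x \<le> r \<Longrightarrow> (LINT t|Iv x. f t) = (LINT t|Iv x. g t)"
  shows "AE x in Iv r. f x = g x"
proof -
  have "AE x in Iv r. f x - g x = 0"
    using assms by (intro AE_zero_of_integrals_Iv) (simp_all add: integrable_Iv_mono[where r=r])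
  then show ?thesis by simp
qed

section \<open>Affine substitutions and primitives of locally integrable functions\<close>

lemma AE_lebesgue_affine:
  fixes a c :: real
  assumes "AE x in lebesgue. P x" "c \<noteq> 0"
  shows "AE t in lebesgue. P (a + c * t)"
proof -
  obtain N where N: "N \<in> null_sets lebesgue" "{x. \<not> P x} \<subseteq> N"
    using assms(1) by (auto simp: eventually_ae_filter)
  have "negligible ((\<lambda>x. (x - a) / c) ` N)"
    using N by (intro negligible_differentiable_image_negligible)
      (auto simp: negligible_iff_null_sets differentiable_on_def intro!: derivative_intros \<open>c \<noteq> 0\<close>)
  moreover have "{t. \<not> P (a + c * t)} \<subseteq> (\<lambda>x. (x - a) / c) ` N"
  proof
    fix t assume "t \<in> {t. \<not> P (a + c * t)}"
    then have "a + c * t \<in> N" using N by auto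
    then show "t \<in> (\<lambda>x. (x - a) / c) ` N" using \<open>c \<noteq> 0\<close> by (intro image_eqI[of _ _ "a + c*t"]) auto
  qed
  ultimately show ?thesis by (intro AE_I') (auto simp: negligible_iff_null_sets)
qed

text \<open>The oriented integral from 0 to y: for negative y the second indicator yields minus the
  integral over (y, 0). Both signs are needed because d_j t - d_i x changes sign.\<close>

definition prim :: "(real \<Rightarrow> complex) \<Rightarrow> real \<Rightarrow> complex" where
  "prim k y = (LINT t|lebesgue. (indicator {0<..<y} t - indicator {y<..<0} t) *\<^sub>R k t)"

definition loc_integrable :: "(real \<Rightarrow> complex) \<Rightarrow> bool" where
  "loc_integrable k \<longleftrightarrow> (\<forall>a b. integrable (lebesgue_on {a<..<b}) k)"

lemma set_integrable_loc: "loc_integrable k \<Longrightarrow> integrable lebesgue (\<lambda>x. indicator {a<..<b} x *\<^sub>R k x)"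
  by (simp add: loc_integrable_def integrable_restrict_space)

lemma prim_diff:
  assumes "loc_integrable k" "a \<le> b"
  shows "prim k b - prim k a = (LINT t|lebesgue_on {a<..<b}. k t)"
proof -
  have I: "integrable lebesgue (\<lambda>t. (indicator {0<..<y} t - indicator {y<..<0} t) *\<^sub>R k t)" for y
    unfolding scaleR_diff_left by (intro Bochner_Integration.integrable_diff set_integrable_loc assms)
  have "prim k b - prim k a = (LINT t|lebesgue. (indicator {0<..<b} t - indicator {b<..<0} t) *\<^sub>R k t - (indicator {0<..<a} t - indicator {a<..<0} t) *\<^sub>R k t)"
    unfolding prim_def by (intro Bochner_Integration.integral_diff[symmetric] I)
  also have "\<dots> = (LINT t|lebesgue. indicator {a<..<b} t *\<^sub>R k t)"
  proof (rule integral_cong_AE)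
    have "AE t in lebesgue. t \<notin> {0,a,b}"
      by (rule AE_not_in) (simp add: negligible_iff_null_sets[symmetric])
    then show "AE t in lebesgue. (indicator {0<..<b} t - indicator {b<..<0} t) *\<^sub>R k t - (indicator {0<..<a} t - indicator {a<..<0} t) *\<^sub>R k t = indicator {a<..<b} t *\<^sub>R k t"
      by eventually_elim (use \<open>a \<le> b\<close> in \<open>auto simp: indicator_def\<close>)
  qed (use I set_integrable_loc[OF assms(1), of a b] in auto)
  finally show ?thesis by (simp add: integral_restrict_space)
qed

lemma prim_0 [simp]: "prim k 0 = 0" by (simp add: prim_def)

lemma prim_nonneg: "prim k y = (LINT t|Iv y. k t)" if "loc_integrable k" "0 \<le> y"
  using prim_diff[OF that] by simp

lemma continuous_on_prim:
  assumes "loc_integrable k"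
  shows "continuous_on A (prim k)"
proof -
  have "isCont (prim k) x" for x
  proof -
    have Icc: "integrable (lebesgue_on {a..b}) k" for a b
    proof -
      have "integrable lebesgue (\<lambda>x. indicator {a-1<..<b+1} x *\<^sub>R k x)"
        by (rule set_integrable_loc[OF assms])
      then have "set_integrable lebesgue {a-1<..<b+1} k" by (simp add: set_integrable_def)
      then have "set_integrable lebesgue {a..b} k"
        by (rule set_integrable_subset) auto
      then show ?thesis by (simp add: set_integrable_def integrable_restrict_space)
    qed
    have eq: "prim k y = prim k (x - 1) + integral\<^sup>L (lebesgue_on {x-1..y}) k" if "y \<in> {x-1..x+1}" for y
    proof -
      have "prim k y - prim k (x-1) = integral {x-1<..<y} k"
        using that assms by (subst prim_diff) (auto simp: lebesgue_integral_eq_integral loc_integrable_def)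
      also have "\<dots> = integral\<^sup>L (lebesgue_on {x-1..y}) k"
        by (subst lebesgue_integral_eq_integral[OF Icc]) (auto simp: integral_open_interval_real)
      finally show ?thesis by (simp add: algebra_simps)
    qed
    have "continuous_on {x-1..x+1} (\<lambda>y. prim k (x - 1) + integral\<^sup>L (lebesgue_on {x-1..y}) k)"
      by (intro continuous_intros indefinite_integral_continuous_real Icc)
    then have "continuous_on {x-1..x+1} (prim k)"
      using eq by (metis (no_types, lifting) continuous_on_cong)
    then show ?thesis
      by (rule continuous_on_interior) auto
  qed
  then show ?thesis by (simp add: continuous_at_imp_continuous_on)
qed

lemma LINT_Iv_affine:
  fixes k :: "real \<Rightarrow> complex"
  assumes "loc_integrable k" "q < 0" "0 \<le> x"
  shows "(LINT \<xi>|Iv x. k (p - q * \<xi>)) = (prim k p - prim k (p - q * x)) / of_real q"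
    and "integrable (Iv x) (\<lambda>\<xi>. k (p - q * \<xi>))"
proof -
  have *: "(\<lambda>\<xi>. indicator {0<..<x} \<xi> *\<^sub>R k (p - q * \<xi>)) = (\<lambda>\<xi>. indicator {p<..<p - q * x} (p + (-q) * \<xi>) *\<^sub>R k (p + (-q) * \<xi>))"
    using \<open>q < 0\<close> by (auto simp: indicator_def fun_eq_iff mult_less_0_iff)
  have "(LINT \<xi>|Iv x. k (p - q * \<xi>)) = (LINT \<xi>|lebesgue. indicator {p<..<p - q * x} (p + (-q) * \<xi>) *\<^sub>R k (p + (-q) * \<xi>))"
    by (simp add: integral_restrict_space * del: mult_minus_left)
  also have "\<dots> = (LINT y|lebesgue. indicator {p<..<p - q * x} y *\<^sub>R k y) /\<^sub>R \<bar>-q\<bar>"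
    using \<open>q < 0\<close> by (subst lebesgue_integral_real_affine[of "-q" _ p]) auto
  also have "\<dots> = (prim k (p - q * x) - prim k p) /\<^sub>R \<bar>-q\<bar>"
    using assms by (subst prim_diff) (auto simp: integral_restrict_space mult_nonpos_nonneg)
  finally show "(LINT \<xi>|Iv x. k (p - q * \<xi>)) = (prim k p - prim k (p - q * x)) / of_real q"
    using \<open>q < 0\<close> by (simp add: scaleR_conv_of_real field_simps)
  show "integrable (Iv x) (\<lambda>\<xi>. k (p - q * \<xi>))"
    using lebesgue_integrable_real_affine[OF set_integrable_loc[OF assms(1), of p "p - q*x"], of "-q" p] \<open>q < 0\<close>
    by (simp add: integrable_restrict_space * del: mult_minus_left)
qed

lemma loc_integrable_norm: "loc_integrable k \<Longrightarrow> loc_integrable (\<lambda>x. of_real (norm (k x)))"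
  by (simp add: loc_integrable_def)

text \<open>Integrating the kernel in the variable \<xi> first replaces the rough function k by a
  difference of values of its continuous primitive. With q = d_i this is how the kernel of
  \<open>A S\<close> becomes continuous.\<close>

lemma convolution_Fubini:
  fixes k F :: "real \<Rightarrow> complex"
  assumes k: "loc_integrable k" and F: "integrable (Iv r) F" and pq: "p \<noteq> 0" "q < 0" and x: "0 \<le> x"
  shows "(LINT \<xi>|Iv x. (LINT t|Iv r. k (p * t - q * \<xi>) * F t)) =
      (LINT t|Iv r. (prim k (p * t) - prim k (p * t - q * x)) / of_real q * F t)" (is ?th1)
    and "integrable (Iv x) (\<lambda>\<xi>. (LINT t|Iv r. k (p * t - q * \<xi>) * F t))" (is ?th2)
proof -
  interpret pair_sigma_finite "Iv r" "Iv x" by (rule pair_sigma_finite_Iv)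
  have kL: "k \<in> borel_measurable lebesgue"
  proof (rule borel_measurable_LIMSEQ_metric)
    show "(\<lambda>x. indicator {-real n<..<real n} x *\<^sub>R k x) \<in> borel_measurable lebesgue" for n
      using set_integrable_loc[OF k] by auto
    fix x 
    have "eventually (\<lambda>n. \<bar>x\<bar> < real n) sequentially"
      using filterlim_real_sequentially filterlim_at_top_dense by blast
    then show "(\<lambda>n. indicator {-real n<..<real n} x *\<^sub>R k x) \<longlonglongrightarrow> k x"
      by (intro tendsto_eventually, elim eventually_mono) (auto simp: indicator_def)
  qed
  \<comment> \<open>Joint measurability of (t, \<xi>) -> k(p t - q \<xi>) is needed for Fubini, so k
    is exchanged for a Borel function. Since p is nonzero, the exchange changes the inner integrals
    for no \<xi>.\<close>
  obtain k' where k'[measurable]: "k' \<in> borel_measurable borel" and kk': "AE y in lebesgue. k y = k' y"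
    using borel_representative[OF kL] .
  have "loc_integrable k'"
    unfolding loc_integrable_def
  proof (intro allI)
    fix a b
    have "integrable (lebesgue_on {a<..<b}) k" using k by (auto simp: loc_integrable_def)
    moreover have "k' \<in> borel_measurable (lebesgue_on {a<..<b})"
      by (intro measurable_restrict_space1) (simp add: k' measurable_completion)
    moreover have "AE y in lebesgue_on {a<..<b}. k y = k' y"
      using kk' by (auto simp: AE_restrict_space_iff elim!: eventually_mono)
    ultimately show "integrable (lebesgue_on {a<..<b}) k'"
      by (rule integrable_cong_AE_imp)
  qed
  note n' = loc_integrable_norm[OF this]
  have [measurable]: "F \<in> borel_measurable (Iv r)" using F by auto
  have [measurable]: "(\<lambda>t. t) \<in> borel_measurable (Iv a)" for a
    by (rule continuous_measurable_Iv) (simp add: continuous_on_id)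
  let ?n = "\<lambda>y. complex_of_real (norm (k' y))"
  have I: "integrable (Iv r \<Otimes>\<^sub>M Iv x) (\<lambda>(t, \<xi>). k' (p * t - q * \<xi>) * F t)"
  proof (rule Fubini_integrable)
    \<comment> \<open>The inner integral of |k'| is itself a difference of values of the primitive
      of |k'|. Being continuous in t on a compact interval, it is bounded uniformly, and F alone
      dominates.\<close>
    have "continuous_on {0..r} (\<lambda>t. prim ?n (p * t - c))" for c
      by (rule continuous_on_compose2[OF continuous_on_prim[OF n', of UNIV]]) (auto intro!: continuous_intros)
    from this[of 0] this[of "q * x"]
    have "continuous_on {0..r} (\<lambda>t. (prim ?n (p * t) - prim ?n (p * t - q * x)) / of_real q)"
      by (intro continuous_on_divide continuous_on_diff) (use pq in auto)
    then have "bounded ((\<lambda>t. (prim ?n (p * t) - prim ?n (p * t - q * x)) / of_real q) ` {0..r})"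
      by (intro compact_imp_bounded compact_continuous_image) auto
    then obtain C where "\<forall>y \<in> (\<lambda>t. (prim ?n (p * t) - prim ?n (p * t - q * x)) / of_real q) ` {0..r}. norm y \<le> C"
      unfolding bounded_iff by blast
    then have C: "norm ((prim ?n (p * t) - prim ?n (p * t - q * x)) / of_real q) \<le> C" if "t \<in> {0..r}" for t
      using that by blast
    have meas: "(\<lambda>t. LINT \<xi>|Iv x. norm (k' (p * t - q * \<xi>) * F t)) \<in> borel_measurable (Iv r)"
      by measurable
    show "integrable (Iv r) (\<lambda>t. LINT \<xi>|Iv x. norm (case (t, \<xi>) of (t, \<xi>) \<Rightarrow> k' (p * t - q * \<xi>) * F t))"
    proof (rule Bochner_Integration.integrable_bound[where f="\<lambda>t. C * F t"])
      show "AE t in Iv r. norm (LINT \<xi>|Iv x. norm (case (t, \<xi>) of (t, \<xi>) \<Rightarrow> k' (p * t - q * \<xi>) * F t)) \<le> norm (complex_of_real C * F t)"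
      proof (rule AE_I2)
        fix t assume t: "t \<in> space (Iv r)"
        have "complex_of_real (LINT \<xi>|Iv x. norm (k' (p * t - q * \<xi>))) = (LINT \<xi>|Iv x. ?n (p * t - q * \<xi>))"
          by (simp add: integral_complex_of_real)
        also have "\<dots> = (prim ?n (p * t) - prim ?n (p * t - q * x)) / of_real q"
          by (rule LINT_Iv_affine[OF n' pq(2) x])
        finally have eq: "complex_of_real (LINT \<xi>|Iv x. norm (k' (p * t - q * \<xi>))) = (prim ?n (p * t) - prim ?n (p * t - q * x)) / of_real q" .
        have "norm (complex_of_real (LINT \<xi>|Iv x. norm (k' (p * t - q * \<xi>)))) \<le> C"
          unfolding eq by (rule C) (use t in auto)
        then have "\<bar>LINT \<xi>|Iv x. norm (k' (p * t - q * \<xi>))\<bar> \<le> C"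
          by (simp only: norm_of_real)
        then have "\<bar>LINT \<xi>|Iv x. norm (k' (p * t - q * \<xi>))\<bar> * norm (F t) \<le> \<bar>C\<bar> * norm (F t)"
          by (intro mult_right_mono) auto
        then show "norm (LINT \<xi>|Iv x. norm (case (t, \<xi>) of (t, \<xi>) \<Rightarrow> k' (p * t - q * \<xi>) * F t)) \<le> norm (complex_of_real C * F t)"
          by (simp add: norm_mult abs_mult)
      qed
    qed (use F meas in auto)
    show "AE t in Iv r. integrable (Iv x) (\<lambda>\<xi>. case (t, \<xi>) of (t, \<xi>) \<Rightarrow> k' (p * t - q * \<xi>) * F t)"
      using LINT_Iv_affine(2)[OF \<open>loc_integrable k'\<close> pq(2) x] by simp
  qed measurable
  have r1: "(LINT t|Iv r. k (p * t - q * \<xi>) * F t) = (LINT t|Iv r. k' (p * t - q * \<xi>) * F t)" for \<xi>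
  proof (rule integral_cong_AE)
    have *: "AE t in lebesgue. k (- q * \<xi> + p * t) = k' (- q * \<xi> + p * t)"
      by (rule AE_lebesgue_affine[OF kk' pq(1)])
    show "AE t in Iv r. k (p * t - q * \<xi>) * F t = k' (p * t - q * \<xi>) * F t"
      using * by (auto simp: AE_restrict_space_iff algebra_simps elim!: eventually_mono)
    have "(\<lambda>t. k (- q * \<xi> + p *\<^sub>R t)) \<in> borel_measurable lebesgue"
      by (rule borel_measurable_affine[OF kL pq(1)])
    then have "(\<lambda>t. k (p * t - q * \<xi>)) \<in> borel_measurable (Iv r)"
      by (intro measurable_restrict_space1) (simp add: algebra_simps)
    then show "(\<lambda>t. k (p * t - q * \<xi>) * F t) \<in> borel_measurable (Iv r)"
      by measurable
  qed measurable
  have r2: "prim k y = prim k' y" for y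
    unfolding prim_def
  proof (rule integral_cong_AE)
    have I: "integrable lebesgue (\<lambda>t. (indicator {0<..<y} t - indicator {y<..<0} t) *\<^sub>R k t)" if "loc_integrable k" for k
      unfolding scaleR_diff_left by (intro Bochner_Integration.integrable_diff set_integrable_loc that)
    show "(\<lambda>t. (indicator {0<..<y} t - indicator {y<..<0} t) *\<^sub>R k t) \<in> borel_measurable lebesgue"
     "(\<lambda>t. (indicator {0<..<y} t - indicator {y<..<0} t) *\<^sub>R k' t) \<in> borel_measurable lebesgue"
      using I[OF k] I[OF \<open>loc_integrable k'\<close>] by auto
    show "AE t in lebesgue. (indicator {0<..<y} t - indicator {y<..<0} t) *\<^sub>R k t = (indicator {0<..<y} t - indicator {y<..<0} t) *\<^sub>R k' t"
      using kk' by eventually_elim simp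
  qed
  have "(LINT \<xi>|Iv x. (LINT t|Iv r. k' (p * t - q * \<xi>) * F t)) = (LINT t|Iv r. (LINT \<xi>|Iv x. k' (p * t - q * \<xi>) * F t))"
    using Fubini_integral[OF I] by simp
  also have "\<dots> = (LINT t|Iv r. (prim k' (p * t) - prim k' (p * t - q * x)) / of_real q * F t)"
    by (simp add: LINT_Iv_affine(1)[OF \<open>loc_integrable k'\<close> pq(2) x])
  finally show ?th1 by (simp add: r1 r2)
  show ?th2 using integrable_snd[OF I] by (simp add: r1)
qed

section \<open>Phragmen--Lindelof and truncated Laplace transforms\<close>

text \<open>On the principal branch, Re w^rho = |w|^rho cos(rho arg w), and |arg w| is at most
  arctan m in the sector. The cosine decreases on [0, pi], so its worst value is attained on the
  boundary rays.\<close>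

lemma Re_powr_nonneg:
  assumes w: "0 < Re w" "\<bar>Im w\<bar> \<le> m * Re w" and rho: "0 < \<rho>" "\<rho> * arctan m < pi / 2"
  shows "norm w powr \<rho> * cos (\<rho> * arctan m) \<le> Re (w powr of_real \<rho>)"
proof -
  have w0: "w \<noteq> 0" using w by auto
  have ImLn: "Im (Ln w) = arctan (Im w / Re w)"
    using w by (simp add: Arg_eq_Im_Ln[symmetric] w0 arg_conv_arctan)
  have "\<bar>Im w / Re w\<bar> \<le> m" using w by (simp add: field_simps abs_divide)
  then have a: "\<bar>Im (Ln w)\<bar> \<le> arctan m" 
    unfolding ImLn by (metis abs_le_iff arctan_le_iff arctan_minus minus_le_iff)
  have "w powr of_real \<rho> = exp (of_real \<rho> * Ln w)" using w0 by (simp add: powr_def)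
  then have "Re (w powr of_real \<rho>) = exp (\<rho> * Re (Ln w)) * cos (\<rho> * Im (Ln w))"
    by (simp add: Re_exp)
  also have "exp (\<rho> * Re (Ln w)) = norm w powr \<rho>" using w0 by (simp add: powr_def)
  finally have eq: "Re (w powr of_real \<rho>) = norm w powr \<rho> * cos (\<rho> * Im (Ln w))" .
  have "cos (\<rho> * arctan m) \<le> cos \<bar>\<rho> * Im (Ln w)\<bar>"
  proof (rule cos_monotone_0_pi_le)
    show "\<rho> * arctan m \<le> pi" using rho pi_gt_zero by linarith
  qed (use a rho in \<open>auto simp: abs_mult\<close>)
  then show ?thesis unfolding eq by (simp add: mult_left_mono)
qed

lemma exp_powr_dominates:
  fixes M B e \<rho> :: real
  assumes "0 < e" "1 < \<rho>"
  shows "((\<lambda>R. M * exp (B * R) * exp (- e * R powr \<rho>)) \<longlongrightarrow> 0) at_top"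
proof -
  have "filterlim (\<lambda>R. e * R powr \<rho> - B * R) at_top at_top"
    using assms by real_asymp
  then have "filterlim (\<lambda>R. - (e * R powr \<rho> - B * R)) at_bot at_top"
    by (simp only: filterlim_uminus_at_top)
  then have "((\<lambda>R. exp (- (e * R powr \<rho> - B * R))) \<longlongrightarrow> 0) at_top"
    by (rule filterlim_compose[OF exp_at_bot])
  then have "((\<lambda>R. M * exp (- (e * R powr \<rho> - B * R))) \<longlongrightarrow> M * 0) at_top"
    by (rule tendsto_mult_left)
  then show ?thesis by (simp add: exp_add[symmetric] mult.assoc algebra_simps)
qed

text \<open>The auxiliary factor is \<open>exp (- \<epsilon> (w + 1)\<^sup>\<rho>)\<close> with \<open>\<rho> > 1\<close>; the shift by \<open>1\<close> keeps it
  holomorphic at the vertex.\<close>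

lemma Phragmen_Lindelof_sector:
  fixes F :: "complex \<Rightarrow> complex"
  assumes hol: "F holomorphic_on UNIV"
    and growth: "\<And>w. norm (F w) \<le> M * exp (b * norm w)"
    and bd: "\<And>w. 0 \<le> Re w \<Longrightarrow> \<bar>Im w\<bar> = m * Re w \<Longrightarrow> norm (F w) \<le> C"
    and m: "0 < m" and z: "\<bar>Im z\<bar> \<le> m * Re z"
  shows "norm (F z) \<le> C"
proof -
  have at: "0 < arctan m" "arctan m < pi / 2" using m arctan_ubound[of m] by auto
  \<comment> \<open>The midpoint of 1 and (pi/2) / arctan m. Exceeding 1 lets the auxiliary factor
    beat growth of exponential type, and staying below the second number keeps Re (w + 1)^rho
    positive in the sector.\<close>
  define \<rho> where "\<rho> = (1 + pi / 2 / arctan m) / 2"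
  have rho: "1 < \<rho>" "\<rho> * arctan m < pi / 2"
  proof -
    have "1 < pi / 2 / arctan m" using at by simp
    then show "1 < \<rho>" by (simp add: \<rho>_def)
    have "\<rho> * arctan m = (arctan m + pi / 2) / 2" using at by (simp add: \<rho>_def add_divide_distrib distrib_right)
    then show "\<rho> * arctan m < pi / 2" using at by simp
  qed
  define c where "c = cos (\<rho> * arctan m)"
  have c: "0 < c" unfolding c_def using rho at by (intro cos_gt_zero) auto
  have Rez: "0 \<le> Re z" using z mult_pos_neg[OF m, of "Re z"] by linarith
  have C0: "0 \<le> C" using bd[of 0] by (auto intro: order_trans[OF norm_ge_zero])
  have M0: "0 \<le> M" using growth[of 0] by (auto intro: order_trans[OF norm_ge_zero])
  define G where "G \<epsilon> w = F w * exp (- of_real \<epsilon> * (w + 1) powr of_real \<rho>)" for \<epsilon> w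
  have Gn: "norm (G \<epsilon> w) \<le> norm (F w) * exp (- \<epsilon> * c * (norm (w + 1)) powr \<rho>)" 
    if "0 < \<epsilon>" "0 \<le> Re w" "\<bar>Im w\<bar> \<le> m * Re w" for \<epsilon> w
  proof -
    have "norm (w + 1) powr \<rho> * c \<le> Re ((w + 1) powr of_real \<rho>)"
      unfolding c_def using that rho m by (intro Re_powr_nonneg) (auto simp: distrib_left)
    then have "\<epsilon> * (norm (w + 1) powr \<rho> * c) \<le> \<epsilon> * Re ((w + 1) powr of_real \<rho>)"
      using that by (intro mult_left_mono) auto
    then have "exp (Re (- of_real \<epsilon> * (w + 1) powr of_real \<rho>)) \<le> exp (- \<epsilon> * c * (norm (w + 1)) powr \<rho>)"
      by (simp add: mult.commute mult.left_commute)
    then show ?thesis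
      unfolding G_def norm_mult norm_exp_eq_Re by (rule mult_left_mono) simp
  qed
  have key: "norm (F z) \<le> C * norm (exp (of_real \<epsilon> * (z + 1) powr of_real \<rho>))" if e: "0 < \<epsilon>" for \<epsilon>
  proof -
    \<comment> \<open>In the sector \<open>norm w \<le> (1 + m) * Re w\<close>, so on the side
      \<open>Re w = R\<close> the growth bound for F becomes
      \<open>M * exp (?B * R)\<close>.\<close>
    let ?B = "\<bar>b\<bar> * (1 + m)" and ?e = "\<epsilon> * c"
    have ec: "0 < ?e" using e c by simp
    have lim: "((\<lambda>R. M * exp (?B * R) * exp (- ?e * R powr \<rho>)) \<longlongrightarrow> 0) at_top"
      by (rule exp_powr_dominates[OF ec rho(1)])
    have "norm (G \<epsilon> z) \<le> C + \<delta>" if d: "0 < \<delta>" for \<delta>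
    proof -
      have "\<forall>\<^sub>F R in at_top. M * exp (?B * R) * exp (- ?e * R powr \<rho>) < \<delta> \<and> R > Re z \<and> R > 0"
        using order_tendstoD(2)[OF lim d] eventually_gt_at_top[of "Re z"] eventually_gt_at_top[of 0] by eventually_elim auto
      then have "\<exists>R. M * exp (?B * R) * exp (- ?e * R powr \<rho>) < \<delta> \<and> R > Re z \<and> R > 0"
        by (rule eventually_happens'[OF trivial_limit_at_top_linorder])
      then obtain R where R: "M * exp (?B * R) * exp (- ?e * R powr \<rho>) < \<delta>" "R > Re z" "R > 0"
        by blast
      define S where "S = {w. \<bar>Im w\<bar> \<le> m * Re w \<and> Re w \<le> R}"
      define S' where "S' = {w. \<bar>Im w\<bar> < m * Re w \<and> Re w < R}"
      have Re0: "0 \<le> Re w" if "w \<in> S" for w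
        using that mult_pos_neg[OF m, of "Re w"] unfolding S_def mem_Collect_eq by linarith
      have nS: "norm w \<le> (1 + m) * Re w" if "w \<in> S" for w
        using that cmod_le[of w] Re0[OF that] by (simp add: S_def algebra_simps)
      have holG: "G \<epsilon> holomorphic_on {w. 0 \<le> Re w}"
        unfolding G_def using hol
        by (intro holomorphic_intros holomorphic_on_subset[OF hol]) (auto simp: complex_nonpos_Reals_iff)
      have closed: "closed S" unfolding S_def
        by (intro closed_Collect_conj closed_Collect_le continuous_intros)
      have "open S'" unfolding S'_def
        by (intro open_Collect_conj open_Collect_less continuous_intros)
      then have int: "S' \<subseteq> interior S" by (intro interior_maximal) (auto simp: S_def S'_def)
      show ?thesis
      \<comment> \<open>On the triangle \<open>S\<close> the slanted sides contribute at most C and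
        the far side \<open>Re w = R\<close> less than \<delta>.\<close>
      proof (rule maximum_modulus_frontier[of "G \<epsilon>" S])
        show "G \<epsilon> holomorphic_on interior S"
          by (rule holomorphic_on_subset[OF holG]) (use Re0 interior_subset in auto)
        show "continuous_on (closure S) (G \<epsilon>)"
          by (rule continuous_on_subset[OF holomorphic_on_imp_continuous_on[OF holG]]) (use Re0 closed in auto)
        show "bounded S"
          unfolding bounded_iff
        proof (intro exI ballI)
          fix w assume "w \<in> S"
          then have "(1 + m) * Re w \<le> (1 + m) * R" using m by (simp add: S_def)
          then show "norm w \<le> (1 + m) * R" using nS[OF \<open>w \<in> S\<close>] by simp
        qed
        show "z \<in> S" using z R by (simp add: S_def)
        fix w assume w: "w \<in> frontier S"
        have wS: "w \<in> S" using w closed by (auto simp: frontier_def)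
        have "w \<notin> S'" using w int by (auto simp: frontier_def)
        then have "\<bar>Im w\<bar> = m * Re w \<or> Re w = R" using wS by (simp add: S_def S'_def) linarith
        then consider "\<bar>Im w\<bar> = m * Re w" | "Re w = R" by blast
        then show "norm (G \<epsilon> w) \<le> C + \<delta>"
        proof cases
          case 1
          have "norm (G \<epsilon> w) \<le> norm (F w) * exp (- ?e * (norm (w + 1)) powr \<rho>)"
            using Gn[OF e Re0[OF wS]] wS by (simp add: S_def)
          also have "\<dots> \<le> norm (F w) * 1"
            using ec by (intro mult_left_mono) auto
          also have "\<dots> \<le> C" using bd[OF Re0[OF wS] 1] by simp
          finally show ?thesis using d by simp
        next
          case 2
          have "R \<le> Re (w + 1)" using 2 by simp
          also have "\<dots> \<le> norm (w + 1)" by (rule complex_Re_le_cmod)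
          finally have R1: "R powr \<rho> \<le> norm (w + 1) powr \<rho>" using R rho by (intro powr_mono2) auto
          have "norm (G \<epsilon> w) \<le> norm (F w) * exp (- ?e * (norm (w + 1)) powr \<rho>)"
            using Gn[OF e Re0[OF wS]] wS by (simp add: S_def)
          also have "\<dots> \<le> norm (F w) * exp (- ?e * R powr \<rho>)"
            using mult_left_mono[OF R1, of ?e] ec by (intro mult_left_mono) auto
          also have "\<dots> \<le> M * exp (?B * R) * exp (- ?e * R powr \<rho>)"
          proof (intro mult_right_mono)
            have "b * norm w \<le> \<bar>b\<bar> * norm w" by (intro mult_right_mono) auto
            also have "\<dots> \<le> \<bar>b\<bar> * ((1 + m) * R)" using nS[OF wS] 2 by (intro mult_left_mono) auto
            finally have "exp (b * norm w) \<le> exp (?B * R)" by (simp add: mult_ac)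
            then show "norm (F w) \<le> M * exp (?B * R)"
              using growth[of w] M0 by (meson mult_left_mono order_trans)
          qed simp
          also have "\<dots> \<le> C + \<delta>" using R C0 by simp
          finally show ?thesis .
        qed
      qed
    qed
    then have "norm (G \<epsilon> z) \<le> C" by (rule field_le_epsilon)
    then have "norm (F z) * norm (exp (- of_real \<epsilon> * (z + 1) powr of_real \<rho>)) \<le> C"
      by (simp only: G_def norm_mult)
    then have "norm (F z) * exp (- (\<epsilon> * Re ((z + 1) powr of_real \<rho>))) \<le> C" by simp
    then show ?thesis by (simp add: exp_minus field_simps)
  qed
  \<comment> \<open>With z fixed, \<epsilon> tends to 0 and the auxiliary factor disappears from
    \<open>key\<close>.\<close>
  have "((\<lambda>\<epsilon>. C * norm (exp (of_real \<epsilon> * (z + 1) powr of_real \<rho>))) \<longlongrightarrow> C * norm (exp (of_real 0 * (z + 1) powr of_real \<rho>))) (at_right 0)"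
    by (intro tendsto_intros)
  moreover have "\<forall>\<^sub>F \<epsilon> in at_right 0. norm (F z) \<le> C * norm (exp (of_real \<epsilon> * (z + 1) powr of_real \<rho>))"
    using eventually_at_right_less[of 0] by (rule eventually_mono) (rule key)
  ultimately have "norm (F z) \<le> C * norm (exp (of_real 0 * (z + 1) powr of_real \<rho>))"
    by (rule tendsto_lowerbound) simp
  then show ?thesis by simp
qed

text \<open>The combinations of exp(n s) are the polynomials in y = exp(s). By Stone-Weierstrass
  they approximate h uniformly on [0, a], so h is orthogonal to itself. The exponentials are real,
  which permits treating real and imaginary parts separately.\<close>

lemma Laplace_kernel_trivial:
  fixes h :: "real \<Rightarrow> complex"
  assumes a: "0 < a" and h: "continuous_on {0..a} h"
    and 0: "\<And>n::nat. integral {0..a} (\<lambda>s. exp (of_nat n * of_real s) * h s) = 0"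
    and x: "x \<in> {0..a}"
  shows "h x = 0"
proof -
  have real: "g x = 0" if g: "continuous_on {0..a} g" and g0: "\<And>n::nat. integral {0..a} (\<lambda>s. exp (real n * s) * g s) = 0" for g :: "real \<Rightarrow> real"
  proof -
    have P: "integral {0..a} (\<lambda>s. p (exp s) * g s) = 0" if p: "real_polynomial_function p" for p
    proof -
      obtain c n where p: "p = (\<lambda>x. \<Sum>i\<le>n. c i * x ^ i)"
        using p unfolding real_polynomial_function_iff_sum by blast
      have "integral {0..a} (\<lambda>s. p (exp s) * g s) = integral {0..a} (\<lambda>s. \<Sum>i\<le>n. c i * (exp (real i * s) * g s))"
        by (simp add: p sum_distrib_right exp_of_nat_mult mult.assoc)
      also have "\<dots> = (\<Sum>i\<le>n. integral {0..a} (\<lambda>s. c i * (exp (real i * s) * g s)))"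
        by (intro integral_sum integrable_continuous_real continuous_intros g) auto
      also have "\<dots> = 0" by (simp add: g0)
      finally show ?thesis .
    qed
    have "integral {0..a} (\<lambda>s. (g s)\<^sup>2) \<le> 0"
    proof (rule field_le_epsilon)
      fix e :: real assume e: "0 < e"
      \<comment> \<open>The summand 1 keeps the divisor in \<open>e / ?K\<close> positive even if g
        vanishes identically.\<close>
      let ?K = "integral {0..a} (\<lambda>s. \<bar>g s\<bar>) + 1"
      have K: "integral {0..a} (\<lambda>s. \<bar>g s\<bar>) \<ge> 0" by (rule integral_nonneg) (auto intro!: integrable_continuous_real continuous_intros g)
      have "continuous_on (exp ` {0..a}) (\<lambda>y. g (ln y))"
        by (rule continuous_on_compose2[OF g]) (auto intro!: continuous_intros)
      moreover have "compact (exp ` {0..a::real})" by (intro compact_continuous_image continuous_intros) auto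
      moreover have "0 < e / ?K" using e K by simp
      ultimately obtain p where p: "real_polynomial_function p" "\<And>y. y \<in> exp ` {0..a} \<Longrightarrow> \<bar>g (ln y) - p y\<bar> < e / ?K"
        using Stone_Weierstrass_real_polynomial_function[of "exp ` {0..a}" "\<lambda>y. g (ln y)" "e / ?K"] by metis
      have cp: "continuous_on {0..a} (\<lambda>s. p (exp s))"
        by (rule continuous_on_compose2[OF continuous_on_polymonial_function[of p UNIV]]) (use p in \<open>auto simp: real_polynomial_function_eq intro!: continuous_intros\<close>)
      have "integral {0..a} (\<lambda>s. (g s)\<^sup>2) = integral {0..a} (\<lambda>s. (g s)\<^sup>2) - integral {0..a} (\<lambda>s. p (exp s) * g s)"
        using P[OF p(1)] by simp
      also have "\<dots> = integral {0..a} (\<lambda>s. (g s)\<^sup>2 - p (exp s) * g s)"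
        by (intro integral_diff[symmetric] integrable_continuous_real continuous_intros g cp)
      also have "\<dots> \<le> integral {0..a} (\<lambda>s. e / ?K * \<bar>g s\<bar>)"
      proof (intro integral_le integrable_continuous_real continuous_intros g cp)
        fix s assume s: "s \<in> {0..a}"
        have "(g s)\<^sup>2 - p (exp s) * g s = (g s - p (exp s)) * g s" by (simp add: power2_eq_square algebra_simps)
        also have "\<dots> \<le> \<bar>g s - p (exp s)\<bar> * \<bar>g s\<bar>" by (metis abs_ge_self abs_mult)
        also have "\<dots> \<le> e / ?K * \<bar>g s\<bar>" using p(2)[of "exp s"] s by (intro mult_right_mono) auto
        finally show "(g s)\<^sup>2 - p (exp s) * g s \<le> e / ?K * \<bar>g s\<bar>" .
      qed
      also have "\<dots> = e / ?K * integral {0..a} (\<lambda>s. \<bar>g s\<bar>)" by simp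
      also have "\<dots> \<le> e / ?K * ?K" using e K by (intro mult_left_mono) auto
      also have "\<dots> = e" using K by simp
      finally show "integral {0..a} (\<lambda>s. (g s)\<^sup>2) \<le> 0 + e" by simp
    qed
    then have "integral {0..a} (\<lambda>s. (g s)\<^sup>2) = 0"
      by (intro antisym integral_nonneg integrable_continuous_real continuous_intros g) auto
    moreover have "(\<lambda>s. (g s)\<^sup>2) integrable_on cbox 0 a"
      by (simp add: integrable_continuous_real continuous_on_power g)
    ultimately have "((\<lambda>s. (g s)\<^sup>2) has_integral 0) (cbox 0 a)"
      using integrable_integral by fastforce
    then have "(g x)\<^sup>2 = 0" using x a
      by (intro has_integral_0_cbox_imp_0[of 0 a "\<lambda>s. (g s)\<^sup>2"]) (auto intro!: continuous_intros g)
    then show ?thesis by simp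
  qed
  have int: "(\<lambda>s. exp (of_nat n * of_real s) * h s) integrable_on {0..a}" for n
    by (intro integrable_continuous_real continuous_intros h)
  have e: "exp (of_nat n * of_real s) = complex_of_real (exp (real n * s))" for n s
    by (simp flip: exp_of_real)
  have "Re (h x) = 0"
  proof (rule real[where g="\<lambda>x. Re (h x)"])
    show "integral {0..a} (\<lambda>s. exp (real n * s) * Re (h s)) = 0" for n
      using integral_linear[OF int bounded_linear_Re, of n] 0[of n] by (simp add: o_def e)
  qed (intro continuous_intros h)
  moreover have "Im (h x) = 0"
  proof (rule real[where g="\<lambda>x. Im (h x)"])
    show "integral {0..a} (\<lambda>s. exp (real n * s) * Im (h s)) = 0" for n
      using integral_linear[OF int bounded_linear_Im, of n] 0[of n] by (simp add: o_def e)
  qed (intro continuous_intros h)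
  ultimately show ?thesis by (simp add: complex_eq_iff)
qed

text \<open>Rotation by the bisector \<mu> reduces to the symmetric sector with slope tan \<eta>,
  where \<eta> is half the opening. An opening below pi is exactly \<eta> < pi/2.\<close>

lemma Phragmen_Lindelof_angle:
  fixes G :: "complex \<Rightarrow> complex"
  assumes hol: "G holomorphic_on UNIV"
    and growth: "\<And>w. norm (G w) \<le> M * exp (b * norm w)"
    and \<theta>: "\<theta>\<^sub>1 < \<theta>\<^sub>2" "\<theta>\<^sub>2 < \<theta>\<^sub>1 + pi"
    and bd: "\<And>r. 0 \<le> r \<Longrightarrow> norm (G (of_real r * cis \<theta>\<^sub>1)) \<le> C" "\<And>r. 0 \<le> r \<Longrightarrow> norm (G (of_real r * cis \<theta>\<^sub>2)) \<le> C"
    and \<alpha>: "\<theta>\<^sub>1 \<le> \<alpha>" "\<alpha> \<le> \<theta>\<^sub>2" and r: "0 \<le> r"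
  shows "norm (G (of_real r * cis \<alpha>)) \<le> C"
proof -
  define \<mu> where "\<mu> = (\<theta>\<^sub>1 + \<theta>\<^sub>2) / 2"
  define \<eta> where "\<eta> = (\<theta>\<^sub>2 - \<theta>\<^sub>1) / 2"
  have \<eta>: "0 < \<eta>" "\<eta> < pi / 2" using \<theta> by (auto simp: \<eta>_def)
  have th: "\<theta>\<^sub>1 = \<mu> - \<eta>" "\<theta>\<^sub>2 = \<mu> + \<eta>" by (auto simp: \<mu>_def \<eta>_def field_simps)
  have c: "0 < cos \<eta>" and t: "0 < tan \<eta>" using \<eta> by (auto intro!: cos_gt_zero tan_gt_zero)
  have "norm (G (cis \<mu> * (of_real r * cis (\<alpha> - \<mu>)))) \<le> C"
  proof (rule Phragmen_Lindelof_sector[where F="\<lambda>w. G (cis \<mu> * w)" and m="tan \<eta>"])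
    show "(\<lambda>w. G (cis \<mu> * w)) holomorphic_on UNIV"
      using holomorphic_on_compose_gen[of "\<lambda>w. cis \<mu> * w" UNIV G UNIV] hol by (auto simp: o_def intro!: holomorphic_intros)
    show "norm (G (cis \<mu> * w)) \<le> M * exp (b * norm w)" for w
      using growth[of "cis \<mu> * w"] by (simp add: norm_mult)
    show "0 < tan \<eta>" by fact
    have "\<bar>\<alpha> - \<mu>\<bar> \<le> \<eta>" using \<alpha> by (auto simp: th)
    then have "sin \<bar>\<alpha> - \<mu>\<bar> * cos \<eta> \<le> sin \<eta> * cos \<bar>\<alpha> - \<mu>\<bar>"
    proof -
      have "0 \<le> sin (\<eta> - \<bar>\<alpha> - \<mu>\<bar>)" using \<open>\<bar>\<alpha> - \<mu>\<bar> \<le> \<eta>\<close> \<eta> by (intro sin_ge_zero) auto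
      then show ?thesis by (simp add: sin_diff mult_ac)
    qed
    moreover have "sin \<bar>\<alpha> - \<mu>\<bar> = \<bar>sin (\<alpha> - \<mu>)\<bar>" 
    proof -
      have pos: "0 \<le> sin \<bar>\<alpha> - \<mu>\<bar>" using \<open>\<bar>\<alpha> - \<mu>\<bar> \<le> \<eta>\<close> \<eta> by (intro sin_ge_zero) auto
      have "sin \<bar>\<alpha> - \<mu>\<bar> = sin (\<alpha> - \<mu>) \<or> sin \<bar>\<alpha> - \<mu>\<bar> = - sin (\<alpha> - \<mu>)"
        by (metis abs_if sin_minus)
      with pos show ?thesis by linarith
    qed
    ultimately have "\<bar>sin (\<alpha> - \<mu>)\<bar> \<le> tan \<eta> * cos (\<alpha> - \<mu>)"
      using c by (simp add: tan_def field_simps)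
    then show "\<bar>Im (of_real r * cis (\<alpha> - \<mu>))\<bar> \<le> tan \<eta> * Re (of_real r * cis (\<alpha> - \<mu>))"
      using mult_left_mono[OF _ r] by (simp add: abs_mult r mult.left_commute)
    fix w assume w: "0 \<le> Re w" "\<bar>Im w\<bar> = tan \<eta> * Re w"
    define s where "s = Re w / cos \<eta>"
    have s: "0 \<le> s" using w c by (simp add: s_def)
    have re: "Re w = s * cos \<eta>" using c by (simp add: s_def)
    then have "\<bar>Im w\<bar> = s * sin \<eta>" using w c by (simp add: tan_def)
    then have "Im w = s * sin \<eta> \<or> Im w = s * (- sin \<eta>)" by linarith
    then have "w = of_real s * cis \<eta> \<or> w = of_real s * cis (- \<eta>)"
      using re by (simp add: complex_eq_iff)
    then show "norm (G (cis \<mu> * w)) \<le> C"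
    proof
      assume "w = of_real s * cis \<eta>"
      then have "cis \<mu> * w = of_real s * cis \<theta>\<^sub>2" by (simp add: cis_mult th mult.left_commute[of "cis \<mu>"])
      then show ?thesis using bd(2)[OF s] by simp
    next
      assume "w = of_real s * cis (- \<eta>)"
      then have "cis \<mu> * w = of_real s * cis \<theta>\<^sub>1" by (simp add: cis_mult th mult.left_commute[of "cis \<mu>"])
      then show ?thesis using bd(1)[OF s] by simp
    qed
  qed
  moreover have "cis \<mu> * (of_real r * cis (\<alpha> - \<mu>)) = of_real r * cis \<alpha>"
    by (simp add: mult.left_commute[of "cis \<mu>"] cis_mult)
  ultimately show ?thesis by simp
qed

text \<open>The transform G has exponential type and is bounded on the left half-plane, because s is
  nonnegative. Boundedness on the imaginary axis does not control the right half-plane, as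
  exp(\<zeta>) shows. The extra ray cuts that half-plane into two sectors of opening less than pi,
  where Phragmen-Lindelof applies.\<close>

lemma Paley_Wiener_ray:
  fixes h :: "real \<Rightarrow> complex" and \<omega> :: complex
  assumes a: "0 < a" and h: "continuous_on {0..a} h" and \<omega>: "0 < Re \<omega>"
    and bd: "\<And>\<rho>. 0 \<le> \<rho> \<Longrightarrow> norm (integral {0..a} (\<lambda>s. exp (of_real \<rho> * \<omega> * of_real s) * h s)) \<le> C"
    and x: "x \<in> {0..a}"
  shows "h x = 0"
proof -
  define G where "G \<zeta> = integral {0..a} (\<lambda>s. exp (\<zeta> * of_real s) * h s)" for \<zeta>
  have h1: "(\<lambda>s. exp (\<zeta> * of_real s) * h s) integrable_on {0..a}" for \<zeta>
    by (intro integrable_continuous_real continuous_intros h)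
  have hol: "G holomorphic_on UNIV"
  proof -
    have "(\<lambda>\<zeta>. integral (cbox 0 a) (\<lambda>s. exp (\<zeta> * of_real s) * h s)) holomorphic_on UNIV"
    proof (rule leibniz_rule_holomorphic[where fx="\<lambda>\<zeta> s. of_real s * exp (\<zeta> * of_real s) * h s"])
      show "((\<lambda>\<zeta>. exp (\<zeta> * of_real s) * h s) has_field_derivative of_real s * exp (\<zeta> * of_real s) * h s) (at \<zeta> within UNIV)" for \<zeta> s
        by (auto intro!: derivative_eq_intros)
      show "(\<lambda>s. exp (\<zeta> * of_real s) * h s) integrable_on cbox 0 a" for \<zeta> using h1 by simp
      have "continuous_on (UNIV \<times> {0..a}) (\<lambda>p. h (snd p))"
        by (rule continuous_on_compose2[OF h]) (auto intro!: continuous_intros)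
      then show "continuous_on (UNIV \<times> cbox 0 a) (\<lambda>(\<zeta>, s). of_real s * exp (\<zeta> * of_real s) * h s)"
        unfolding case_prod_beta' by (auto intro!: continuous_intros)
    qed auto
    moreover have "G = (\<lambda>\<zeta>. integral (cbox 0 a) (\<lambda>s. exp (\<zeta> * of_real s) * h s))" by (simp add: G_def fun_eq_iff)
    ultimately show ?thesis by simp
  qed
  define K where "K = integral {0..a} (\<lambda>s. norm (h s))"
  have hn: "(\<lambda>s. norm (h s)) integrable_on {0..a}" by (intro integrable_continuous_real continuous_intros h)
  have le: "norm (G \<zeta>) \<le> B * K" if "\<And>s. s \<in> {0..a} \<Longrightarrow> exp (Re \<zeta> * s) \<le> B" for \<zeta> B
  proof -
    have "norm (G \<zeta>) \<le> integral {0..a} (\<lambda>s. B * norm (h s))"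
      unfolding G_def by (intro integral_norm_bound_integral h1 integrable_on_mult_right hn) (use that in \<open>auto simp: norm_mult mult_right_mono\<close>)
    then show ?thesis by (simp add: K_def)
  qed
  have growth: "norm (G \<zeta>) \<le> K * exp (a * norm \<zeta>)" for \<zeta>
  proof -
    have "Re \<zeta> * s \<le> a * norm \<zeta>" if "s \<in> {0..a}" for s
    proof -
      have "Re \<zeta> * s \<le> norm \<zeta> * s" using that complex_Re_le_cmod by (intro mult_right_mono) auto
      also have "\<dots> \<le> norm \<zeta> * a" using that by (intro mult_left_mono) auto
      finally show ?thesis by (simp add: mult.commute)
    qed
    then show ?thesis using le[of \<zeta> "exp (a * norm \<zeta>)"] by (simp add: mult.commute)
  qed
  have left: "norm (G \<zeta>) \<le> K" if "Re \<zeta> \<le> 0" for \<zeta>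
    using le[of \<zeta> 1] that by (simp add: mult_nonpos_nonneg)
  define C' where "C' = max C K"
  define \<psi> where "\<psi> = Arg \<omega>"
  have "\<bar>\<psi>\<bar> < pi/2" unfolding \<psi>_def using Arg_Re_pos \<omega> by blast
  then have \<psi>: "- (pi/2) < \<psi>" "\<psi> < pi/2" by linarith+
  have w0: "\<omega> \<noteq> 0" using \<omega> by auto
  have rays: "norm (G (of_real r * cis \<psi>)) \<le> C'" "norm (G (of_real r * cis (pi/2))) \<le> C'" "norm (G (of_real r * cis (-(pi/2)))) \<le> C'"
    if r: "0 \<le> r" for r
  proof -
    have "of_real r * cis \<psi> = of_real (r / norm \<omega>) * \<omega>"
      using rcis_cmod_Arg[of \<omega>] w0 by (simp add: \<psi>_def rcis_def field_simps)
    then show "norm (G (of_real r * cis \<psi>)) \<le> C'"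
      using bd[of "r / norm \<omega>"] r by (simp add: G_def C'_def)
    show "norm (G (of_real r * cis (pi/2))) \<le> C'" "norm (G (of_real r * cis (-(pi/2)))) \<le> C'"
      using left[of "of_real r * cis (pi/2)"] left[of "of_real r * cis (-(pi/2))"] by (auto simp: C'_def)
  qed
  have right: "norm (G \<zeta>) \<le> C'" if z: "0 < Re \<zeta>" for \<zeta>
  proof -
    have \<zeta>: "\<zeta> = of_real (norm \<zeta>) * cis (Arg \<zeta>)" using rcis_cmod_Arg[of \<zeta>] by (simp add: rcis_def)
    have "\<bar>Arg \<zeta>\<bar> < pi/2" using Arg_Re_pos z by blast
    then have A: "-(pi/2) < Arg \<zeta>" "Arg \<zeta> < pi/2" by linarith+
    show ?thesis
    proof (cases "\<psi> \<le> Arg \<zeta>")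
      case True
      show ?thesis
        by (subst \<zeta>, rule Phragmen_Lindelof_angle[OF hol growth _ _ rays(1,2) True]) (use A \<psi> in auto)
    next
      case False
      then have F: "Arg \<zeta> \<le> \<psi>" by simp
      show ?thesis
        by (subst \<zeta>, rule Phragmen_Lindelof_angle[OF hol growth _ _ rays(3,1) _ F]) (use A \<psi> in auto)
    qed
  qed
  have "norm (G \<zeta>) \<le> C'" for \<zeta>
    using left[of \<zeta>] right[of \<zeta>] by (cases "0 < Re \<zeta>") (auto simp: C'_def)
  then have "bounded (range G)" by (auto simp: bounded_iff)
  then obtain c where c: "\<And>z. G z = c"
    using Liouville_theorem[OF hol] by (auto simp: constant_on_def)
  \<comment> \<open>G is known to be constant, but its value is not yet known. Differences G(n+1) -
    G(n) remove the constant and are the moments of (exp(s) - 1) h(s), whose first factor vanishes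
    only at s = 0; continuity of h covers that point.\<close>
  have *: "(exp (of_real s) - 1) * h s = 0" if "s \<in> {0..a}" for s
  proof (rule Laplace_kernel_trivial[OF a _ _ that])
    show "continuous_on {0..a} (\<lambda>s. (exp (complex_of_real s) - 1) * h s)" by (intro continuous_intros h)
    fix n :: nat
    have "integral {0..a} (\<lambda>s. exp (of_nat n * of_real s) * ((exp (of_real s) - 1) * h s)) =
      integral {0..a} (\<lambda>s. exp (of_nat (Suc n) * of_real s) * h s - exp (of_nat n * of_real s) * h s)"
    proof -
      have "exp (of_nat n * of_real s) * ((exp (of_real s) - 1) * h s) = exp (of_nat (Suc n) * of_real s) * h s - exp (of_nat n * of_real s) * h s" for s
        unfolding of_nat_Suc distrib_right exp_add by (simp add: left_diff_distrib right_diff_distrib mult.commute mult.left_commute)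
      then show ?thesis by presburger
    qed
    also have "\<dots> = G (of_nat (Suc n)) - G (of_nat n)"
      unfolding G_def by (intro integral_diff h1)
    finally show "integral {0..a} (\<lambda>s. exp (of_nat n * of_real s) * ((exp (of_real s) - 1) * h s)) = 0"
      by (simp add: c)
  qed
  have pos: "h s = 0" if "s \<in> {0<..a}" for s
  proof -
    have "exp (complex_of_real s) \<noteq> 1" using that by (simp add: complex_eq_iff Re_exp)
    then show ?thesis using *[of s] that by auto
  qed
  have "h ` closure {0<..a} \<subseteq> {0}"
  proof (rule image_closure_subset)
    show "continuous_on (closure {0<..a}) h" using h a by simp
  qed (use pos in auto)
  then have "h ` {0..a} \<subseteq> {0}" using a by simp
  then show ?thesis using x by blast
qed

text \<open>Bounded increments make V grow at most linearly, so exp(i z y) V(y) tends to 0. That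
  product is the truncated transform of \<Phi> - \<kappa>, and the transform of the constant \<Phi>
  is i \<Phi> / z. No growth condition on \<kappa> itself enters, and the convergence is only
  conditional.\<close>

lemma tendsto_Laplace_of_bounded_increments:
  fixes \<kappa> :: "real \<Rightarrow> complex" and z \<Phi> :: complex
  assumes z: "0 < Im z" and \<kappa>: "continuous_on {0..} \<kappa>"
    and V: "\<And>y. 0 \<le> y \<Longrightarrow> V y = exp (- (\<i> * z * of_real y)) * integral {0..y} (\<lambda>t. exp (\<i> * z * of_real t) * (\<Phi> - \<kappa> t))"
    and bd: "\<And>y. 0 \<le> y \<Longrightarrow> norm (V (y + 1) - V y) \<le> C"
  shows "((\<lambda>y. integral {0..y} (\<lambda>t. exp (\<i> * z * of_real t) * \<kappa> t)) \<longlongrightarrow> \<i> * \<Phi> / z) at_top"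
proof -
  let ?e = "\<lambda>t. exp (\<i> * z * complex_of_real t)"
  have z0: "z \<noteq> 0" using z by auto
  have \<kappa>': "continuous_on {0..y} \<kappa>" for y by (rule continuous_on_subset[OF \<kappa>]) auto
  have int: "(\<lambda>t. ?e t * (\<Phi> - \<kappa> t)) integrable_on {0..y}" "(\<lambda>t. ?e t * \<Phi>) integrable_on {0..y}" "(\<lambda>t. ?e t * \<kappa> t) integrable_on {0..y}" for y
    by (intro integrable_continuous_real continuous_intros \<kappa>')+
  have C0: "0 \<le> C" using order_trans[OF norm_ge_zero bd[of 0]] by simp
  have "continuous_on {0..1} (\<lambda>y. exp (- (\<i> * z * of_real y)) * integral {0..y} (\<lambda>t. ?e t * (\<Phi> - \<kappa> t)))"
    by (intro continuous_intros indefinite_integral_continuous_1 int)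
  then have "continuous_on {0..1} V"
    by (rule continuous_on_eq) (use V in auto)
  then have "bounded (V ` {0..1})" by (intro compact_imp_bounded compact_continuous_image) auto
  then obtain B where B: "\<And>y. y \<in> {0..1} \<Longrightarrow> norm (V y) \<le> B" unfolding bounded_iff by blast
  have step: "norm (V (y + real n)) \<le> B + C * real n" if "y \<in> {0..1}" for y n
  proof (induction n)
    case 0
    then show ?case using B that by simp
  next
    case (Suc n)
    have "norm (V (y + real n + 1)) \<le> norm (V (y + real n + 1) - V (y + real n)) + norm (V (y + real n))"
      by (metis diff_add_cancel norm_triangle_ineq)
    also have "\<dots> \<le> C + (B + C * real n)" using Suc bd[of "y + real n"] that by (intro add_mono) auto
    finally show ?case by (simp add: algebra_simps)
  qed
  have grow: "norm (V y) \<le> B + C * y" if "0 \<le> y" for y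
  proof -
    have "y = (y - real (nat \<lfloor>y\<rfloor>)) + real (nat \<lfloor>y\<rfloor>)" by simp
    moreover have "y - real (nat \<lfloor>y\<rfloor>) \<in> {0..1}" using that by (simp; linarith)
    ultimately have "norm (V y) \<le> B + C * real (nat \<lfloor>y\<rfloor>)" using step by metis
    also have "\<dots> \<le> B + C * y" using that C0 by (intro add_left_mono mult_left_mono) auto
    finally show ?thesis .
  qed
  have "((\<lambda>y. ?e y * V y) \<longlongrightarrow> 0) at_top"
  proof (rule Lim_null_comparison)
    show "\<forall>\<^sub>F y in at_top. norm (?e y * V y) \<le> exp (- Im z * y) * (B + C * y)"
      using eventually_ge_at_top[of 0]
    proof eventually_elim
      case (elim y)
      have "norm (?e y) = exp (- Im z * y)" by simp
      then show ?case unfolding norm_mult by (simp add: grow elim mult_left_mono)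
    qed
    show "((\<lambda>y. exp (- Im z * y) * (B + C * y)) \<longlongrightarrow> 0) at_top"
      using z by real_asymp
  qed
  then have 1: "((\<lambda>y. integral {0..y} (\<lambda>t. ?e t * (\<Phi> - \<kappa> t))) \<longlongrightarrow> 0) at_top"
  proof (rule Lim_transform_eventually)
    show "\<forall>\<^sub>F y in at_top. ?e y * V y = integral {0..y} (\<lambda>t. ?e t * (\<Phi> - \<kappa> t))"
      using eventually_ge_at_top[of 0] by eventually_elim (simp add: V exp_minus)
  qed
  have "((\<lambda>y. (?e y - 1) * \<Phi> / (\<i> * z)) \<longlongrightarrow> (0 - 1) * \<Phi> / (\<i> * z)) at_top"
  proof (intro tendsto_intros)
    show "(?e \<longlongrightarrow> 0) at_top"
    proof (rule Lim_null_comparison)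
      show "\<forall>\<^sub>F y in at_top. norm (?e y) \<le> exp (- Im z * y)" by simp
      show "((\<lambda>y. exp (- Im z * y)) \<longlongrightarrow> 0) at_top" using z by real_asymp
    qed
  qed (use z0 in auto)
  then have 2: "((\<lambda>y. integral {0..y} (\<lambda>t. ?e t * \<Phi>)) \<longlongrightarrow> \<i> * \<Phi> / z) at_top"
  proof (rule tendsto_eq_rhs[OF Lim_transform_eventually])
    show "\<forall>\<^sub>F y in at_top. (?e y - 1) * \<Phi> / (\<i> * z) = integral {0..y} (\<lambda>t. ?e t * \<Phi>)"
      using eventually_ge_at_top[of 0]
    proof eventually_elim
      case (elim y)
      have hi: "((\<lambda>t. ?e t * \<Phi>) has_integral ?e y * \<Phi> / (\<i> * z) - ?e 0 * \<Phi> / (\<i> * z)) {0..y}"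
      proof (rule fundamental_theorem_of_calculus)
        fix t assume "t \<in> {0..y}"
        have "((\<lambda>w. exp (\<i> * z * w) * \<Phi> / (\<i> * z)) has_field_derivative exp (\<i> * z * of_real t) * \<Phi>) (at (of_real t))"
          using z0 by (auto intro!: derivative_eq_intros)
        then show "((\<lambda>a. ?e a * \<Phi> / (\<i> * z)) has_vector_derivative ?e t * \<Phi>) (at t within {0..y})"
          by (rule has_vector_derivative_real_field)
      qed (use elim in auto)
      show ?case unfolding integral_unique[OF hi] by (simp add: diff_divide_distrib left_diff_distrib)
    qed
    show "(0 - 1) * \<Phi> / (\<i> * z) = \<i> * \<Phi> / z" using z0 by (simp add: field_simps)
  qed
  have "integral {0..y} (\<lambda>t. ?e t * \<kappa> t) = integral {0..y} (\<lambda>t. ?e t * \<Phi>) - integral {0..y} (\<lambda>t. ?e t * (\<Phi> - \<kappa> t))" for y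
    by (subst integral_diff[symmetric, OF int(2,1)]) (simp add: algebra_simps)
  then show ?thesis using tendsto_diff[OF 2 1] by simp
qed

text \<open>Abel's argument: convergence at z = i makes the partial integrals \<open>N\<close> with
  weight exp(-t) bounded. Integration by parts against exp(\<zeta> t) with \<zeta> = i (z - i),
  whose real part is -(Im z - 1), gives two boundary terms, the 2 in the bound, and an integral with
  the factor |\<zeta>| / (Im z - 1).\<close>

lemma Laplace_tail_bound:
  fixes q :: "real \<Rightarrow> complex"
  assumes q: "continuous_on {0..} q"
    and lim: "((\<lambda>y. integral {0..y} (\<lambda>t. exp (- of_real t) * q t)) \<longlongrightarrow> L) at_top"
  obtains B where "0 \<le> B" "\<And>z a Y. 1 < Im z \<Longrightarrow> 0 \<le> a \<Longrightarrow> a \<le> Y \<Longrightarrow>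
     norm (integral {a..Y} (\<lambda>t. exp (\<i> * z * of_real t) * q t)) \<le> B * exp (- (Im z - 1) * a) * (2 + norm (z - \<i>) / (Im z - 1))"
proof -
  define N where "N y = integral {0..y} (\<lambda>t. exp (- of_real t) * q t)" for y
  have q': "continuous_on {0..y} q" for y by (rule continuous_on_subset[OF q]) auto
  have cN: "continuous_on {0..y} N" for y
    unfolding N_def by (intro indefinite_integral_continuous_1 integrable_continuous_real continuous_intros q')
  have "\<forall>\<^sub>F y in at_top. norm (N y) < norm L + 1"
    using tendsto_norm[OF lim] unfolding N_def by (rule order_tendstoD) simp
  then obtain Y0 where Y0: "\<And>y. y \<ge> Y0 \<Longrightarrow> norm (N y) < norm L + 1"
    by (auto simp: eventually_at_top_linorder)
  have "bounded (N ` {0..Y0})" by (intro compact_imp_bounded compact_continuous_image cN) auto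
  then obtain B0 where B0: "\<And>y. y \<in> {0..Y0} \<Longrightarrow> norm (N y) \<le> B0" unfolding bounded_iff by blast
  define B where "B = max (norm L + 1) B0"
  have NB: "norm (N y) \<le> B" if "0 \<le> y" for y
    using Y0[of y] B0[of y] that by (cases "y \<le> Y0") (auto simp: B_def)
  have B: "0 \<le> B" using NB[of 0] by (auto intro: order_trans[OF norm_ge_zero])
  show ?thesis
  proof (rule that[OF B])
    fix z :: complex and a Y :: real assume *: "1 < Im z" "0 \<le> a" "a \<le> Y"
    define \<zeta> where "\<zeta> = \<i> * (z - \<i>)"
    define \<sigma> where "\<sigma> = Im z - 1"
    have \<sigma>: "Re \<zeta> = - \<sigma>" "0 < \<sigma>" using * by (auto simp: \<zeta>_def \<sigma>_def)
    have n\<zeta>: "norm \<zeta> = norm (z - \<i>)" by (simp add: \<zeta>_def norm_mult)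
    let ?e = "\<lambda>t. exp (\<zeta> * complex_of_real t)"
    have ne: "norm (?e t) = exp (- \<sigma> * t)" for t by (simp add: \<sigma>)
    have cNa: "continuous_on {a..Y} N" by (rule continuous_on_subset[OF cN[of Y]]) (use * in auto)
    let ?I = "integral {a..Y} (\<lambda>t. N t * (\<zeta> * ?e t))"
    have "((\<lambda>t. (exp (- of_real t) * q t) * ?e t) has_integral N Y * ?e Y - N a * ?e a - ?I) {a..Y}"
    proof (rule integration_by_parts_interior[OF bounded_bilinear_mult, where f=N and g="?e"])
      show "continuous_on {a..Y} ?e" by (intro continuous_intros)
      show "continuous_on {a..Y} N" by fact
      show "a \<le> Y" using * by simp
      fix t assume t: "t \<in> {a<..<Y}"
      have "((\<lambda>w. exp (\<zeta> * w)) has_field_derivative \<zeta> * exp (\<zeta> * of_real t)) (at (of_real t))"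
        by (auto intro!: derivative_eq_intros)
      then show "(?e has_vector_derivative \<zeta> * ?e t) (at t)"
        using has_vector_derivative_real_field by blast
      have "(N has_vector_derivative exp (- of_real t) * q t) (at t within {0..Y})"
        unfolding N_def by (rule integral_has_vector_derivative) (use t * in \<open>auto intro!: continuous_intros q'\<close>)
      then show "(N has_vector_derivative exp (- of_real t) * q t) (at t)"
        using t * by (simp add: at_within_Icc_at)
    next
      have "(\<lambda>t. N t * (\<zeta> * ?e t)) integrable_on {a..Y}"
        by (intro integrable_continuous_real continuous_intros cNa)
      then show "((\<lambda>t. N t * (\<zeta> * ?e t)) has_integral N Y * ?e Y - N a * ?e a - (N Y * ?e Y - N a * ?e a - ?I)) {a..Y}"
        by (simp add: has_integral_integrable_integral)
    qed
    moreover have "(exp (- of_real t) * q t) * ?e t = exp (\<i> * z * of_real t) * q t" for t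
    proof -
      have "\<i> * z * of_real t = - of_real t + \<zeta> * of_real t" by (simp add: \<zeta>_def algebra_simps)
      then have "exp (\<i> * z * of_real t) = exp (- of_real t) * ?e t" by (simp only: exp_add)
      then show ?thesis by simp
    qed
    ultimately have eq: "integral {a..Y} (\<lambda>t. exp (\<i> * z * of_real t) * q t) = N Y * ?e Y - N a * ?e a - ?I"
      by (simp add: integral_unique)
    have "((\<lambda>t. exp (- \<sigma> * t)) has_integral (- exp (- \<sigma> * Y) / \<sigma>) - (- exp (- \<sigma> * a) / \<sigma>)) {a..Y}"
      using \<sigma> * by (intro fundamental_theorem_of_calculus) 
        (auto intro!: derivative_eq_intros simp: has_real_derivative_iff_has_vector_derivative[symmetric])
    then have i: "integral {a..Y} (\<lambda>t. exp (- \<sigma> * t)) \<le> exp (- \<sigma> * a) / \<sigma>"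
      using \<sigma> by (simp add: integral_unique)
    have "norm (integral {a..Y} (\<lambda>t. N t * (\<zeta> * ?e t))) \<le> integral {a..Y} (\<lambda>t. norm \<zeta> * B * exp (- \<sigma> * t))"
    proof (rule integral_norm_bound_integral)
      show "(\<lambda>t. N t * (\<zeta> * ?e t)) integrable_on {a..Y}"
        by (intro integrable_continuous_real continuous_intros cNa)
      show "(\<lambda>t. norm \<zeta> * B * exp (- \<sigma> * t)) integrable_on {a..Y}"
        by (intro integrable_continuous_real continuous_intros)
      fix t assume "t \<in> {a..Y}"
      then have "norm (N t) \<le> B" using * NB by auto
      then have "norm \<zeta> * norm (?e t) * norm (N t) \<le> norm \<zeta> * norm (?e t) * B" by (intro mult_left_mono) auto
      then show "norm (N t * (\<zeta> * ?e t)) \<le> norm \<zeta> * B * exp (- \<sigma> * t)"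
        by (simp only: norm_mult ne mult_ac)
    qed
    also have "\<dots> \<le> norm \<zeta> * B * (exp (- \<sigma> * a) / \<sigma>)"
      using mult_left_mono[OF i, of "norm \<zeta> * B"] B by simp
    finally have I: "norm (integral {a..Y} (\<lambda>t. N t * (\<zeta> * ?e t))) \<le> norm \<zeta> * B * (exp (- \<sigma> * a) / \<sigma>)" .
    have eYa: "exp (- \<sigma> * Y) \<le> exp (- \<sigma> * a)" using * \<sigma> by simp
    have "norm (N Y * ?e Y) \<le> B * exp (- \<sigma> * a)" "norm (N a * ?e a) \<le> B * exp (- \<sigma> * a)"
      unfolding norm_mult ne using NB[of Y] NB[of a] * eYa B by (auto intro!: mult_mono)
    then have "norm (N Y * ?e Y - N a * ?e a - ?I) \<le> B * exp (- \<sigma> * a) + B * exp (- \<sigma> * a) + norm \<zeta> * B * (exp (- \<sigma> * a) / \<sigma>)"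
      using I by (meson add_mono norm_triangle_ineq4 order_trans)
    also have "\<dots> = B * exp (- \<sigma> * a) * (2 + norm \<zeta> / \<sigma>)" by (simp add: algebra_simps)
    finally show "norm (integral {a..Y} (\<lambda>t. exp (\<i> * z * of_real t) * q t)) \<le> B * exp (- (Im z - 1) * a) * (2 + norm (z - \<i>) / (Im z - 1))"
      unfolding eq by (simp add: \<sigma>_def n\<zeta>)
  qed
qed

text \<open>Along the ray the tail of the transform beyond a is of order exp(-a Im z), the same
  order as the assumed bound on \<Delta>. So the truncated transform over [0, a] is also of this
  order, and after division by exp(i z a) it is bounded on the ray as
  \<open>Paley_Wiener_ray\<close> requires.\<close>

lemma Laplace_ray_uniqueness:
  fixes q :: "real \<Rightarrow> complex" and \<Delta> :: "complex \<Rightarrow> complex"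
  assumes q: "continuous_on {0..} q"
    and lim: "\<And>z. 0 < Im z \<Longrightarrow> ((\<lambda>y. integral {0..y} (\<lambda>t. exp (\<i> * z * of_real t) * q t)) \<longlongrightarrow> \<Delta> z) at_top"
    and \<omega>: "0 < Im \<omega>" and a: "0 < a"
    and bd: "\<forall>\<^sub>F \<rho> in at_top. norm (exp (- (\<i> * (of_real \<rho> * \<omega>) * of_real a)) * \<Delta> (of_real \<rho> * \<omega>)) \<le> C"
    and x: "x \<in> {0..a}"
  shows "q x = 0"
proof -
  have q': "continuous_on {b..y} q" if "0 \<le> b" for b y by (rule continuous_on_subset[OF q]) (use that in auto)
  have lim': "((\<lambda>y. integral {0..y} (\<lambda>t. exp (- of_real t) * q t)) \<longlongrightarrow> \<Delta> \<i>) at_top"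
    using lim[of \<i>] by simp
  obtain B where B: "0 \<le> B" "\<And>z a Y. 1 < Im z \<Longrightarrow> 0 \<le> a \<Longrightarrow> a \<le> Y \<Longrightarrow>
     norm (integral {a..Y} (\<lambda>t. exp (\<i> * z * of_real t) * q t)) \<le> B * exp (- (Im z - 1) * a) * (2 + norm (z - \<i>) / (Im z - 1))"
    by (rule Laplace_tail_bound[OF q lim']) (erule that, blast)
  define Q where "Q z = integral {0..a} (\<lambda>t. exp (\<i> * z * of_real t) * q t)" for z
  \<comment> \<open>For Im z at least 2 on the ray, Im z - 1 is at least Im z / 2, |z - i| is at
    most |z| + 1, and |z| / Im z is the constant |\<omega>| / Im \<omega>. The factor exp(a) comes
    from replacing Im z - 1 by Im z in the exponent.\<close>
  define K where "K = B * exp a * (2 + 2 * (norm \<omega> / Im \<omega> + 1 / 2))"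
  have tail: "norm (\<Delta> z - Q z) \<le> exp (- Im z * a) * K" if z: "z = of_real \<rho> * \<omega>" "2 \<le> Im z" for z \<rho>
  proof (rule tendsto_upperbound)
    show "((\<lambda>y. norm (integral {0..y} (\<lambda>t. exp (\<i> * z * of_real t) * q t) - Q z)) \<longlongrightarrow> norm (\<Delta> z - Q z)) at_top"
      using z by (intro tendsto_intros lim) auto
    show "\<forall>\<^sub>F y in at_top. norm (integral {0..y} (\<lambda>t. exp (\<i> * z * of_real t) * q t) - Q z) \<le> exp (- Im z * a) * K"
      using eventually_ge_at_top[of a]
    proof eventually_elim
      case (elim y)
      have "integral {0..y} (\<lambda>t. exp (\<i> * z * of_real t) * q t) - Q z = integral {a..y} (\<lambda>t. exp (\<i> * z * of_real t) * q t)"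
        unfolding Q_def using a elim
        by (subst Henstock_Kurzweil_Integration.integral_combine[of 0 a y, symmetric]) (auto intro!: integrable_continuous_real continuous_intros q')
      also have "norm \<dots> \<le> B * exp (- (Im z - 1) * a) * (2 + norm (z - \<i>) / (Im z - 1))"
        using z a elim by (intro B(2)) auto
      also have "\<dots> \<le> B * exp (- (Im z - 1) * a) * (2 + 2 * (norm \<omega> / Im \<omega> + 1 / 2))"
      proof (intro mult_left_mono add_left_mono)
        have "0 < \<rho>" using z \<omega> by (simp add: zero_less_mult_iff) (smt (verit) zero_less_mult_iff)
        then have nz: "norm z / Im z = norm \<omega> / Im \<omega>" using z by (simp add: norm_mult)
        have "norm (z - \<i>) \<le> norm z + 1" by (metis norm_ii norm_triangle_ineq4)
        then have "norm (z - \<i>) / (Im z - 1) \<le> (norm z + 1) / (Im z / 2)" using z by (intro frac_le) auto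
        also have "\<dots> = 2 * (norm z / Im z + 1 / Im z)" by (simp add: add_divide_distrib mult.commute)
        also have "\<dots> \<le> 2 * (norm \<omega> / Im \<omega> + 1 / 2)" unfolding nz using z by (intro mult_left_mono add_left_mono) (auto simp: field_simps)
        finally show "norm (z - \<i>) / (Im z - 1) \<le> 2 * (norm \<omega> / Im \<omega> + 1 / 2)" .
      qed (use B in auto)
      also have "exp (- (Im z - 1) * a) = exp a * exp (- Im z * a)" unfolding exp_add[symmetric] by (simp add: algebra_simps)
      finally show ?case by (simp add: K_def mult_ac)
    qed
  qed simp
  \<comment> \<open>The substitution s = a - t absorbs exp(-i z a) and turns the decaying
    exponential into one that grows in the direction -i \<omega>, whose real part is Im
    \<omega>.\<close>
  define G where "G \<rho> = integral {0..a} (\<lambda>s. exp (of_real \<rho> * (- \<i> * \<omega>) * of_real s) * q (a - s))" for \<rho>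
  have GQ: "G \<rho> = exp (- (\<i> * (of_real \<rho> * \<omega>) * of_real a)) * Q (of_real \<rho> * \<omega>)" for \<rho>
  proof -
    have "G \<rho> = integral {0..a} (\<lambda>t. exp (of_real \<rho> * (- \<i> * \<omega>) * of_real (a - t)) * q t)"
      
    proof -
      have "((\<lambda>t. exp (of_real \<rho> * (- \<i> * \<omega>) * of_real (a - t)) * q t) has_integral integral {0..a} (\<lambda>t. exp (of_real \<rho> * (- \<i> * \<omega>) * of_real (a - t)) * q t)) (cbox 0 a)"
        by (auto intro!: integrable_integral integrable_continuous_real continuous_intros q')
      from has_integral_affinity[OF this, of "-1" a]
      have "((\<lambda>s. exp (of_real \<rho> * (- \<i> * \<omega>) * of_real s) * q (a - s)) has_integral integral {0..a} (\<lambda>t. exp (of_real \<rho> * (- \<i> * \<omega>) * of_real (a - t)) * q t)) {0..a}"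
        using a by (simp add: image_affinity_cbox)
      then show ?thesis by (simp add: G_def integral_unique)
    qed
    also have "\<dots> = integral {0..a} (\<lambda>t. exp (- (\<i> * (of_real \<rho> * \<omega>) * of_real a)) * (exp (\<i> * (of_real \<rho> * \<omega>) * of_real t) * q t))"
    proof -
      have "exp (of_real \<rho> * (- \<i> * \<omega>) * of_real (a - t)) = exp (- (\<i> * (of_real \<rho> * \<omega>) * of_real a)) * exp (\<i> * (of_real \<rho> * \<omega>) * of_real t)" for t
        unfolding exp_add[symmetric] by (simp add: algebra_simps)
      then show ?thesis by (simp only: mult.assoc)
    qed
    finally show ?thesis by (simp add: Q_def)
  qed
  have ev: "\<forall>\<^sub>F \<rho> in at_top. norm (G \<rho>) \<le> C + K"
  proof -
    have "\<forall>\<^sub>F \<rho> in at_top. 2 / Im \<omega> \<le> \<rho>" by (rule eventually_ge_at_top)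
    with bd show ?thesis
    proof eventually_elim
      case (elim \<rho>)
      let ?z = "of_real \<rho> * \<omega>" and ?E = "exp (- (\<i> * (of_real \<rho> * \<omega>) * of_real a))"
      have "2 \<le> Im ?z" using elim \<omega> by (simp add: field_simps)
      then have "norm (\<Delta> ?z - Q ?z) \<le> exp (- Im ?z * a) * K" by (rule tail[OF refl])
      moreover have nE: "norm ?E = exp (Im ?z * a)" by simp
      ultimately have "norm ?E * norm (\<Delta> ?z - Q ?z) \<le> exp (Im ?z * a) * (exp (- Im ?z * a) * K)"
        by (simp only:) (intro mult_left_mono, auto)
      also have "\<dots> = K" by (simp add: exp_minus)
      finally have "norm (?E * \<Delta> ?z - ?E * Q ?z) \<le> K" by (simp only: norm_mult right_diff_distrib[symmetric])
      moreover have "norm (?E * Q ?z) \<le> norm (?E * \<Delta> ?z) + norm (?E * \<Delta> ?z - ?E * Q ?z)"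
        by (metis norm_minus_commute norm_triangle_sub)
      ultimately show ?case using elim GQ[of \<rho>] by simp
    qed
  qed
  then obtain R where R: "\<And>\<rho>. \<rho> \<ge> R \<Longrightarrow> norm (G \<rho>) \<le> C + K" by (auto simp: eventually_at_top_linorder)
  have ch: "continuous_on {0..a} (\<lambda>s. q (a - s))"
    by (rule continuous_on_compose2[OF q]) (auto intro!: continuous_intros)
  \<comment> \<open>The hypothesis speaks of large \<rho> only; the compact rest of the ray is
    covered by continuity in \<rho>.\<close>
  have "bounded (G ` {0..R})"
  proof (intro compact_imp_bounded compact_continuous_image)
    have "continuous_on ({0..R} \<times> {0..a}) (\<lambda>p. q (a - snd p))"
      by (rule continuous_on_compose2[OF q]) (auto intro!: continuous_intros)
    then have "continuous_on {0..R} (\<lambda>\<rho>. integral (cbox 0 a) (\<lambda>s. exp (of_real \<rho> * (- \<i> * \<omega>) * of_real s) * q (a - s)))"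
      by (intro integral_continuous_on_param) (auto simp: case_prod_beta' intro!: continuous_intros)
    then show "continuous_on {0..R} G" by (simp add: G_def)
  qed auto
  then obtain C1 where C1: "\<And>\<rho>. \<rho> \<in> {0..R} \<Longrightarrow> norm (G \<rho>) \<le> C1" unfolding bounded_iff by blast
  have "q (a - (a - x)) = 0"
  proof (rule Paley_Wiener_ray[OF a ch])
    show "0 < Re (- \<i> * \<omega>)" using \<omega> by simp
    show "norm (integral {0..a} (\<lambda>s. exp (of_real \<rho> * (- \<i> * \<omega>) * of_real s) * q (a - s))) \<le> max C1 (C + K)" if "0 \<le> \<rho>" for \<rho>
      using R[of \<rho>] C1[of \<rho>] that unfolding G_def by (cases "\<rho> \<le> R") auto
  qed (use x in auto)
  then show ?thesis by simp
qed

section \<open>Square summable vector functions\<close>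

lemma measurable_vec_nth_complex:
  fixes f :: "'a \<Rightarrow> complex ^ 'p"
  assumes "f \<in> borel_measurable M"
  shows "(\<lambda>x. f x $ i) \<in> borel_measurable M"
  by (rule borel_measurable_continuous_on[OF _ assms]) (intro continuous_intros)

lemma measurable_vecI:
  fixes f :: "'a \<Rightarrow> complex ^ 'p"
  assumes "\<And>i. (\<lambda>x. f x $ i) \<in> borel_measurable M"
  shows "f \<in> borel_measurable M"
  unfolding borel_measurable_euclidean_space[of f]
proof
  fix b :: "complex ^ 'p" assume "b \<in> Basis"
  then obtain i u where "b = axis i u" by (auto simp: Basis_vec_def)
  then have "(\<lambda>x. f x \<bullet> b) = (\<lambda>x. f x $ i \<bullet> u)" by (simp add: inner_axis)
  then show "(\<lambda>x. f x \<bullet> b) \<in> borel_measurable M" using assms by simp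
qed

lemma norm_vec_le_sum:
  fixes v :: "complex ^ 'p" shows "norm v \<le> (\<Sum>i\<in>UNIV. norm (v $ i))"
  unfolding norm_vec_def by (rule L2_set_le_sum) simp

lemma integrable_vecI:
  fixes f :: "'a \<Rightarrow> complex ^ 'p"
  assumes "\<And>i. integrable M (\<lambda>x. f x $ i)"
  shows "integrable M f"
proof (rule Bochner_Integration.integrable_bound)
  show "integrable M (\<lambda>x. \<Sum>i\<in>UNIV. norm (f x $ i))" using assms by auto
  show "f \<in> borel_measurable M" using assms by (intro measurable_vecI) auto
  show "AE x in M. norm (f x) \<le> norm (\<Sum>i\<in>UNIV. norm (f x $ i))"
    by (intro AE_I2) (auto intro: order_trans[OF norm_vec_le_sum])
qed

lemma integral_vec_nth:
  fixes f :: "'a \<Rightarrow> 'b::euclidean_space ^ 'p"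
  assumes "integrable M f"
  shows "(LINT x|M. f x) $ i = (LINT x|M. f x $ i)"
  by (rule integral_bounded_linear[OF bounded_linear_vec_nth assms, symmetric])

lemma norm_vec_power2:
  fixes v :: "complex ^ 'p" shows "(norm v)\<^sup>2 = (\<Sum>i\<in>UNIV. (norm (v $ i))\<^sup>2)"
  unfolding norm_vec_def L2_set_def by (simp add: sum_nonneg)

definition cinner :: "complex ^ 'p \<Rightarrow> complex ^ 'p \<Rightarrow> complex" where
  "cinner u v = (\<Sum>i\<in>UNIV. u $ i * cnj (v $ i))"

lemma cinner_self: "cinner u u = of_real ((norm u)\<^sup>2)"
  unfolding cinner_def norm_vec_power2 of_real_sum complex_norm_square ..

lemma norm_cinner_le: "norm (cinner u v) \<le> (norm u)\<^sup>2 + (norm v)\<^sup>2"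
proof -
  have "norm (cinner u v) \<le> (\<Sum>i\<in>UNIV. norm (u $ i) * norm (v $ i))"
    unfolding cinner_def by (rule order_trans[OF norm_sum]) (simp add: norm_mult)
  also have "\<dots> \<le> (\<Sum>i\<in>UNIV. (norm (u $ i))\<^sup>2 + (norm (v $ i))\<^sup>2)"
  proof (rule sum_mono)
    fix i
    have "2 * (norm (u $ i) * norm (v $ i)) \<le> (norm (u $ i))\<^sup>2 + (norm (v $ i))\<^sup>2"
      using sum_squares_bound[of "norm (u $ i)" "norm (v $ i)"] by (simp add: mult.assoc)
    then show "norm (u $ i) * norm (v $ i) \<le> (norm (u $ i))\<^sup>2 + (norm (v $ i))\<^sup>2"
      using mult_nonneg_nonneg[OF norm_ge_zero norm_ge_zero, of "u $ i" "v $ i"] by linarith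
  qed
  finally show ?thesis by (simp add: norm_vec_power2 sum.distrib)
qed

lemma cinner_commute: "cinner v u = cnj (cinner u v)"
  by (simp add: cinner_def mult.commute)
lemma cinner_0 [simp]: "cinner 0 w = 0" "cinner w 0 = 0"
  by (simp_all add: cinner_def)
lemma L2_inner_cinner: "L2_inner r f g = (LINT x|Iv r. cinner (f x) (g x))"
  by (simp add: L2_inner_def cinner_def)

lemma L2_measurable: "f \<in> L2 r \<Longrightarrow> f \<in> borel_measurable (Iv r)"
  by (simp add: L2_def square_summable_on_def)
lemma L2_norm_integrable: "f \<in> L2 r \<Longrightarrow> integrable (Iv r) (\<lambda>x. (norm (f x))\<^sup>2)"
  by (simp add: L2_def square_summable_on_def)
lemma L2_nth_measurable: 
  fixes f :: "real \<Rightarrow> complex ^ 'p" 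
  shows "f \<in> L2 r \<Longrightarrow> (\<lambda>x. f x $ i) \<in> borel_measurable (Iv r)"
  by (intro measurable_vec_nth_complex L2_measurable)

lemma L2I: "f \<in> borel_measurable (Iv r) \<Longrightarrow> integrable (Iv r) (\<lambda>x. (norm (f x))\<^sup>2) \<Longrightarrow> f \<in> L2 r"
  by (simp add: L2_def square_summable_on_def)

lemma L2_mono: "f \<in> L2 r \<Longrightarrow> s \<le> r \<Longrightarrow> f \<in> L2 s"
  by (meson L2I measurable_Iv_mono L2_measurable integrable_Iv_mono L2_norm_integrable)

lemma L2_bounded:
  fixes f :: "real \<Rightarrow> complex ^ 'p"
  assumes "\<And>i. (\<lambda>x. f x $ i) \<in> borel_measurable (Iv r)" "\<And>x. 0 < x \<Longrightarrow> x < r \<Longrightarrow> norm (f x) \<le> B"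
  shows "f \<in> L2 r"
proof (rule L2I)
  show f: "f \<in> borel_measurable (Iv r)" using assms(1) by (rule measurable_vecI)
  show "integrable (Iv r) (\<lambda>x. (norm (f x))\<^sup>2)"
  proof (rule integrable_Iv_bound)
    show "norm ((norm (f x))\<^sup>2) \<le> B\<^sup>2" if "0 < x" "x < r" for x
      using assms(2)[OF that] by (simp add: power_mono)
  qed (use f in measurable)
qed

lemma L2_continuous:
  fixes f :: "real \<Rightarrow> complex ^ 'p"
  assumes "continuous_on {0..r} f" shows "f \<in> L2 r"
  by (intro L2I continuous_on_measurable_Iv continuous_integrable_Iv continuous_intros assms)

lemma cinner_measurable:
  assumes "f \<in> borel_measurable M" "g \<in> borel_measurable M"
  shows "(\<lambda>x. cinner (f x) (g x)) \<in> borel_measurable M"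
  unfolding cinner_def
  by (intro borel_measurable_sum borel_measurable_times measurable_vec_nth_complex assms
    borel_measurable_continuous_on[of cnj, OF _ measurable_vec_nth_complex] continuous_intros)

lemma cinner_integrable:
  assumes f: "f \<in> L2 r" and g: "g \<in> L2 r"
  shows "integrable (Iv r) (\<lambda>x. cinner (f x) (g x))"
proof (rule Bochner_Integration.integrable_bound)
  show "integrable (Iv r) (\<lambda>x. (norm (f x))\<^sup>2 + (norm (g x))\<^sup>2)" 
    by (intro Bochner_Integration.integrable_add L2_norm_integrable f g)
  show "(\<lambda>x. cinner (f x) (g x)) \<in> borel_measurable (Iv r)"
    by (intro cinner_measurable L2_measurable f g)
  show "AE x in Iv r. norm (cinner (f x) (g x)) \<le> norm ((norm (f x))\<^sup>2 + (norm (g x))\<^sup>2)"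
    by (intro AE_I2) (simp add: norm_cinner_le)
qed

lemma L2_nth_integrable:
  fixes f :: "real \<Rightarrow> complex ^ 'p"
  assumes f: "f \<in> L2 r"
  shows "integrable (Iv r) (\<lambda>x. f x $ i)"
proof (rule Bochner_Integration.integrable_bound)
  show "integrable (Iv r) (\<lambda>x. 1 + (norm (f x))\<^sup>2)" 
    using finite_measure.integrable_const[OF finite_measure_Iv, of r "1::real"] 
    by (intro Bochner_Integration.integrable_add L2_norm_integrable f) auto
  show "(\<lambda>x. f x $ i) \<in> borel_measurable (Iv r)" by (rule L2_nth_measurable[OF f])
  show "AE x in Iv r. norm (f x $ i) \<le> norm (1 + (norm (f x))\<^sup>2)"
  proof (rule AE_I2)
    fix x
    have "norm (f x $ i) \<le> norm (f x)" by (rule Finite_Cartesian_Product.norm_nth_le)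
    also have "\<dots> \<le> 1 + (norm (f x))\<^sup>2" 
      using sum_squares_bound[of "norm (f x)" 1] norm_ge_zero[of "f x"] unfolding power_one by linarith
    finally show "norm (f x $ i) \<le> norm (1 + (norm (f x))\<^sup>2)" by simp
  qed
qed

lemma L2_add: assumes "f \<in> L2 r" "g \<in> L2 r" shows "(\<lambda>x. f x + g x) \<in> L2 r"
proof (rule L2I)
  show m: "(\<lambda>x. f x + g x) \<in> borel_measurable (Iv r)" by (intro borel_measurable_add L2_measurable assms)
  have "integrable (Iv r) (\<lambda>x. 2 * (norm (f x))\<^sup>2 + 2 * (norm (g x))\<^sup>2)"
    by (intro Bochner_Integration.integrable_add integrable_mult_right L2_norm_integrable assms)
  then show "integrable (Iv r) (\<lambda>x. (norm (f x + g x))\<^sup>2)"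
  proof (rule Bochner_Integration.integrable_bound)
    show "AE x in Iv r. norm ((norm (f x + g x))\<^sup>2) \<le> norm (2 * (norm (f x))\<^sup>2 + 2 * (norm (g x))\<^sup>2)"
    proof (rule AE_I2)
      fix x
      have "(norm (f x + g x))\<^sup>2 \<le> (norm (f x) + norm (g x))\<^sup>2" by (intro power_mono norm_triangle_ineq) auto
      also have "\<dots> \<le> 2 * (norm (f x))\<^sup>2 + 2 * (norm (g x))\<^sup>2" 
        using sum_squares_bound[of "norm (f x)" "norm (g x)"] by (simp add: power2_sum)
      finally show "norm ((norm (f x + g x))\<^sup>2) \<le> norm (2 * (norm (f x))\<^sup>2 + 2 * (norm (g x))\<^sup>2)" by simp
    qed
  qed (use m in measurable)
qed

lemma norm_vector_scale: "norm (c *s v) = norm c * norm (v :: complex ^ 'p)"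
proof -
  have "(norm (c *s v))\<^sup>2 = (norm c * norm v)\<^sup>2"
    by (simp add: norm_vec_power2 norm_mult power_mult_distrib sum_distrib_left)
  then show ?thesis by (simp add: power2_eq_iff_nonneg)
qed

lemma L2_scale: assumes "f \<in> L2 r" shows "(\<lambda>x. c *s f x) \<in> L2 r"
proof (rule L2I)
  show "(\<lambda>x. c *s f x) \<in> borel_measurable (Iv r)"
    by (intro measurable_vecI) (use L2_nth_measurable[OF assms] in \<open>simp, measurable\<close>)
  show "integrable (Iv r) (\<lambda>x. (norm (c *s f x))\<^sup>2)"
    using L2_norm_integrable[OF assms] by (simp add: norm_vector_scale power_mult_distrib)
qed

lemma L2_zero: "(\<lambda>x. 0) \<in> L2 r" by (intro L2_continuous continuous_intros)

lemma L2_sum: "(\<And>a. a \<in> A \<Longrightarrow> f a \<in> L2 r) \<Longrightarrow> (\<lambda>x. \<Sum>a\<in>A. f a x) \<in> L2 r"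
  by (induction A rule: infinite_finite_induct) (auto intro: L2_add L2_zero)

lemma L2_eq_sym: "L2_eq r f g \<Longrightarrow> L2_eq r g f" by (auto simp: L2_eq_def elim!: eventually_mono)
lemma L2_eq_trans: "L2_eq r f g \<Longrightarrow> L2_eq r g h \<Longrightarrow> L2_eq r f h" by (auto simp: L2_eq_def)
lemma L2_eqI: "(\<And>x. 0 < x \<Longrightarrow> x < r \<Longrightarrow> f x = g x) \<Longrightarrow> L2_eq r f g" unfolding L2_eq_def by (intro AE_I2) auto

lemma L2_inner_cong:
  assumes "L2_eq r f f'" "L2_eq r g g'" "f \<in> L2 r" "f' \<in> L2 r" "g \<in> L2 r" "g' \<in> L2 r"
  shows "L2_inner r f g = L2_inner r f' g'"
  unfolding L2_inner_cinner
proof (rule integral_cong_AE)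
  show "AE x in Iv r. cinner (f x) (g x) = cinner (f' x) (g' x)"
    using assms(1,2) unfolding L2_eq_def by eventually_elim simp
qed (intro cinner_measurable L2_measurable assms)+

lemma L2_inner_commute:
  assumes "f \<in> L2 r" "g \<in> L2 r"
  shows "L2_inner r g f = cnj (L2_inner r f g)"
  using integral_bounded_linear[OF bounded_linear_cnj cinner_integrable[OF assms]]
  unfolding L2_inner_cinner by (simp add: cinner_commute[of "g _"])

lemma L2_norm_inner: "f \<in> L2 r \<Longrightarrow> (LINT x|Iv r. (norm (f x))\<^sup>2) = Re (L2_inner r f f)"
  unfolding L2_inner_cinner cinner_self integral_complex_of_real by (simp only: Re_complex_of_real)

text \<open>An additive substitute for Cauchy-Schwarz. In its applications both quadratic terms are
  bounded, or tend to zero, so the product form would gain nothing.\<close>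

lemma norm_L2_inner_le:
  assumes "f \<in> L2 r" "g \<in> L2 r"
  shows "norm (L2_inner r f g) \<le> Re (L2_inner r f f) + Re (L2_inner r g g)"
proof -
  have "norm (L2_inner r f g) \<le> (LINT x|Iv r. norm (cinner (f x) (g x)))"
    unfolding L2_inner_cinner by (rule integral_norm_bound)
  also have "\<dots> \<le> (LINT x|Iv r. (norm (f x))\<^sup>2 + (norm (g x))\<^sup>2)"
    by (intro integral_mono integrable_norm cinner_integrable Bochner_Integration.integrable_add L2_norm_integrable assms norm_cinner_le)
  also have "\<dots> = Re (L2_inner r f f) + Re (L2_inner r g g)"
    by (simp add: L2_norm_inner[symmetric] assms L2_norm_integrable)
  finally show ?thesis .
qed

context
  fixes r :: real and T :: "('p :: finite) operator"
  assumes T: "bounded_op r T"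
begin

lemma bounded_op_L2: "f \<in> L2 r \<Longrightarrow> T f \<in> L2 r" using T by (auto simp: bounded_op_def)
lemma bounded_op_cong: "f \<in> L2 r \<Longrightarrow> g \<in> L2 r \<Longrightarrow> L2_eq r f g \<Longrightarrow> L2_eq r (T f) (T g)" using T by (auto simp: bounded_op_def)
lemma bounded_op_add: "f \<in> L2 r \<Longrightarrow> g \<in> L2 r \<Longrightarrow> L2_eq r (T (\<lambda>x. f x + g x)) (\<lambda>x. T f x + T g x)" using T by (auto simp: bounded_op_def)
lemma bounded_op_scale: "f \<in> L2 r \<Longrightarrow> L2_eq r (T (\<lambda>x. c *s f x)) (\<lambda>x. c *s T f x)" using T by (auto simp: bounded_op_def)

lemma bounded_op_sum:
  assumes "finite A" "\<And>a. a \<in> A \<Longrightarrow> f a \<in> L2 r"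
  shows "L2_eq r (T (\<lambda>x. \<Sum>a\<in>A. c a *s f a x)) (\<lambda>x. \<Sum>a\<in>A. c a *s T (f a) x)"
  using assms
proof (induction A rule: finite_induct)
  case empty
  have "L2_eq r (T (\<lambda>x. 0 *s (0::complex^'p))) (\<lambda>x. 0 *s T (\<lambda>x. 0) x)"
    by (rule bounded_op_scale[OF L2_zero])
  moreover have "0 *s (v::complex^'p) = 0" for v by (simp add: vec_eq_iff)
  ultimately show ?case by simp
next
  case (insert a A)
  have "L2_eq r (T (\<lambda>x. c a *s f a x + (\<Sum>a\<in>A. c a *s f a x))) (\<lambda>x. T (\<lambda>x. c a *s f a x) x + T (\<lambda>x. \<Sum>a\<in>A. c a *s f a x) x)"
    by (intro bounded_op_add L2_scale L2_sum insert) (auto intro: insert)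
  moreover have "L2_eq r (T (\<lambda>x. c a *s f a x)) (\<lambda>x. c a *s T (f a) x)"
    by (intro bounded_op_scale insert) auto
  moreover have "L2_eq r (T (\<lambda>x. \<Sum>a\<in>A. c a *s f a x)) (\<lambda>x. \<Sum>a\<in>A. c a *s T (f a) x)"
    using insert by auto
  ultimately have "L2_eq r (T (\<lambda>x. c a *s f a x + (\<Sum>a\<in>A. c a *s f a x))) (\<lambda>x. c a *s T (f a) x + (\<Sum>a\<in>A. c a *s T (f a) x))"
    unfolding L2_eq_def by eventually_elim simp
  then show ?case using insert by simp
qed

end

section \<open>The operator identity\<close>

lemma set_integrable_AE_eq:
  fixes f g :: "'a::euclidean_space \<Rightarrow> 'b::euclidean_space"
  assumes "set_integrable lebesgue S f" "AE x in lebesgue. f x = g x"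
  shows "set_integrable lebesgue S g"
proof -
  obtain N where N: "N \<in> null_sets lebesgue" "{x. \<not> f x = g x} \<subseteq> N"
    using assms(2) by (auto simp: eventually_ae_filter)
  show ?thesis
    by (rule absolutely_integrable_spike[OF assms(1), of N]) (use N in \<open>force simp: negligible_iff_null_sets\<close>)+
qed

text \<open>\<open>admissible_kernel\<close> speaks about (0, r) only; the symmetry k(-x) = k(x)^*
  carries integrability to the negative half-line, and the point 0 is null. The partner h may differ
  from g because the symmetry exchanges the indices i and j.\<close>

lemma loc_integrable_reflect:
  fixes g h :: "real \<Rightarrow> complex"
  assumes g: "\<And>R. integrable (Iv R) g" and h: "\<And>R. integrable (Iv R) h"
    and gh: "AE x in lebesgue. g (- x) = h x"
  shows "loc_integrable g"
  unfolding loc_integrable_def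
proof (intro allI)
  fix a b :: real
  define R where "R = \<bar>a\<bar> + \<bar>b\<bar> + 1"
  have "integrable lebesgue (\<lambda>x. indicator {0<..<R} x *\<^sub>R h x)"
    using h[of R] by (simp add: integrable_restrict_space)
  from lebesgue_integrable_real_affine[OF this, of "-1" 0]
  have "integrable lebesgue (\<lambda>x. indicator {0<..<R} (- x) *\<^sub>R h (- x))" by simp
  moreover have "(\<lambda>x. indicator {0<..<R} (- x) *\<^sub>R h (- x)) = (\<lambda>x. indicator {-R<..<0} x *\<^sub>R h (- x))"
    by (auto simp: indicator_def fun_eq_iff)
  ultimately have "set_integrable lebesgue {-R<..<0} (\<lambda>x. h (- x))"
    by (simp add: set_integrable_def)
  then have 1: "set_integrable lebesgue {-R<..<0} g"
  proof (rule set_integrable_AE_eq)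
    show "AE x in lebesgue. h (- x) = g x"
      using AE_lebesgue_affine[OF gh, of "-1" 0] by (auto elim!: eventually_mono)
  qed
  have 2: "set_integrable lebesgue {0<..<R} g"
    using g[of R] by (simp add: set_integrable_def integrable_restrict_space)
  have 3: "set_integrable lebesgue {0} g"
    by (rule absolutely_integrable_negligible) simp
  have "set_integrable lebesgue ({-R<..<0} \<union> {0<..<R} \<union> {0}) g"
    by (intro set_integrable_Un 1 2 3) auto
  then have "set_integrable lebesgue {a<..<b} g"
    by (rule set_integrable_subset) (auto simp: R_def)
  then show "integrable (lebesgue_on {a<..<b}) g"
    by (simp add: set_integrable_def integrable_restrict_space)
qed

lemma loc_integrable_affine:
  assumes "loc_integrable k" "c \<noteq> 0"
  shows "integrable (Iv r) (\<lambda>t. k (a + c * t))"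
proof -
  define M where "M = \<bar>a\<bar> + \<bar>c\<bar> * \<bar>r\<bar> + 1"
  have "integrable lebesgue (\<lambda>t. indicator {-M<..<M} (a + c * t) *\<^sub>R k (a + c * t))"
    by (rule lebesgue_integrable_real_affine[OF set_integrable_loc[OF assms(1)] assms(2)])
  then have "set_integrable lebesgue UNIV (\<lambda>t. indicator {-M<..<M} (a + c * t) *\<^sub>R k (a + c * t))"
    by (simp add: set_integrable_def)
  then have "set_integrable lebesgue {0<..<r} (\<lambda>t. indicator {-M<..<M} (a + c * t) *\<^sub>R k (a + c * t))"
    by (rule set_integrable_subset) auto
  moreover have "indicator {0<..<r} t *\<^sub>R (indicator {-M<..<M} (a + c * t) *\<^sub>R k (a + c * t)) = indicator {0<..<r} t *\<^sub>R k (a + c * t)" for t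
  proof (cases "t \<in> {0<..<r}")
    case True
    then have "\<bar>c * t\<bar> \<le> \<bar>c\<bar> * \<bar>r\<bar>" by (simp add: abs_mult mult_left_mono)
    then have "a + c * t \<in> {-M<..<M}" by (auto simp: M_def)
    then show ?thesis by simp
  qed simp
  ultimately have "set_integrable lebesgue {0<..<r} (\<lambda>t. k (a + c * t))"
    unfolding set_integrable_def by (simp only:)
  then show ?thesis by (simp add: set_integrable_def integrable_restrict_space)
qed

lemma integrable_mult_L2:
  fixes f g :: "real \<Rightarrow> complex"
  assumes "f \<in> borel_measurable M" "g \<in> borel_measurable M" 
    "integrable M (\<lambda>x. (norm (f x))\<^sup>2)" "integrable M (\<lambda>x. (norm (g x))\<^sup>2)"
  shows "integrable M (\<lambda>x. f x * g x)"
proof (rule Bochner_Integration.integrable_bound)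
  show "integrable M (\<lambda>x. (norm (f x))\<^sup>2 + (norm (g x))\<^sup>2)"
    using assms by simp
  show "AE x in M. norm (f x * g x) \<le> norm ((norm (f x))\<^sup>2 + (norm (g x))\<^sup>2)"
  proof (intro AE_I2)
    fix x 
    have "norm (f x) * norm (g x) \<le> (norm (f x))\<^sup>2 + (norm (g x))\<^sup>2"
      using sum_squares_bound[of "norm (f x)" "norm (g x)"] mult_nonneg_nonneg[OF norm_ge_zero norm_ge_zero, of "f x" "g x"] by linarith
    then show "norm (f x * g x) \<le> norm ((norm (f x))\<^sup>2 + (norm (g x))\<^sup>2)" by (simp add: norm_mult)
  qed
qed (use assms in measurable)

definition A_op :: "real ^ 'p \<Rightarrow> 'p operator" where
  "A_op d f x = (\<chi> i. \<i> * of_real (d $ i) * (LINT t|Iv x. f t $ i))"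

definition pi_col :: "real ^ 'p \<Rightarrow> (real \<Rightarrow> complex ^ 'p ^ 'p) \<Rightarrow> 'p + 'p \<Rightarrow> real \<Rightarrow> complex ^ 'p" where
  "pi_col d k c x = column c (Pi_fun d k x)"

lemma norm_matrix_entry_le: "norm (M $ i $ j) \<le> norm (M :: complex ^ 'n ^ 'm)"
  by (rule order_trans[OF Finite_Cartesian_Product.norm_nth_le Finite_Cartesian_Product.norm_nth_le])

section \<open>The entries of \<open>k\<close>, their primitives and the columns of Pi\<close>

locale admissible =
  fixes d :: "real ^ 'p" and k :: "real \<Rightarrow> complex ^ 'p ^ 'p"
  assumes neg: "d $ i < 0" and adm: "admissible_kernel d k"
begin

abbreviation "K i j \<equiv> (\<lambda>y. k y $ i $ j)"
abbreviation "kap i j \<equiv> prim (K i j)"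

lemma d_nz: "d $ i \<noteq> 0" using neg[of i] by simp

lemma k_meas: "k \<in> borel_measurable (Iv R)" and k_sq: "integrable (Iv R) (\<lambda>x. (norm (k x))\<^sup>2)"
proof -
  have "k \<in> borel_measurable (Iv (max R 1)) \<and> integrable (Iv (max R 1)) (\<lambda>x. (norm (k x))\<^sup>2)"
  proof -
    have "\<forall>r>0. k square_summable_on {0<..<r}" using adm unfolding admissible_kernel_def by blast
    then have "k square_summable_on {0<..<max R 1}" by (rule allE[of _ "max R 1"]) simp
    then show ?thesis unfolding square_summable_on_def .
  qed
  then have m: "k \<in> borel_measurable (Iv (max R 1))" and q: "integrable (Iv (max R 1)) (\<lambda>x. (norm (k x))\<^sup>2)"
    by blast+
  show "k \<in> borel_measurable (Iv R)" by (rule measurable_Iv_mono[OF m]) simp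
  show "integrable (Iv R) (\<lambda>x. (norm (k x))\<^sup>2)" by (rule integrable_Iv_mono[OF q]) simp
qed

lemma k_herm: "AE x in lebesgue. k (- x) = hermconj (k x)"
  using adm unfolding admissible_kernel_def by blast

lemma K_meas: "K i j \<in> borel_measurable (Iv R)"
  by (rule borel_measurable_continuous_on[OF _ k_meas]) (intro continuous_intros)

lemma K_sq: "integrable (Iv R) (\<lambda>x. (norm (K i j x))\<^sup>2)"
proof (rule Bochner_Integration.integrable_bound[OF k_sq])
  show "(\<lambda>x. (norm (K i j x))\<^sup>2) \<in> borel_measurable (Iv R)" using K_meas by measurable
  show "AE x in Iv R. norm ((norm (K i j x))\<^sup>2) \<le> norm ((norm (k x))\<^sup>2)"
    by (intro AE_I2) (simp add: power_mono norm_matrix_entry_le)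
qed

lemma K_integrable: "integrable (Iv R) (K i j)"
proof -
  have "integrable (Iv R) (\<lambda>x. K i j x * 1)"
    by (intro integrable_mult_L2 K_meas K_sq) (auto intro!: finite_measure.integrable_const finite_measure_Iv)
  then show ?thesis by simp
qed

lemma K_herm: "AE x in lebesgue. K i j (- x) = cnj (K j i x)"
  using k_herm by eventually_elim (simp add: hermconj_def)

lemma K_loc: "loc_integrable (K i j)"
  by (rule loc_integrable_reflect[OF K_integrable _ K_herm]) (use K_integrable in simp)

lemma K_sq_loc: "loc_integrable (\<lambda>y. complex_of_real ((norm (K i j y))\<^sup>2))"
proof (rule loc_integrable_reflect)
  show "AE x in lebesgue. complex_of_real ((norm (K i j (- x)))\<^sup>2) = complex_of_real ((norm (K j i x))\<^sup>2)"
    using K_herm[of i j] by eventually_elim simp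
qed (rule iffD2[OF complex_of_real_integrable_eq K_sq])+

text \<open>The integrated form of k(-x) = k(x)^*; the minus sign comes from the reversed
  orientation. It produces the cancellation behind the operator identity.\<close>

lemma kap_minus: "kap i j (- y) = - cnj (kap j i y)"
proof -
  let ?w = "\<lambda>y t. indicat_real {0<..<y} t - indicat_real {y<..<0} t"
  have I: "integrable lebesgue (\<lambda>t. ?w y t *\<^sub>R K i j t)" for y i j
    unfolding scaleR_diff_left by (intro Bochner_Integration.integrable_diff set_integrable_loc K_loc)
  have "kap i j (- y) = (LINT t|lebesgue. ?w (-y) (0 + (-1) * t) *\<^sub>R K i j (0 + (-1) * t))"
    unfolding prim_def by (subst lebesgue_integral_real_affine[of "-1" _ 0]) auto
  also have "\<dots> = (LINT t|lebesgue. - cnj (?w y t *\<^sub>R K j i t))"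
  proof (rule integral_cong_AE)
    show "AE t in lebesgue. ?w (-y) (0 + (-1) * t) *\<^sub>R K i j (0 + (-1) * t) = - cnj (?w y t *\<^sub>R K j i t)"
      using K_herm[of i j] by eventually_elim (auto simp: indicator_def)
    show "(\<lambda>t. ?w (-y) (0 + (-1) * t) *\<^sub>R K i j (0 + (-1) * t)) \<in> borel_measurable lebesgue"
      by (intro borel_measurable_integrable lebesgue_integrable_real_affine[OF I]) simp
    have "integrable lebesgue (\<lambda>t. - cnj (?w y t *\<^sub>R K j i t))"
      using I[of y j i] by (intro Bochner_Integration.integrable_minus) (simp only: complex_integrable_cnj)
    then show "(\<lambda>t. - cnj (?w y t *\<^sub>R K j i t)) \<in> borel_measurable lebesgue" by auto
  qed
  also have "\<dots> = - cnj (kap j i y)"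
    unfolding prim_def integral_minus by (simp only: integral_bounded_linear[OF bounded_linear_cnj I])
  finally show ?thesis .
qed

lemma kap_cont: "continuous_on A (kap i j)"
  by (rule continuous_on_prim[OF K_loc])

lemma kap_cont': "continuous_on A f \<Longrightarrow> continuous_on A (\<lambda>x. kap i j (f x))"
  by (rule continuous_on_compose2[OF kap_cont[of UNIV]]) auto

lemma s_fun_entry:
  assumes "0 \<le> x"
  shows "s_fun d k x $ i $ j = (if i = j then 1/2 else 0) + kap i j x / of_real \<bar>d $ i\<bar>"
proof -
  have "integrable (Iv x) k"
  proof (rule Bochner_Integration.integrable_bound)
    show "integrable (Iv x) (\<lambda>t. 1 + (norm (k t))\<^sup>2)"
      using finite_measure.integrable_const[OF finite_measure_Iv, of x "1::real"] k_sq by auto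
    show "AE t in Iv x. norm (k t) \<le> norm (1 + (norm (k t))\<^sup>2)"
    proof (rule AE_I2)
      fix t
      have "norm (k t) \<le> 1 + (norm (k t))\<^sup>2"
        using sum_squares_bound[of "norm (k t)" 1] norm_ge_zero[of "k t"] unfolding power_one by linarith
      then show "norm (k t) \<le> norm (1 + (norm (k t))\<^sup>2)" by simp
    qed
  qed (rule k_meas)
  then have "(LINT t|Iv x. k t) $ i $ j = (LINT t|Iv x. k t $ i $ j)"
    by (intro integral_bounded_linear[symmetric, of "\<lambda>M. M $ i $ j"] bounded_linear_compose[OF bounded_linear_vec_nth bounded_linear_vec_nth])
  also have "\<dots> = kap i j x" using assms by (simp add: prim_nonneg[OF K_loc])
  finally have e: "(LINT t|Iv x. k t) $ i $ j = kap i j x" .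
  have "s_fun d k x $ i $ j = (if i = j then 1/2 else 0) + (\<Sum>l\<in>UNIV. (if i = l then complex_of_real (inverse \<bar>d $ i\<bar>) else 0) * (LINT t|Iv x. k t) $ l $ j)"
    by (simp add: s_fun_def mat_def matrix_matrix_mult_def diagmat_def)
  also have "(\<Sum>l\<in>UNIV. (if i = l then complex_of_real (inverse \<bar>d $ i\<bar>) else 0) * (LINT t|Iv x. k t) $ l $ j) = complex_of_real (inverse \<bar>d $ i\<bar>) * kap i j x"
    by (simp add: if_distrib[of "\<lambda>a. a * _"] e cong: if_cong)
  finally show ?thesis by (simp add: divide_inverse mult.commute)
qed

lemma pi_col_Inr: "pi_col d k (Inr j) x $ i = (if i = j then 1 else 0)"
  by (simp add: pi_col_def column_def Pi_fun_def hcat_def mat_def)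

text \<open>Since D < 0, D |D|^-1 = -I, which is the minus sign before the primitive, and |d_i| x =
  -d_i x.\<close>

lemma pi_col_Inl:
  assumes "0 \<le> x"
  shows "pi_col d k (Inl j) x $ i = (if i = j then of_real (d $ i) / 2 else 0) - kap i j (- (d $ i * x))"
proof -
  have "pi_col d k (Inl j) x $ i = (\<Sum>l\<in>UNIV. (if i = l then complex_of_real (d $ i) else 0) * s_fun d k (\<bar>d $ l\<bar> * x) $ l $ j)"
    by (simp add: pi_col_def column_def Pi_fun_def hcat_def matrix_matrix_mult_def diagmat_def)
  also have "\<dots> = of_real (d $ i) * s_fun d k (\<bar>d $ i\<bar> * x) $ i $ j"
    by (simp add: if_distrib[of "\<lambda>a. a * _"] cong: if_cong)
  also have "\<dots> = (if i = j then of_real (d $ i) / 2 else 0) + of_real (d $ i) / of_real \<bar>d $ i\<bar> * kap i j (\<bar>d $ i\<bar> * x)"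
    using assms by (simp add: s_fun_entry distrib_left)
  also have "of_real (d $ i) / complex_of_real \<bar>d $ i\<bar> = -1"
    using neg[of i] by (simp add: field_simps)
  also have "\<bar>d $ i\<bar> * x = - (d $ i * x)" using neg[of i] by simp
  finally show ?thesis by simp
qed

lemma pi_col_continuous: "continuous_on {0..r} (pi_col d k c)"
proof (cases c)
  case (Inr j)
  have "pi_col d k c = (\<lambda>x. \<chi> i. if i = j then 1 else 0)"
    by (simp add: fun_eq_iff vec_eq_iff Inr pi_col_Inr)
  then show ?thesis by simp
next
  case (Inl j)
  have "continuous_on {0..r} (\<lambda>x. \<chi> i. (if i = j then of_real (d $ i) / 2 else 0) - kap i j (- (d $ i * x)))"
    by (intro continuous_intros kap_cont')
  moreover have "pi_col d k c x = (\<chi> i. (if i = j then of_real (d $ i) / 2 else 0) - kap i j (- (d $ i * x)))" if "x \<in> {0..r}" for x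
    using that by (simp add: vec_eq_iff Inl pi_col_Inl)
  ultimately show ?thesis by (metis (no_types, lifting) continuous_on_cong)
qed

lemma pi_col_L2: "pi_col d k c \<in> L2 r"
  by (rule L2_continuous[OF pi_col_continuous])

lemma K_product_integrable:
  assumes f: "f \<in> L2 r"
  shows "integrable (Iv r) (\<lambda>t. K i j (d $ j * t - d $ i * x) * f t $ j)"
proof (rule integrable_mult_L2)
  have e: "d $ j * t - d $ i * x = - (d $ i * x) + d $ j * t" for t by simp
  show "(\<lambda>t. K i j (d $ j * t - d $ i * x)) \<in> borel_measurable (Iv r)"
    unfolding e by (rule borel_measurable_integrable[OF loc_integrable_affine[OF K_loc d_nz]])
  show "integrable (Iv r) (\<lambda>t. (norm (K i j (d $ j * t - d $ i * x)))\<^sup>2)"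
    unfolding e by (rule iffD1[OF complex_of_real_integrable_eq loc_integrable_affine[OF K_sq_loc d_nz]])
  show "(\<lambda>t. f t $ j) \<in> borel_measurable (Iv r)" by (rule L2_nth_measurable[OF f])
  show "integrable (Iv r) (\<lambda>t. (norm (f t $ j))\<^sup>2)"
  proof (rule Bochner_Integration.integrable_bound[OF L2_norm_integrable[OF f]])
    show "(\<lambda>t. (norm (f t $ j))\<^sup>2) \<in> borel_measurable (Iv r)" using L2_nth_measurable[OF f] by measurable
  qed (intro AE_I2, simp add: power_mono Finite_Cartesian_Product.norm_nth_le)
qed

lemma S_op_nth:
  assumes f: "f \<in> L2 r"
  shows "S_op d k r f x $ i = f x $ i + (\<Sum>j\<in>UNIV. LINT t|Iv r. K i j (d $ j * t - d $ i * x) * f t $ j)"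
proof -
  note I = K_product_integrable[OF f]
  have c: "((\<chi> i j. k (d $ j * t - d $ i * x) $ i $ j) *v f t) $ i = (\<Sum>j\<in>UNIV. K i j (d $ j * t - d $ i * x) * f t $ j)" for t i
    by (simp add: matrix_vector_mult_def)
  have "integrable (Iv r) (\<lambda>t. (\<chi> i j. k (d $ j * t - d $ i * x) $ i $ j) *v f t)"
    by (rule integrable_vecI) (simp only: c, intro Bochner_Integration.integrable_sum I)
  from integral_vec_nth[OF this, of i] 
  show ?thesis unfolding S_op_def by (simp add: c I)
qed

text \<open>Up to the factor i, the kernel of A (S - I): integrating k_ij(d_j t - d_i \<xi>) over 0
  < \<xi> < x yields this difference divided by d_i, and A multiplies by i d_i.\<close>

definition hker :: "'p \<Rightarrow> 'p \<Rightarrow> real \<Rightarrow> real \<Rightarrow> complex" where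
  "hker i j x t = kap i j (d $ j * t) - kap i j (d $ j * t - d $ i * x)"

lemma hker_measurable: "case_prod (hker i j) \<in> borel_measurable (Iv r \<Otimes>\<^sub>M Iv s)"
proof -
  have id: "(\<lambda>t. t) \<in> borel_measurable (Iv a)" for a
    by (rule continuous_measurable_Iv) (simp add: continuous_on_id)
  have [measurable]: "fst \<in> borel_measurable (Iv r \<Otimes>\<^sub>M Iv s)" "snd \<in> borel_measurable (Iv r \<Otimes>\<^sub>M Iv s)"
    using measurable_compose[OF measurable_fst id] measurable_compose[OF measurable_snd id] by auto
  have [measurable]: "kap i j \<in> borel_measurable borel"
    by (rule borel_measurable_continuous_onI[OF kap_cont])
  show ?thesis unfolding hker_def case_prod_beta' by measurable
qed

lemma hker_bounded: "\<exists>B. \<forall>x t. 0 < x \<longrightarrow> x < r \<longrightarrow> 0 < t \<longrightarrow> t < s \<longrightarrow> norm (hker i j x t) \<le> B"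
proof -
  have "continuous_on ({0..r} \<times> {0..s}) (\<lambda>p. hker i j (fst p) (snd p))"
    unfolding hker_def by (intro continuous_intros kap_cont')
  then have "bounded ((\<lambda>p. hker i j (fst p) (snd p)) ` ({0..r} \<times> {0..s}))"
    by (intro compact_imp_bounded compact_continuous_image compact_Times) auto
  then obtain B where B: "\<forall>y\<in>(\<lambda>p. hker i j (fst p) (snd p)) ` ({0..r} \<times> {0..s}). norm y \<le> B"
    unfolding bounded_iff by blast
  have "norm (hker i j x t) \<le> B" if "0 < x" "x < r" "0 < t" "t < s" for x t
    using bspec[OF B imageI, of "(x, t)"] that by simp
  then show ?thesis by blast
qed

lemma A_S_nth:
  assumes F: "F \<in> L2 r" and x: "0 < x" "x < r"
  shows "A_op d (S_op d k r F) x $ i = \<i> * of_real (d $ i) * (LINT t|Iv x. F t $ i)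
     + (\<Sum>j\<in>UNIV. \<i> * (LINT t|Iv r. hker i j x t * F t $ j))"
proof -
  have C1: "(LINT \<xi>|Iv x. LINT t|Iv r. K i j (d $ j * t - d $ i * \<xi>) * F t $ j) = (LINT t|Iv r. hker i j x t * F t $ j) / of_real (d $ i)" for j
  proof -
    have "(LINT \<xi>|Iv x. LINT t|Iv r. K i j (d $ j * t - d $ i * \<xi>) * F t $ j) = (LINT t|Iv r. (kap i j (d $ j * t) - kap i j (d $ j * t - d $ i * x)) / of_real (d $ i) * F t $ j)"
      by (rule convolution_Fubini(1)[OF K_loc L2_nth_integrable[OF F] d_nz neg]) (use x in simp)
    also have "\<dots> = (LINT t|Iv r. hker i j x t * F t $ j) / of_real (d $ i)"
      by (simp add: hker_def flip: integral_divide_zero)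
    finally show ?thesis .
  qed
  have C2: "integrable (Iv x) (\<lambda>\<xi>. LINT t|Iv r. K i j (d $ j * t - d $ i * \<xi>) * F t $ j)" for j
    by (rule convolution_Fubini(2)[OF K_loc L2_nth_integrable[OF F] d_nz neg]) (use x in simp)
  have "A_op d (S_op d k r F) x $ i = \<i> * of_real (d $ i) * (LINT \<xi>|Iv x. F \<xi> $ i + (\<Sum>j\<in>UNIV. LINT t|Iv r. K i j (d $ j * t - d $ i * \<xi>) * F t $ j))"
    by (simp add: A_op_def S_op_nth[OF F])
  also have "(LINT \<xi>|Iv x. F \<xi> $ i + (\<Sum>j\<in>UNIV. LINT t|Iv r. K i j (d $ j * t - d $ i * \<xi>) * F t $ j)) =
    (LINT \<xi>|Iv x. F \<xi> $ i) + (\<Sum>j\<in>UNIV. LINT \<xi>|Iv x. LINT t|Iv r. K i j (d $ j * t - d $ i * \<xi>) * F t $ j)"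
  proof -
    have "integrable (Iv x) (\<lambda>\<xi>. F \<xi> $ i)"
      using x by (intro L2_nth_integrable[OF L2_mono[OF F]]) auto
    then show ?thesis using C2 by (simp add: Bochner_Integration.integral_sum)
  qed
  also have "(\<Sum>j\<in>UNIV. LINT \<xi>|Iv x. LINT t|Iv r. K i j (d $ j * t - d $ i * \<xi>) * F t $ j) = 
     (\<Sum>j\<in>UNIV. (LINT t|Iv r. hker i j x t * F t $ j) / of_real (d $ i))"
    by (simp add: C1)
  finally show ?thesis
    by (simp add: distrib_left sum_distrib_left d_nz)
qed

lemma hker_pairing:
  assumes F: "F \<in> L2 r" and G: "G \<in> L2 r"
  shows "L2_inner r (A_op d (S_op d k r F)) G = 
     (\<Sum>i\<in>UNIV. \<i> * of_real (d $ i) * (LINT x|Iv r. (LINT t|Iv x. F t $ i) * cnj (G x $ i))) +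
     (\<Sum>i\<in>UNIV. \<Sum>j\<in>UNIV. \<i> * (LINT x|Iv r. (LINT t|Iv r. hker i j x t * F t $ j) * cnj (G x $ i)))"
proof -
  have G': "integrable (Iv r) (\<lambda>x. cnj (G x $ i))" for i using L2_nth_integrable[OF G] by simp
  have I1: "integrable (Iv r) (\<lambda>x. \<i> * of_real (d $ i) * ((LINT t|Iv x. F t $ i) * cnj (G x $ i)))" for i
    by (intro integrable_mult_right product_of_integrals_Iv(2) G' L2_nth_integrable F)
  have I2: "integrable (Iv r) (\<lambda>x. \<i> * ((LINT t|Iv r. hker i j x t * F t $ j) * cnj (G x $ i)))" for i j
  proof -
    obtain B where B: "\<And>x t. 0 < x \<Longrightarrow> x < r \<Longrightarrow> 0 < t \<Longrightarrow> t < r \<Longrightarrow> norm (hker i j x t) \<le> B"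
      using hker_bounded[of r r i j] by blast
    show ?thesis
      by (intro integrable_mult_right Fubini_Iv(2)[OF G' L2_nth_integrable[OF F] hker_measurable B])
  qed
  have "L2_inner r (A_op d (S_op d k r F)) G = (LINT x|Iv r. (\<Sum>i\<in>UNIV. \<i> * of_real (d $ i) * ((LINT t|Iv x. F t $ i) * cnj (G x $ i))
     + (\<Sum>j\<in>UNIV. \<i> * ((LINT t|Iv r. hker i j x t * F t $ j) * cnj (G x $ i)))))"
    unfolding L2_inner_def by (intro Bochner_Integration.integral_cong refl sum.cong)
      (auto simp: A_S_nth[OF F] distrib_right sum_distrib_right mult.assoc)
  then have X: "L2_inner r (A_op d (S_op d k r F)) G = 
     (\<Sum>i\<in>UNIV. LINT x|Iv r. \<i> * of_real (d $ i) * ((LINT t|Iv x. F t $ i) * cnj (G x $ i))) +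
     (\<Sum>i\<in>UNIV. \<Sum>j\<in>UNIV. LINT x|Iv r. \<i> * ((LINT t|Iv r. hker i j x t * F t $ j) * cnj (G x $ i)))"
    by (simp add: I1 I2 Bochner_Integration.integral_sum Bochner_Integration.integral_add sum.distrib del: integral_mult_right_zero)
  show ?thesis unfolding X by simp
qed

text \<open>The operator identity \<open>A S - S A\<^sup>* = i \<Pi> J \<Pi>\<^sup>*\<close> in weak form.\<close>

lemma operator_identity:
  assumes F: "F \<in> L2 r" and G: "G \<in> L2 r"
  shows "L2_inner r (A_op d (S_op d k r F)) G - cnj (L2_inner r (A_op d (S_op d k r G)) F) =
    \<i> * (\<Sum>j\<in>UNIV. L2_inner r (pi_col d k (Inl j)) G * L2_inner r F (pi_col d k (Inr j))
                + L2_inner r (pi_col d k (Inr j)) G * L2_inner r F (pi_col d k (Inl j)))"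
proof -
  define f where "f j = (LINT t|Iv r. F t $ j)" for j
  define g where "g i = (LINT t|Iv r. cnj (G t $ i))" for i
  define a where "a i j = (LINT t|Iv r. kap i j (d $ j * t) * F t $ j)" for i j
  define b where "b i j = (LINT t|Iv r. kap i j (- (d $ i * t)) * cnj (G t $ i))" for i j
  have Fi: "integrable (Iv r) (\<lambda>x. F x $ i)" for i by (rule L2_nth_integrable[OF F])
  have Gi: "integrable (Iv r) (\<lambda>x. cnj (G x $ i))" for i using L2_nth_integrable[OF G] by simp
  have bdd: "integrable (Iv r) (\<lambda>x. kap i j (c * x) * u x)" if "integrable (Iv r) u" for u :: "real \<Rightarrow> complex" and i j c
    by (intro integrable_continuous_mult_Iv that kap_cont' continuous_intros)
  have bdd': "integrable (Iv r) (\<lambda>x. kap i j (- (c * x)) * u x)" if "integrable (Iv r) u" for u :: "real \<Rightarrow> complex" and i j c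
    using bdd[OF that, of i j "-c"] by simp
  \<comment> \<open>In the conjugated term F and G have exchanged places. Fubini moves F inside, so
    that both terms can be compared under the same double integral.\<close>
  have swap: "(LINT x|Iv r. (LINT t|Iv r. cnj (hker i j x t) * cnj (G t $ j)) * F x $ i) =
     (LINT x|Iv r. (LINT t|Iv r. cnj (hker i j t x) * F t $ i) * cnj (G x $ j))" for i j
  proof -
    obtain B where B: "\<And>x t. 0 < x \<Longrightarrow> x < r \<Longrightarrow> 0 < t \<Longrightarrow> t < r \<Longrightarrow> norm (cnj (hker i j x t)) \<le> B"
      using hker_bounded[of r r i j] by (auto simp only: complex_mod_cnj)
    have "case_prod (\<lambda>x t. cnj (hker i j x t)) \<in> borel_measurable (Iv r \<Otimes>\<^sub>M Iv r)"
      using borel_measurable_continuous_on[OF continuous_on_cnj[OF continuous_on_id] hker_measurable[of i j r r]] by (simp add: case_prod_beta')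
    from Fubini_Iv(1)[OF Fi Gi this B] show ?thesis .
  qed
  have comb: "(LINT x|Iv r. (LINT t|Iv r. hker i j x t * F t $ j) * cnj (G x $ i)) +
     (LINT x|Iv r. (LINT t|Iv r. cnj (hker j i t x) * F t $ j) * cnj (G x $ i)) = a i j * g i - f j * b i j" for i j
  proof -
    obtain B where B: "\<And>x t. 0 < x \<Longrightarrow> x < r \<Longrightarrow> 0 < t \<Longrightarrow> t < r \<Longrightarrow> norm (hker i j x t) \<le> B"
      using hker_bounded[of r r i j] by blast
    obtain B' where B': "\<And>x t. 0 < x \<Longrightarrow> x < r \<Longrightarrow> 0 < t \<Longrightarrow> t < r \<Longrightarrow> norm (cnj (hker j i t x)) \<le> B'"
      using hker_bounded[of r r j i] by (auto simp only: complex_mod_cnj)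
    \<comment> \<open>By \<open>kap_minus\<close> the two values at d_j t - d_i x cancel. What
      remains is a function of t plus a function of x, so each double integral splits into products
      of single integrals; this is why the right-hand side has finite rank.\<close>
    have id: "hker i j x t + cnj (hker j i t x) = kap i j (d $ j * t) - kap i j (- (d $ i * x))" for x t
      using kap_minus[of i j "d $ i * x"] kap_minus[of i j "d $ i * x - d $ j * t"] by (simp add: hker_def)
    have eqh: "cnj (hker j i t x) = kap i j (d $ j * t) - kap i j (- (d $ i * x)) - hker i j x t" for x t
      using id[of x t] by (simp add: algebra_simps)
    have hI: "integrable (Iv r) (\<lambda>t. hker i j x t * F t $ j)" for x
    proof -
      have "integrable (Iv r) (\<lambda>t. kap i j (d $ j * t - d $ i * x) * F t $ j)"
        by (intro integrable_continuous_mult_Iv Fi kap_cont' continuous_intros)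
      then show ?thesis unfolding hker_def left_diff_distrib by (intro Bochner_Integration.integrable_diff bdd Fi)
    qed
    have inner: "(LINT t|Iv r. cnj (hker j i t x) * F t $ j) = a i j - kap i j (- (d $ i * x)) * f j - (LINT t|Iv r. hker i j x t * F t $ j)" for x
      unfolding eqh left_diff_distrib a_def f_def by (simp add: bdd Fi hI)
    have F2: "integrable (Iv r) (\<lambda>x. (LINT t|Iv r. hker i j x t * F t $ j) * cnj (G x $ i))"
      by (rule Fubini_Iv(2)[OF Gi Fi hker_measurable B])
    have "(LINT x|Iv r. (LINT t|Iv r. cnj (hker j i t x) * F t $ j) * cnj (G x $ i)) =
      (LINT x|Iv r. a i j * cnj (G x $ i) - f j * (kap i j (- (d $ i * x)) * cnj (G x $ i)) - (LINT t|Iv r. hker i j x t * F t $ j) * cnj (G x $ i))"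
      unfolding inner by (intro Bochner_Integration.integral_cong refl) (simp add: algebra_simps)
    also have "\<dots> = a i j * g i - f j * b i j - (LINT x|Iv r. (LINT t|Iv r. hker i j x t * F t $ j) * cnj (G x $ i))"
    proof -
      have I1: "integrable (Iv r) (\<lambda>x. a i j * cnj (G x $ i))" by (intro integrable_mult_right Gi)
      have I2: "integrable (Iv r) (\<lambda>x. f j * (kap i j (- (d $ i * x)) * cnj (G x $ i)))" by (intro integrable_mult_right bdd' Gi)
      show ?thesis unfolding g_def b_def
        by (simp only: Bochner_Integration.integral_diff[OF Bochner_Integration.integrable_diff[OF I1 I2] F2]
            Bochner_Integration.integral_diff[OF I1 I2] integral_mult_right_zero)
    qed
    finally show ?thesis by simp
  qed
  \<comment> \<open>The contribution of the identity in S: in component i the kernels of A and of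
    its adjoint fill the two triangles of the square, and A minus its adjoint has the constant
    kernel i d_i.\<close>
  have diag: "(LINT x|Iv r. (LINT t|Iv x. F t $ i) * cnj (G x $ i)) + (LINT x|Iv r. (LINT t|Iv x. cnj (G t $ i)) * F x $ i) = f i * g i" for i
    unfolding f_def g_def by (subst product_of_integrals_Iv(1)[OF Fi Gi]) (simp add: add.commute)
  have "cnj (L2_inner r (A_op d (S_op d k r G)) F) = 
     (\<Sum>i\<in>UNIV. - \<i> * of_real (d $ i) * (LINT x|Iv r. (LINT t|Iv x. cnj (G t $ i)) * F x $ i)) +
     (\<Sum>i\<in>UNIV. \<Sum>j\<in>UNIV. - \<i> * (LINT x|Iv r. (LINT t|Iv r. cnj (hker i j x t) * cnj (G t $ j)) * F x $ i))"
  proof -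
    have c2: "(LINT x|Iv r. (LINT t|Iv r. cnj (hker i j x t) * cnj (G t $ j)) * F x $ i) = cnj (LINT x|Iv r. (LINT t|Iv r. hker i j x t * G t $ j) * cnj (F x $ i))" for i j
      by (subst Bochner_Integration.integral_cnj[symmetric], simp only: complex_cnj_mult Bochner_Integration.integral_cnj[symmetric] complex_cnj_cnj)
    have c1: "(LINT x|Iv r. (LINT t|Iv x. cnj (G t $ i)) * F x $ i) = cnj (LINT x|Iv r. (LINT t|Iv x. G t $ i) * cnj (F x $ i))" for i
      by (subst Bochner_Integration.integral_cnj[symmetric], simp only: complex_cnj_mult Bochner_Integration.integral_cnj[symmetric] complex_cnj_cnj)
    show ?thesis unfolding hker_pairing[OF G F] c1 c2 by simp
  qed
  also have "(\<Sum>i\<in>UNIV. \<Sum>j\<in>UNIV. - \<i> * (LINT x|Iv r. (LINT t|Iv r. cnj (hker i j x t) * cnj (G t $ j)) * F x $ i)) =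
     (\<Sum>i\<in>UNIV. \<Sum>j\<in>UNIV. - \<i> * (LINT x|Iv r. (LINT t|Iv r. cnj (hker j i t x) * F t $ j) * cnj (G x $ i)))"
    unfolding swap by (rule sum.swap)
  finally have "L2_inner r (A_op d (S_op d k r F)) G - cnj (L2_inner r (A_op d (S_op d k r G)) F) =
     (\<Sum>i\<in>UNIV. \<i> * of_real (d $ i) * ((LINT x|Iv r. (LINT t|Iv x. F t $ i) * cnj (G x $ i)) + (LINT x|Iv r. (LINT t|Iv x. cnj (G t $ i)) * F x $ i))) +
     (\<Sum>i\<in>UNIV. \<Sum>j\<in>UNIV. \<i> * ((LINT x|Iv r. (LINT t|Iv r. hker i j x t * F t $ j) * cnj (G x $ i)) +
        (LINT x|Iv r. (LINT t|Iv r. cnj (hker j i t x) * F t $ j) * cnj (G x $ i))))"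
    unfolding hker_pairing[OF F G] by (simp add: distrib_left sum.distrib sum_negf)
  also have "\<dots> = (\<Sum>i\<in>UNIV. \<i> * of_real (d $ i) * (f i * g i)) + (\<Sum>i\<in>UNIV. \<Sum>j\<in>UNIV. \<i> * (a i j * g i - f j * b i j))"
    unfolding comb diag ..
  \<comment> \<open>The term d_j f_j g_j is divided evenly between the two products. The summand I/2
    in the definition of s is what makes the columns of Pi match these halves.\<close>
  also have "\<dots> = \<i> * (\<Sum>j\<in>UNIV. ((of_real (d $ j) / 2) * g j - (\<Sum>i\<in>UNIV. b i j)) * f j + g j * ((of_real (d $ j) / 2) * f j + (\<Sum>i\<in>UNIV. a j i)))"
  proof -
    have "(\<Sum>i\<in>UNIV. \<Sum>j\<in>UNIV. \<i> * (f j * b i j)) = (\<Sum>j\<in>UNIV. \<Sum>i\<in>UNIV. \<i> * (f j * b i j))" by (rule sum.swap)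
    then show ?thesis
      by (simp add: sum_distrib_left sum_distrib_right sum.distrib sum_subtractf algebra_simps)
  qed
  also have "\<dots> = \<i> * (\<Sum>j\<in>UNIV. L2_inner r (pi_col d k (Inl j)) G * L2_inner r F (pi_col d k (Inr j))
                + L2_inner r (pi_col d k (Inr j)) G * L2_inner r F (pi_col d k (Inl j)))"
  proof -
    have r1: "L2_inner r (pi_col d k (Inr j)) G = g j" for j
      unfolding L2_inner_def g_def by (simp add: pi_col_Inr if_distrib[of "\<lambda>a. a * _"] cong: if_cong)
    have r2: "L2_inner r F (pi_col d k (Inr j)) = f j" for j
      unfolding L2_inner_def f_def by (simp add: pi_col_Inr if_distrib[of cnj] if_distrib[of "\<lambda>a. _ * a"] cong: if_cong)
    have l1: "L2_inner r (pi_col d k (Inl j)) G = (of_real (d $ j) / 2) * g j - (\<Sum>i\<in>UNIV. b i j)" for j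
    proof -
      have "L2_inner r (pi_col d k (Inl j)) G = (LINT x|Iv r. (of_real (d $ j) / 2) * cnj (G x $ j) - (\<Sum>i\<in>UNIV. kap i j (- (d $ i * x)) * cnj (G x $ i)))"
        unfolding L2_inner_def by (intro Bochner_Integration.integral_cong refl)
          (simp add: pi_col_Inl left_diff_distrib sum_subtractf if_distrib[of "\<lambda>a. a * _"] cong: if_cong)
      also have "\<dots> = (of_real (d $ j) / 2) * g j - (\<Sum>i\<in>UNIV. b i j)"
      proof -
        have I1: "integrable (Iv r) (\<lambda>x. of_real (d $ j) / 2 * cnj (G x $ j))" by (intro integrable_mult_right Gi)
        have I2: "integrable (Iv r) (\<lambda>x. kap i j (- (d $ i * x)) * cnj (G x $ i))" for i by (intro bdd' Gi)
        show ?thesis unfolding g_def b_def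
          by (simp only: Bochner_Integration.integral_diff[OF I1 Bochner_Integration.integrable_sum[OF I2]]
            Bochner_Integration.integral_sum[OF I2] integral_mult_right_zero)
      qed
      finally show ?thesis .
    qed
    have l2: "L2_inner r F (pi_col d k (Inl j)) = (of_real (d $ j) / 2) * f j + (\<Sum>i\<in>UNIV. a j i)" for j
    proof -
      have "L2_inner r F (pi_col d k (Inl j)) = (LINT x|Iv r. (of_real (d $ j) / 2) * F x $ j + (\<Sum>i\<in>UNIV. kap j i (d $ i * x) * F x $ i))"
        unfolding L2_inner_def
      proof (intro Bochner_Integration.integral_cong refl)
        fix x assume "x \<in> space (Iv r)"
        then have "F x $ i * cnj (pi_col d k (Inl j) x $ i) = (if i = j then (of_real (d $ j) / 2) * F x $ j else 0) + kap j i (d $ i * x) * F x $ i" for i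
          using kap_minus[of j i "- (d $ i * x)"] by (auto simp: pi_col_Inl algebra_simps)
        then show "(\<Sum>i\<in>UNIV. F x $ i * cnj (pi_col d k (Inl j) x $ i)) = (of_real (d $ j) / 2) * F x $ j + (\<Sum>i\<in>UNIV. kap j i (d $ i * x) * F x $ i)"
          by (simp add: sum.distrib)
      qed
      also have "\<dots> = (of_real (d $ j) / 2) * f j + (\<Sum>i\<in>UNIV. a j i)"
        unfolding f_def a_def by (simp add: bdd Fi Bochner_Integration.integral_sum)
      finally show ?thesis .
    qed
    show ?thesis by (simp add: r1 r2 l1 l2)
  qed
  finally show ?thesis .
qed

end

section \<open>The triangular model\<close>

lemma norm_axis_one: "norm (axis i (1::complex)) = 1"
  by (simp add: norm_eq_1 inner_axis_axis)

lemma norm_matrix_vector_le: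
  fixes M :: "complex ^ 'n ^ 'm"
  shows "norm (M *v v) \<le> real (CARD('m) * CARD('n)) * norm M * norm v"
proof -
  have "norm (M *v v) \<le> (\<Sum>i\<in>UNIV. norm ((M *v v) $ i))" by (rule norm_vec_le_sum)
  also have "\<dots> \<le> (\<Sum>i\<in>(UNIV::'m set). real CARD('n) * (norm M * norm v))"
  proof (rule sum_mono)
    fix i
    have "norm ((M *v v) $ i) \<le> (\<Sum>j\<in>UNIV. norm (M $ i $ j * v $ j))"
      unfolding matrix_vector_mult_def by (simp add: norm_sum)
    also have "\<dots> \<le> (\<Sum>j\<in>(UNIV::'n set). norm M * norm v)"
      unfolding norm_mult by (intro sum_mono mult_mono norm_matrix_entry_le Finite_Cartesian_Product.norm_nth_le) auto
    finally show "norm ((M *v v) $ i) \<le> real CARD('n) * (norm M * norm v)" by simp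
  qed
  finally show ?thesis by (simp add: mult.assoc)
qed

text \<open>Square summability on a bounded triangle implies summability there, and Fubini gives
  almost every section. The integral in \<open>E_op\<close> at a point x is meaningful only when
  this section is integrable, since integrals of other functions default to 0.\<close>

lemma AE_section_integrable:
  fixes E :: "real \<Rightarrow> real \<Rightarrow> 'b::euclidean_space"
  assumes "(\<lambda>(x, t). E x t) square_summable_on {(x, t). 0 < t \<and> t < x \<and> x < r}"
  shows "AE x in Iv r. integrable (Iv x) (E x)"
proof -
  let ?D = "{(x, t). 0 < t \<and> t < x \<and> x < (r::real)}"
  let ?E = "\<lambda>(x, t). E x t"
  have D: "?D = {p. 0 < snd p \<and> snd p < fst p \<and> fst p < r}" by auto
  have "open ?D" unfolding D by (intro open_Collect_conj open_Collect_less continuous_intros)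
  moreover have "bounded ?D"
  proof (rule bounded_subset)
    show "?D \<subseteq> {0..r} \<times> {0..r}" by auto
  qed (simp add: bounded_Times)
  ultimately have "?D \<in> lmeasurable" by (rule lmeasurable_open[rotated])
  then have fin: "finite_measure (lebesgue_on ?D)" by (rule finite_measure_lebesgue_on)
  have "integrable (lebesgue_on ?D) ?E"
  proof (rule Bochner_Integration.integrable_bound)
    show "integrable (lebesgue_on ?D) (\<lambda>p. 1 + (norm (?E p))\<^sup>2)"
      using assms finite_measure.integrable_const[OF fin, of "1::real"] by (simp add: square_summable_on_def)
    show "?E \<in> borel_measurable (lebesgue_on ?D)" using assms by (simp add: square_summable_on_def)
    show "AE p in lebesgue_on ?D. norm (?E p) \<le> norm (1 + (norm (?E p))\<^sup>2)"
    proof (rule AE_I2)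
      fix p
      have "norm (?E p) \<le> 1 + (norm (?E p))\<^sup>2"
        using sum_squares_bound[of "norm (?E p)" 1] norm_ge_zero[of "?E p"] unfolding power_one by linarith
      then show "norm (?E p) \<le> norm (1 + (norm (?E p))\<^sup>2)" by simp
    qed
  qed
  moreover have "?D \<in> sets lebesgue" using \<open>?D \<in> lmeasurable\<close> by auto
  ultimately have I: "integrable lebesgue (\<lambda>p. indicator ?D p *\<^sub>R ?E p)"
    by (subst (asm) integrable_restrict_space) auto
  \<comment> \<open>Lebesgue measure on the plane is the completion of the product measure, so
    slices are taken of a Borel representative; for almost every x the exceptional slice is
    null.\<close>
  obtain g where g: "g \<in> borel_measurable borel" and fg: "AE p in lebesgue. indicator ?D p *\<^sub>R ?E p = g p"
    by (rule borel_representative[OF borel_measurable_integrable[OF I]])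
  have "integrable lebesgue g"
    by (rule integrable_cong_AE_imp[OF I _ fg]) (use g in \<open>simp add: measurable_completion\<close>)
  then have gi: "integrable lborel g" using g by (simp add: integrable_completion)
  then have gi': "integrable (lborel \<Otimes>\<^sub>M lborel) (case_prod (\<lambda>x t. g (x, t)))"
    by (simp add: lborel_prod)
  have a1: "AE x in lborel. integrable lborel (\<lambda>t. g (x, t))"
    using lborel_pair.AE_integrable_fst[OF gi'] .
  have "AE p in lborel \<Otimes>\<^sub>M lborel. indicator ?D p *\<^sub>R ?E p = g p"
    using fg unfolding lborel_prod AE_completion_iff .
  then have a2: "AE x in lborel. AE t in lborel. indicator ?D (x, t) *\<^sub>R E x t = g (x, t)"
    using lborel_pair.AE_pair by fastforce
  have "AE x in lborel. x \<in> {0<..<r} \<longrightarrow> integrable (Iv x) (E x)"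
    using a1 a2
  proof eventually_elim
    case (elim x)
    show ?case
    proof
      assume x: "x \<in> {0<..<r}"
      have gm: "(\<lambda>t. g (x, t)) \<in> borel_measurable borel" using g by measurable
      have "integrable lebesgue (\<lambda>t. g (x, t))"
        using elim(1) gm by (simp add: integrable_completion)
      then have "set_integrable lebesgue UNIV (\<lambda>t. g (x, t))" by (simp add: set_integrable_def)
      moreover have "AE t in lebesgue. g (x, t) = indicator ?D (x, t) *\<^sub>R E x t"
        using elim(2) by (intro AE_completion) (auto elim!: eventually_mono)
      ultimately have "set_integrable lebesgue UNIV (\<lambda>t. indicator ?D (x, t) *\<^sub>R E x t)"
        by (rule set_integrable_AE_eq)
      moreover have "indicator ?D (x, t) *\<^sub>R E x t = indicator {0<..<x} t *\<^sub>R E x t" for t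
        using x by (auto simp: indicator_def)
      ultimately show "integrable (Iv x) (E x)" by (simp add: set_integrable_def integrable_restrict_space)
    qed
  qed
  then show ?thesis
    using AE_completion by (auto simp: AE_restrict_space_iff)
qed

section \<open>The operator \<open>A\<close> and the factorization of the inverse of S\<close>

lemma A_op_continuous: "f \<in> L2 r \<Longrightarrow> continuous_on {0..r} (A_op d f)"
  unfolding A_op_def by (intro continuous_intros continuous_on_indefinite_Iv L2_nth_integrable)

lemma A_op_L2: "f \<in> L2 r \<Longrightarrow> A_op d f \<in> L2 r"
  by (rule L2_continuous[OF A_op_continuous])

lemma A_op_cong:
  assumes "f \<in> L2 r" "g \<in> L2 r" "L2_eq r f g" "x \<le> r"
  shows "A_op d f x = A_op d g x"
proof -
  have "(LINT t|Iv x. f t $ i) = (LINT t|Iv x. g t $ i)" for i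
  proof (rule integral_cong_AE)
    have "AE t in Iv x. f t = g t" using assms(3,4) unfolding L2_eq_def by (rule AE_Iv_mono)
    then show "AE t in Iv x. f t $ i = g t $ i" by eventually_elim simp
  qed (use L2_nth_measurable[OF L2_mono] assms in auto)
  then show ?thesis by (simp add: A_op_def)
qed

locale factored = admissible d k
  for d :: "real ^ 'p" and k :: "real \<Rightarrow> complex ^ 'p ^ 'p" +
  fixes E :: "real \<Rightarrow> real \<Rightarrow> complex ^ 'p ^ 'p"
  assumes tri: "triangular_factor d k E"
begin

abbreviation "S \<equiv> S_op d k"
abbreviation "A \<equiv> A_op d"
abbreviation "EO \<equiv> E_op E"
abbreviation "\<pi> \<equiv> pi_col d k"

lemma S_bounded: "0 < r \<Longrightarrow> bounded_op r (S r)"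
  using adm unfolding admissible_kernel_def by blast

lemma E_bounded: "0 < r \<Longrightarrow> bounded_op r EO"
  using tri unfolding triangular_factor_def by blast

lemma E_L2: "f \<in> L2 r \<Longrightarrow> 0 < r \<Longrightarrow> EO f \<in> L2 r"
  by (rule bounded_op_L2[OF E_bounded])

lemma E_section: "0 < r \<Longrightarrow> AE x in Iv r. integrable (Iv x) (E x)"
  by (rule AE_section_integrable) (use tri in \<open>unfold triangular_factor_def, blast\<close>)

text \<open>The form version of S^-1 = E' E, with R for S^-1. The factorization identity is used
  through this equality of inner products, so the adjoint never appears again.\<close>

lemma factor_inverse:
  assumes r: "0 < r"
  obtains R where "inverse_op r (S r) R"
    "\<And>f g. f \<in> L2 r \<Longrightarrow> g \<in> L2 r \<Longrightarrow> L2_inner r (EO f) (EO g) = L2_inner r f (R g)"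
proof -
  obtain E' where E': "adjoint_op r EO E'" "inverse_op r (S r) (E' \<circ> EO)"
    using tri r unfolding triangular_factor_def by blast
  have "L2_inner r (EO f) (EO g) = L2_inner r f ((E' \<circ> EO) g)" if "f \<in> L2 r" "g \<in> L2 r" for f g
    using E'(1) that E_L2[OF _ r] unfolding adjoint_op_def by simp
  then show ?thesis using that E'(2) by blast
qed

text \<open>Put F = R f and G = R g into \<open>operator_identity\<close>, where R inverts S. Then A
  S R f agrees with A f, and by \<open>factor_inverse\<close> every pairing with R becomes a pairing
  of images under E.\<close>

lemma E_identity:
  assumes r: "0 < r" and f: "f \<in> L2 r" and g: "g \<in> L2 r"
  shows "L2_inner r (EO (A f)) (EO g) - L2_inner r (EO f) (EO (A g)) =
    \<i> * (\<Sum>j\<in>UNIV. cnj (L2_inner r (EO g) (EO (\<pi> (Inl j)))) * L2_inner r (EO f) (EO (\<pi> (Inr j)))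
                + cnj (L2_inner r (EO g) (EO (\<pi> (Inr j)))) * L2_inner r (EO f) (EO (\<pi> (Inl j))))"
proof -
  obtain R where R: "inverse_op r (S r) R"
    and ER: "\<And>f g. f \<in> L2 r \<Longrightarrow> g \<in> L2 r \<Longrightarrow> L2_inner r (EO f) (EO g) = L2_inner r f (R g)"
    using factor_inverse[OF r] by blast
  have RL: "R h \<in> L2 r" if "h \<in> L2 r" for h using R that bounded_op_L2 unfolding inverse_op_def by blast
  have SR: "L2_eq r (S r (R h)) h" if "h \<in> L2 r" for h using R that unfolding inverse_op_def by blast
  have SL: "S r h \<in> L2 r" if "h \<in> L2 r" for h using bounded_op_L2[OF S_bounded[OF r] that] .
  have AS: "L2_inner r (A h) u = L2_inner r (A (S r (R h))) u" if "h \<in> L2 r" "u \<in> L2 r" for h u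
  proof (rule L2_inner_cong)
    show "L2_eq r (A h) (A (S r (R h)))"
      by (rule L2_eqI) (intro A_op_cong[of _ r] that SL RL L2_eq_sym[OF SR], simp)
    show "L2_eq r u u" by (simp add: L2_eq_def)
  qed (intro A_op_L2 SL RL that)+
  have 1: "L2_inner r (EO (A f)) (EO g) = L2_inner r (A (S r (R f))) (R g)"
    using ER[OF A_op_L2[OF f] g] AS[OF f RL[OF g]] by simp
  have "L2_inner r (EO f) (EO (A g)) = cnj (L2_inner r (EO (A g)) (EO f))"
    by (intro L2_inner_commute E_L2 A_op_L2 f g r)
  also have "\<dots> = cnj (L2_inner r (A (S r (R g))) (R f))"
    using ER[OF A_op_L2[OF g] f] AS[OF g RL[OF f]] by simp
  finally have 2: "L2_inner r (EO f) (EO (A g)) = cnj (L2_inner r (A (S r (R g))) (R f))" .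
  have 3: "L2_inner r (\<pi> c) (R g) = cnj (L2_inner r (EO g) (EO (\<pi> c)))" for c
    using ER[OF pi_col_L2 g, of c] L2_inner_commute[OF E_L2[OF g r] E_L2[OF pi_col_L2 r], of c] by simp
  have 4: "L2_inner r (R f) (\<pi> c) = L2_inner r (EO f) (EO (\<pi> c))" for c
    using ER[OF pi_col_L2 f, of c] L2_inner_commute[OF E_L2[OF pi_col_L2 r] E_L2[OF f r], of c]
      L2_inner_commute[OF pi_col_L2 RL[OF f], of c] by simp
  show ?thesis unfolding 1 2 operator_identity[OF RL[OF f] RL[OF g]] 3 4 ..
qed

text \<open>Column c of beta is E applied to column c of Pi, so this is entry c of beta^* E f. Its
  primitive \<open>B\<close> below is entry c of the integral of beta^* E f, the vector that J acts
  on in the triangular model.\<close>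

definition bden :: "'p + 'p \<Rightarrow> (real \<Rightarrow> complex ^ 'p) \<Rightarrow> real \<Rightarrow> complex" where
  "bden c f x = cinner (EO f x) (EO (\<pi> c) x)"

definition B :: "'p + 'p \<Rightarrow> (real \<Rightarrow> complex ^ 'p) \<Rightarrow> real \<Rightarrow> complex" where
  "B c f x = (LINT t|Iv x. bden c f t)"

lemma B_inner: "B c f x = L2_inner x (EO f) (EO (\<pi> c))"
  by (simp add: B_def bden_def L2_inner_cinner)

lemma bden_integrable: "f \<in> L2 r \<Longrightarrow> 0 < r \<Longrightarrow> integrable (Iv r) (bden c f)"
  unfolding bden_def by (intro cinner_integrable E_L2 pi_col_L2)

text \<open>E does not depend on r, so \<open>E_identity\<close> holds on every (0, x) and may be
  differentiated in x. The products of two functions \<open>B\<close> on its right-hand side are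
  integrals of the density given by the product rule, by \<open>product_of_integrals_Iv\<close>;
  equality of all the integrals gives equality of the densities.\<close>

lemma pointwise_identity:
  assumes r: "0 < r" and f: "f \<in> L2 r" and g: "g \<in> L2 r"
  shows "AE x in Iv r. cinner (EO (A f) x) (EO g x) - cinner (EO f x) (EO (A g) x) =
    \<i> * (\<Sum>j\<in>UNIV. (cnj (B (Inl j) g x) * bden (Inr j) f x + B (Inr j) f x * cnj (bden (Inl j) g x)) +
                    (cnj (B (Inr j) g x) * bden (Inl j) f x + B (Inl j) f x * cnj (bden (Inr j) g x)))"
    (is "AE x in _. ?L x = \<i> * (\<Sum>j\<in>UNIV. ?P j x + ?Q j x)")
proof -
  have Li: "integrable (Iv r) ?L"
    by (intro Bochner_Integration.integrable_diff cinner_integrable E_L2 A_op_L2 f g r)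
  have cB: "(LINT t|Iv x. cnj (bden c g t)) = cnj (B c g x)" for x c by (simp add: B_def)
  have PP: "integrable (Iv r) (\<lambda>x. cnj (B c' g x) * bden c f x + B c f x * cnj (bden c' g x))"
    and PI: "x \<in> {0<..r} \<Longrightarrow> (LINT t|Iv x. cnj (B c' g t) * bden c f t + B c f t * cnj (bden c' g t)) = cnj (B c' g x) * B c f x" for c c' x
  proof -
    have bf: "integrable (Iv r) (bden c f)" by (rule bden_integrable[OF f r])
    have bg: "integrable (Iv r) (\<lambda>x. cnj (bden c' g x))" using bden_integrable[OF g r] by simp
    have i1: "integrable (Iv r) (\<lambda>x. cnj (B c' g x) * bden c f x)"
      using product_of_integrals_Iv(2)[OF bf bg] by (simp add: B_def)
    have i2: "integrable (Iv r) (\<lambda>x. B c f x * cnj (bden c' g x))"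
      using product_of_integrals_Iv(2)[OF bg bf] by (simp add: B_def)
    show "integrable (Iv r) (\<lambda>x. cnj (B c' g x) * bden c f x + B c f x * cnj (bden c' g x))"
      using i1 i2 by (rule Bochner_Integration.integrable_add)
    assume x: "x \<in> {0<..r}"
    have "(LINT t|Iv x. cnj (B c' g t) * bden c f t + B c f t * cnj (bden c' g t)) = (LINT t|Iv x. cnj (B c' g t) * bden c f t) + (LINT t|Iv x. B c f t * cnj (bden c' g t))"
      using x i1 i2 by (intro Bochner_Integration.integral_add) (auto intro: integrable_Iv_mono)
    also have "\<dots> = (LINT t|Iv x. bden c f t) * (LINT t|Iv x. cnj (bden c' g t))"
      using product_of_integrals_Iv(1)[of x "bden c f" "\<lambda>x. cnj (bden c' g x)"] x integrable_Iv_mono[OF bf, of x] integrable_Iv_mono[OF bg, of x]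
      by (simp only: cB B_def[symmetric]) auto
    finally show "(LINT t|Iv x. cnj (B c' g t) * bden c f t + B c f t * cnj (bden c' g t)) = cnj (B c' g x) * B c f x"
      by (simp add: cB B_def[symmetric] mult.commute)
  qed
  show ?thesis
  proof (rule AE_eq_of_integrals_Iv[OF Li])
    show "integrable (Iv r) (\<lambda>x. \<i> * (\<Sum>j\<in>UNIV. ?P j x + ?Q j x))"
      by (intro integrable_mult_right Bochner_Integration.integrable_sum Bochner_Integration.integrable_add[OF PP PP])
    fix x assume x: "0 < x" "x \<le> r"
    have fx: "f \<in> L2 x" and gx: "g \<in> L2 x" using L2_mono f g x by auto
    have "(LINT t|Iv x. ?L t) = L2_inner x (EO (A f)) (EO g) - L2_inner x (EO f) (EO (A g))"
      unfolding L2_inner_cinner by (intro Bochner_Integration.integral_diff cinner_integrable E_L2 A_op_L2 fx gx x)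
    also have "\<dots> = \<i> * (\<Sum>j\<in>UNIV. cnj (B (Inl j) g x) * B (Inr j) f x + cnj (B (Inr j) g x) * B (Inl j) f x)"
      unfolding E_identity[OF x(1) fx gx] B_inner ..
    also have "\<dots> = \<i> * (\<Sum>j\<in>UNIV. (LINT t|Iv x. ?P j t) + (LINT t|Iv x. ?Q j t))"
      using x by (simp add: PI)
    also have "\<dots> = (LINT t|Iv x. \<i> * (\<Sum>j\<in>UNIV. ?P j t + ?Q j t))"
    proof -
      have i: "integrable (Iv x) (?P j)" "integrable (Iv x) (?Q j)" for j
        using integrable_Iv_mono[OF PP x(2)] by auto
      show ?thesis
        by (simp only: integral_mult_right_zero Bochner_Integration.integral_sum[OF Bochner_Integration.integrable_add[OF i]] Bochner_Integration.integral_add[OF i])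
    qed
    finally show "(LINT t|Iv x. ?L t) = (LINT t|Iv x. \<i> * (\<Sum>j\<in>UNIV. ?P j t + ?Q j t))" .
  qed
qed

definition step :: "'p \<Rightarrow> real \<Rightarrow> real \<Rightarrow> complex ^ 'p" where
  "step i s t = (if s < t then axis i 1 else 0)"

lemma step_L2: "step i s \<in> L2 r"
proof (rule L2_bounded)
  fix l
  have "(\<lambda>t. step i s t $ l) = (\<lambda>t. indicator {s<..} t *\<^sub>R (axis i 1 $ l))"
    by (auto simp: step_def fun_eq_iff indicator_def)
  moreover have "(\<lambda>t. indicator {s<..} t *\<^sub>R (axis i 1 $ l :: complex)) \<in> borel_measurable lebesgue"
    by (intro borel_measurable_scaleR borel_measurable_indicator borel_measurable_const) auto
  ultimately show "(\<lambda>t. step i s t $ l) \<in> borel_measurable (Iv r)" by (simp add: measurable_restrict_space1)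
  show "norm (step i s x) \<le> 1" for x by (simp add: step_def norm_axis_one)
qed

lemma step_tendsto_0:
  assumes "s \<longlonglongrightarrow> x" "t < x"
  shows "(\<lambda>n. step i (s n) t) \<longlonglongrightarrow> 0"
proof (rule tendsto_eventually)
  show "\<forall>\<^sub>F n in sequentially. step i (s n) t = 0"
    using order_tendstoD(1)[OF assms] by eventually_elim (simp add: step_def)
qed

lemma A_step_tendsto_0:
  assumes s: "s \<longlonglongrightarrow> x" and t: "t \<le> x"
  shows "(\<lambda>n. A (step i (s n)) t) \<longlonglongrightarrow> 0"
proof -
  have "(\<lambda>n. LINT u|Iv t. step i (s n) u $ l) \<longlonglongrightarrow> (LINT u|Iv t. 0)" for l
  proof (rule integral_dominated_convergence[where w="\<lambda>_. 1"])
    show "integrable (Iv t) (\<lambda>_. 1::real)" by (intro finite_measure.integrable_const finite_measure_Iv)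
    show "AE u in Iv t. (\<lambda>n. step i (s n) u $ l) \<longlonglongrightarrow> 0"
      using tendsto_vec_nth[OF step_tendsto_0[OF s], of _ i l] t by (intro AE_I2) auto
    show "AE u in Iv t. norm (step i (s n) u $ l) \<le> 1" for n
      by (intro AE_I2) (auto simp: step_def axis_def)
  qed (use L2_nth_measurable[OF step_L2] in auto)
  then have "(\<lambda>n. \<chi> l. \<i> * of_real (d $ l) * (LINT u|Iv t. step i (s n) u $ l)) \<longlonglongrightarrow> (\<chi> l. \<i> * of_real (d $ l) * 0)"
    by (intro tendsto_vec_lambda tendsto_mult tendsto_const) simp
  moreover have "(\<chi> l. \<i> * of_real (d $ l) * 0) = (0::complex^'p)" by (simp add: vec_eq_iff)
  ultimately show ?thesis by (simp add: A_op_def)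
qed

lemma A_step_bounded: "\<exists>C. \<forall>s t. 0 < t \<longrightarrow> t < x \<longrightarrow> norm (A (step i s) t) \<le> C"
proof (intro exI allI impI)
  fix s t assume t: "0 < t" "t < x"
  have int1: "(LINT u|Iv t. (1::real)) = t" using t by (simp add: measure_restrict_space)
  have "norm (LINT u|Iv t. step i s u $ l) \<le> x" for l
  proof -
    have "norm (LINT u|Iv t. step i s u $ l) \<le> (LINT u|Iv t. norm (step i s u $ l))" by (rule integral_norm_bound)
    also have "\<dots> \<le> (LINT u|Iv t. 1)"
      by (intro integral_mono finite_measure.integrable_const finite_measure_Iv integrable_norm L2_nth_integrable step_L2)
        (auto simp: step_def axis_def)
    finally show ?thesis using int1 t by simp
  qed
  then have "norm (\<i> * of_real (d $ l) * (LINT u|Iv t. step i s u $ l)) \<le> \<bar>d $ l\<bar> * x" for l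
    by (simp add: norm_mult mult_left_mono)
  then have "(\<Sum>l\<in>UNIV. norm (A (step i s) t $ l)) \<le> (\<Sum>l\<in>UNIV. \<bar>d $ l\<bar> * x)"
    by (intro sum_mono) (simp add: A_op_def)
  then show "norm (A (step i s) t) \<le> (\<Sum>l\<in>UNIV. \<bar>d $ l\<bar> * x)"
    using norm_vec_le_sum order_trans by blast
qed

text \<open>The Volterra integral over (0, x) does not see the endpoint: dominated convergence sends
  it to 0, while the value at x survives through the identity part of E. This is why test functions
  concentrated to the left of x isolate the value at x.\<close>

lemma E_apply_tendsto:
  fixes g :: "nat \<Rightarrow> real \<Rightarrow> complex ^ 'p"
  assumes E: "integrable (Iv x) (E x)" and g: "\<And>n. g n \<in> L2 x"
    and lim: "\<And>t. 0 < t \<Longrightarrow> t < x \<Longrightarrow> (\<lambda>n. g n t) \<longlonglongrightarrow> 0"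
    and bd: "\<And>n t. 0 < t \<Longrightarrow> t < x \<Longrightarrow> norm (g n t) \<le> C"
    and at: "(\<lambda>n. g n x) \<longlonglongrightarrow> L"
  shows "(\<lambda>n. EO (g n) x) \<longlonglongrightarrow> L"
proof -
  have "(\<lambda>n. LINT t|Iv x. E x t *v g n t) \<longlonglongrightarrow> (LINT t|Iv x. 0)"
  proof (rule integral_dominated_convergence[where w="\<lambda>t. real (CARD('p) * CARD('p)) * norm (E x t) * C"])
    show "integrable (Iv x) (\<lambda>t. real (CARD('p) * CARD('p)) * norm (E x t) * C)"
      by (intro integrable_mult_left integrable_mult_right integrable_norm E)
    have Em: "(\<lambda>t. E x t $ i $ j) \<in> borel_measurable (Iv x)" for i j
      by (rule borel_measurable_continuous_on[OF _ borel_measurable_integrable[OF E]]) (intro continuous_intros)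
    show "(\<lambda>t. E x t *v g n t) \<in> borel_measurable (Iv x)" for n
      by (rule measurable_vecI, simp only: matrix_vector_mult_def vec_lambda_beta)
        (intro borel_measurable_sum borel_measurable_times Em L2_nth_measurable[OF g])
    show "AE t in Iv x. (\<lambda>n. E x t *v g n t) \<longlonglongrightarrow> 0"
    proof (rule AE_I2)
      fix t assume "t \<in> space (Iv x)"
      then have t: "0 < t" "t < x" by auto
      have "(\<lambda>n. \<chi> i. \<Sum>j\<in>UNIV. E x t $ i $ j * g n t $ j) \<longlonglongrightarrow> (\<chi> i. \<Sum>j\<in>UNIV. E x t $ i $ j * (0::complex^'p) $ j)"
        by (intro tendsto_vec_lambda tendsto_sum tendsto_mult tendsto_const tendsto_vec_nth lim t)
      moreover have "(\<chi> i. \<Sum>j\<in>UNIV. E x t $ i $ j * (0::complex^'p) $ j) = 0" by (simp add: vec_eq_iff)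
      ultimately show "(\<lambda>n. E x t *v g n t) \<longlonglongrightarrow> 0" by (simp add: matrix_vector_mult_def)
    qed
    show "AE t in Iv x. norm (E x t *v g n t) \<le> real (CARD('p) * CARD('p)) * norm (E x t) * C" for n
      by (intro AE_I2 order_trans[OF norm_matrix_vector_le] mult_left_mono bd) auto
  qed simp
  then have "(\<lambda>n. g n x + (LINT t|Iv x. E x t *v g n t)) \<longlonglongrightarrow> L + (LINT t|Iv x. 0)"
    by (intro tendsto_add at)
  then show ?thesis by (simp add: E_op_def)
qed

text \<open>E is lower triangular, so E applied to the step vanishes up to s, and the inner product
  only sees (s, x). There it meets the cut-off \<open>?h\<close> of E applied to column c of Pi.
  Boundedness of E and dominated convergence make both square norms tend to 0.\<close>

lemma B_step_tendsto_0:
  assumes s: "s \<longlonglongrightarrow> x" and x: "0 < x" and s0: "\<And>n. s n < x"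
  shows "(\<lambda>n. B c (step i (s n)) x) \<longlonglongrightarrow> 0"
proof -
  let ?h = "\<lambda>n t. if s n < t then EO (\<pi> c) t else 0"
  have piL: "EO (\<pi> c) \<in> L2 x" by (intro E_L2 pi_col_L2 x)
  have hL: "?h n \<in> L2 x" for n
  proof (rule L2I)
    show m: "?h n \<in> borel_measurable (Iv x)"
    proof -
      have "(\<lambda>t. indicator {s n<..} t *\<^sub>R EO (\<pi> c) t) \<in> borel_measurable (Iv x)"
        by (intro borel_measurable_scaleR L2_measurable piL measurable_restrict_space1 borel_measurable_indicator) auto
      moreover have "(\<lambda>t. indicator {s n<..} t *\<^sub>R EO (\<pi> c) t) = ?h n" by (auto simp: indicator_def)
      ultimately show ?thesis by simp
    qed
    show "integrable (Iv x) (\<lambda>t. (norm (?h n t))\<^sup>2)"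
      by (rule Bochner_Integration.integrable_bound[OF L2_norm_integrable[OF piL]]) (use m in \<open>auto intro!: borel_measurable_power borel_measurable_norm\<close>)
  qed
  obtain C where C: "\<And>f. f \<in> L2 x \<Longrightarrow> L2_norm x (EO f) \<le> C * L2_norm x f"
    using E_bounded[OF x] unfolding bounded_op_def by blast
  have E0: "EO (step i (s n)) t = 0" if "t \<le> s n" for n t
  proof -
    have "(LINT u|Iv t. E t u *v step i (s n) u) = (LINT u|Iv t. 0)"
      using that by (intro Bochner_Integration.integral_cong refl) (auto simp: step_def matrix_vector_mult_0_right)
    then show ?thesis using that by (simp add: E_op_def step_def)
  qed
  have ss: "(LINT t|Iv x. (norm (f t))\<^sup>2) = (L2_norm x f)\<^sup>2" for f :: "real \<Rightarrow> complex^'p"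
    unfolding L2_norm_def by (simp add: integral_nonneg_AE)
  have le: "norm (B c (step i (s n)) x) \<le> C\<^sup>2 * (LINT t|Iv x. (norm (step i (s n) t))\<^sup>2) + (LINT t|Iv x. (norm (?h n t))\<^sup>2)" for n
  proof -
    have eq: "B c (step i (s n)) x = L2_inner x (EO (step i (s n))) (?h n)"
      unfolding B_def bden_def L2_inner_cinner by (intro Bochner_Integration.integral_cong refl) (auto simp: E0 not_less)
    have "norm (B c (step i (s n)) x) \<le> Re (L2_inner x (EO (step i (s n))) (EO (step i (s n)))) + Re (L2_inner x (?h n) (?h n))"
      unfolding eq by (rule norm_L2_inner_le[OF E_L2[OF step_L2 x] hL])
    also have "\<dots> = (LINT t|Iv x. (norm (EO (step i (s n)) t))\<^sup>2) + (LINT t|Iv x. (norm (?h n t))\<^sup>2)"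
      by (simp only: L2_norm_inner[OF E_L2[OF step_L2 x]] L2_norm_inner[OF hL])
    also have "(LINT t|Iv x. (norm (EO (step i (s n)) t))\<^sup>2) \<le> C\<^sup>2 * (LINT t|Iv x. (norm (step i (s n) t))\<^sup>2)"
      unfolding ss power_mult_distrib[symmetric] by (intro power_mono C step_L2) (simp add: L2_norm_def integral_nonneg_AE)
    finally show ?thesis by simp
  qed
  have l1: "(\<lambda>n. LINT t|Iv x. (norm (step i (s n) t))\<^sup>2) \<longlonglongrightarrow> (LINT t|Iv x. 0)"
  proof (rule integral_dominated_convergence[where w="\<lambda>_. 1"])
    show "integrable (Iv x) (\<lambda>_. 1::real)" by (intro finite_measure.integrable_const finite_measure_Iv)
    show "AE t in Iv x. (\<lambda>n. (norm (step i (s n) t))\<^sup>2) \<longlonglongrightarrow> 0"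
    proof (rule AE_I2)
      fix t assume "t \<in> space (Iv x)"
      then have "(\<lambda>n. (norm (step i (s n) t))\<^sup>2) \<longlonglongrightarrow> (norm (0::complex^'p))\<^sup>2"
        by (intro tendsto_power tendsto_norm step_tendsto_0[OF s]) auto
      then show "(\<lambda>n. (norm (step i (s n) t))\<^sup>2) \<longlonglongrightarrow> 0" by simp
    qed
    show "AE t in Iv x. norm ((norm (step i (s n) t))\<^sup>2) \<le> 1" for n
      by (intro AE_I2) (auto simp: step_def norm_axis_one)
  qed (use L2_measurable[OF step_L2] in \<open>auto intro!: borel_measurable_power borel_measurable_norm\<close>)
  have l2: "(\<lambda>n. LINT t|Iv x. (norm (?h n t))\<^sup>2) \<longlonglongrightarrow> (LINT t|Iv x. 0)"
  proof (rule integral_dominated_convergence[where w="\<lambda>t. (norm (EO (\<pi> c) t))\<^sup>2"])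
    show "AE t in Iv x. (\<lambda>n. (norm (?h n t))\<^sup>2) \<longlonglongrightarrow> 0"
    proof (rule AE_I2)
      fix t assume "t \<in> space (Iv x)"
      then have "t < x" by simp
      show "(\<lambda>n. (norm (?h n t))\<^sup>2) \<longlonglongrightarrow> 0"
      proof (rule tendsto_eventually)
        show "\<forall>\<^sub>F n in sequentially. (norm (?h n t))\<^sup>2 = 0"
          using order_tendstoD(1)[OF s \<open>t < x\<close>] by eventually_elim simp
      qed
    qed
  qed (use L2_measurable[OF hL] L2_norm_integrable[OF piL] in \<open>auto intro!: borel_measurable_power borel_measurable_norm AE_I2\<close>)
  have lim: "(\<lambda>n. C\<^sup>2 * (LINT t|Iv x. (norm (step i (s n) t))\<^sup>2) + (LINT t|Iv x. (norm (?h n t))\<^sup>2)) \<longlonglongrightarrow> 0"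
    using tendsto_add[OF tendsto_mult_left[OF l1, of "C\<^sup>2"] l2] by simp
  show ?thesis
    by (rule Lim_null_comparison[OF _ lim]) (rule always_eventually[OF allI[OF le]])
qed

lemma tendsto_cinner:
  assumes "f \<longlonglongrightarrow> u" "g \<longlonglongrightarrow> v"
  shows "(\<lambda>n. cinner (f n) (g n)) \<longlonglongrightarrow> cinner u v"
  unfolding cinner_def by (intro tendsto_sum tendsto_mult tendsto_cnj tendsto_vec_nth assms)

lemma cinner_axis: "cinner v (axis i 1) = v $ i" "cinner (axis i 1) v = cnj (v $ i)"
  by (simp_all add: cinner_def axis_def if_distrib[of cnj] if_distrib[of "\<lambda>a. _ * a"] if_distrib[of "\<lambda>a. a * _"] cong: if_cong)

text \<open>The triangular model \<open>E A = i \<beta> J (\<integral> \<beta>\<^sup>* E)\<close> of the operator \<open>A\<close>: the difference of both sides is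
  symmetric by \<open>pointwise_identity\<close> and Volterra, and testing with \<open>step i s\<close> as \<open>s\<close> increases to \<open>x\<close> shows that it is zero at \<open>x\<close>.\<close>

lemma triangular_model:
  assumes r: "0 < r" and f: "f \<in> L2 r"
  shows "AE x in Iv r. EO (A f) x = \<i> *s (\<Sum>j\<in>UNIV. B (Inr j) f x *s EO (\<pi> (Inl j)) x + B (Inl j) f x *s EO (\<pi> (Inr j)) x)"
proof -
  \<comment> \<open>The null set in \<open>pointwise_identity\<close> depends on the test function.
    Rational step positions and finitely many directions leave a countable family, hence a single
    null set.\<close>
  have "AE x in Iv r. \<forall>p\<in>\<rat> \<times> UNIV. cinner (EO (A f) x) (EO (step (snd p) (fst p)) x) - cinner (EO f x) (EO (A (step (snd p) (fst p))) x) =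
    \<i> * (\<Sum>j\<in>UNIV. (cnj (B (Inl j) (step (snd p) (fst p)) x) * bden (Inr j) f x + B (Inr j) f x * cnj (bden (Inl j) (step (snd p) (fst p)) x)) +
                    (cnj (B (Inr j) (step (snd p) (fst p)) x) * bden (Inl j) f x + B (Inl j) f x * cnj (bden (Inr j) (step (snd p) (fst p)) x)))"
    by (subst AE_ball_countable) (auto intro!: countable_SIGMA countable_rat pointwise_identity[OF r f step_L2] simp del: Sigma_cong)
  moreover have "AE x in Iv r. 0 < x" by (intro AE_I2) simp
  ultimately show ?thesis using E_section[OF r]
  proof eventually_elim
    case (elim x)
    note id = elim(1) and x = elim(2) and Ex = elim(3)
    \<comment> \<open>The steps must start strictly before x, so that their value at x is the unit
      vector, and at rational points, where the identity is available for this x.\<close>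
    have "\<exists>q\<in>\<rat>. x - 1 / real (Suc n) < q \<and> q < x" for n by (intro Rats_dense_in_real) simp
    then obtain s where s: "\<And>n. s n \<in> \<rat>" "\<And>n. x - 1 / real (Suc n) < s n" "\<And>n. s n < x" by metis
    have sx: "s \<longlonglongrightarrow> x"
    proof (rule tendsto_sandwich)
      show "(\<lambda>n. x - 1 / real (Suc n)) \<longlonglongrightarrow> x"
        using tendsto_diff[OF tendsto_const LIMSEQ_inverse_real_of_nat, of x] by (simp add: inverse_eq_divide)
      show "(\<lambda>n. x) \<longlonglongrightarrow> x" by simp
    qed (use s in \<open>auto intro!: always_eventually less_imp_le\<close>)
    show ?case
    proof (subst vec_eq_iff, rule allI)
      fix i
      have e1: "(\<lambda>n. EO (step i (s n)) x) \<longlonglongrightarrow> axis i 1"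
      proof (rule E_apply_tendsto[OF Ex step_L2])
        show "norm (step i (s n) t) \<le> 1" for n t by (simp add: step_def norm_axis_one)
        show "(\<lambda>n. step i (s n) x) \<longlonglongrightarrow> axis i 1" using s by (simp add: step_def)
      qed (rule step_tendsto_0[OF sx])
      obtain C where C: "\<And>s t. 0 < t \<Longrightarrow> t < x \<Longrightarrow> norm (A (step i s) t) \<le> C"
        using A_step_bounded[of x i] by blast
      have e2: "(\<lambda>n. EO (A (step i (s n))) x) \<longlonglongrightarrow> 0"
        by (rule E_apply_tendsto[OF Ex A_op_L2[OF step_L2] A_step_tendsto_0[OF sx] C A_step_tendsto_0[OF sx]]) auto
      have e3: "(\<lambda>n. B c (step i (s n)) x) \<longlonglongrightarrow> 0" for c by (rule B_step_tendsto_0[OF sx x s(3)])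
      have e4: "(\<lambda>n. bden c (step i (s n)) x) \<longlonglongrightarrow> cinner (axis i 1) (EO (\<pi> c) x)" for c
        unfolding bden_def by (intro tendsto_cinner e1 tendsto_const)
      \<comment> \<open>In the limit E applied to the step becomes the unit vector, while E A
        applied to the step and every \<open>B\<close> of the step vanish; the remainder is
        component i of the claim.\<close>
      have l: "(\<lambda>n. cinner (EO (A f) x) (EO (step i (s n)) x) - cinner (EO f x) (EO (A (step i (s n))) x)) \<longlonglongrightarrow>
          cinner (EO (A f) x) (axis i 1) - cinner (EO f x) 0"
        by (intro tendsto_diff tendsto_cinner e1 e2 tendsto_const)
      have r: "(\<lambda>n. \<i> * (\<Sum>j\<in>UNIV. (cnj (B (Inl j) (step i (s n)) x) * bden (Inr j) f x + B (Inr j) f x * cnj (bden (Inl j) (step i (s n)) x)) +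
                    (cnj (B (Inr j) (step i (s n)) x) * bden (Inl j) f x + B (Inl j) f x * cnj (bden (Inr j) (step i (s n)) x)))) \<longlonglongrightarrow>
          \<i> * (\<Sum>j\<in>UNIV. (cnj 0 * bden (Inr j) f x + B (Inr j) f x * cnj (cinner (axis i 1) (EO (\<pi> (Inl j)) x))) +
                    (cnj 0 * bden (Inl j) f x + B (Inl j) f x * cnj (cinner (axis i 1) (EO (\<pi> (Inr j)) x))))"
        by (intro tendsto_mult tendsto_sum tendsto_add tendsto_cnj e3 e4 tendsto_const)
      have "cinner (EO (A f) x) (EO (step i (s n)) x) - cinner (EO f x) (EO (A (step i (s n))) x) =
         \<i> * (\<Sum>j\<in>UNIV. (cnj (B (Inl j) (step i (s n)) x) * bden (Inr j) f x + B (Inr j) f x * cnj (bden (Inl j) (step i (s n)) x)) +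
                    (cnj (B (Inr j) (step i (s n)) x) * bden (Inl j) f x + B (Inl j) f x * cnj (bden (Inr j) (step i (s n)) x)))" for n
        using bspec[OF id, of "(s n, i)"] s(1) by simp
      then have "cinner (EO (A f) x) (axis i 1) - cinner (EO f x) 0 = 
          \<i> * (\<Sum>j\<in>UNIV. (cnj 0 * bden (Inr j) f x + B (Inr j) f x * cnj (cinner (axis i 1) (EO (\<pi> (Inl j)) x))) +
                    (cnj 0 * bden (Inl j) f x + B (Inl j) f x * cnj (cinner (axis i 1) (EO (\<pi> (Inr j)) x))))"
        using LIMSEQ_unique[OF l] r by simp
      then show "EO (A f) x $ i = (\<i> *s (\<Sum>j\<in>UNIV. B (Inr j) f x *s EO (\<pi> (Inl j)) x + B (Inl j) f x *s EO (\<pi> (Inr j)) x)) $ i"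
        by (simp add: cinner_axis)
    qed
  qed
qed

end

section \<open>Solutions of the canonical system\<close>

text \<open>Here h is integrable but may be unbounded, so smallness comes from continuity of its
  primitive. If \<phi> vanishes up to s and h has integral at most 1/2 over (s, m0), the maximum of
  \<phi> on [s, m0] is at most half of itself. Taking s as the supremum of the initial zero
  intervals, this forces s = r.\<close>

lemma Gronwall_zero:
  fixes \<phi> h :: "real \<Rightarrow> real"
  assumes \<phi>: "continuous_on {0..r} \<phi>" and nn: "\<And>x. x \<in> {0..r} \<Longrightarrow> 0 \<le> \<phi> x"
    and h: "integrable (Iv r) h" "\<And>x. 0 \<le> h x"
    and le: "\<And>x. x \<in> {0..r} \<Longrightarrow> \<phi> x \<le> (LINT t|Iv x. h t * \<phi> t)"
    and x: "x \<in> {0..r}"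
  shows "\<phi> x = 0"
proof -
  define Z where "Z = {x \<in> {0..r}. \<forall>y\<in>{0..x}. \<phi> y = 0}"
  have r: "0 \<le> r" using x by auto
  have "\<phi> 0 = 0" using le[of 0] nn[of 0] r by simp
  then have Z0: "0 \<in> Z" using r by (auto simp: Z_def)
  define s where "s = Sup Z"
  have bdd: "bdd_above Z" by (rule bdd_aboveI[of _ r]) (auto simp: Z_def)
  have s: "0 \<le> s" unfolding s_def by (rule cSup_upper[OF Z0 bdd])
  moreover have "s \<le> r" unfolding s_def by (rule cSup_least) (use Z0 in blast, simp add: Z_def)
  ultimately have s: "0 \<le> s" "s \<le> r" by auto
  have below: "\<phi> y = 0" if y: "0 \<le> y" "y < s" for y
  proof -
    obtain w where "w \<in> Z" "y < w" using y(2) less_cSup_iff[of Z y] Z0 bdd by (auto simp: s_def)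
    then show ?thesis using y by (auto simp: Z_def)
  qed
  define Hh where "Hh x = (LINT t|Iv x. h t)" for x
  have cH: "continuous_on {0..r} Hh" unfolding Hh_def by (rule continuous_on_indefinite_Iv[OF h(1)])
  have small: "\<phi> y = 0" if y: "s \<le> m0" "m0 \<le> r" "Hh m0 - Hh s \<le> 1/2" "y \<in> {s..m0}" for m0 y
  proof -
    have "continuous_on {s..m0} \<phi>" by (rule continuous_on_subset[OF \<phi>]) (use s y in auto)
    then obtain m where m: "m \<in> {s..m0}" "\<And>y. y \<in> {s..m0} \<Longrightarrow> \<phi> y \<le> \<phi> m"
      using continuous_attains_sup[of "{s..m0}" \<phi>] y by auto
    have m': "m \<in> {0..r}" using m s y by auto
    have hm: "integrable (Iv m) h" using integrable_Iv_mono[OF h(1)] m' by auto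
    have "\<phi> m \<le> (LINT t|Iv m. h t * \<phi> t)" by (rule le[OF m'])
    also have "\<dots> \<le> (LINT t|Iv m. \<phi> m * (h t - indicator {0<..<s} t *\<^sub>R h t))"
    proof (rule integral_mono_AE)
      have "continuous_on {0..m} \<phi>" by (rule continuous_on_subset[OF \<phi>]) (use m' in auto)
      from integrable_continuous_mult_Iv[OF this hm]
      show "integrable (Iv m) (\<lambda>t. h t * \<phi> t)" by (simp add: mult.commute)
      show "integrable (Iv m) (\<lambda>t. \<phi> m * (h t - indicator {0<..<s} t *\<^sub>R h t))"
        by (intro integrable_mult_right Bochner_Integration.integrable_diff hm integrable_indicator_Iv) auto
      show "AE t in Iv m. h t * \<phi> t \<le> \<phi> m * (h t - indicator {0<..<s} t *\<^sub>R h t)"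
      proof (rule AE_I2)
        fix t assume t: "t \<in> space (Iv m)"
        show "h t * \<phi> t \<le> \<phi> m * (h t - indicator {0<..<s} t *\<^sub>R h t)"
        proof (cases "t < s")
          case True then show ?thesis using below[of t] t by simp
        next
          case False
          then have "\<phi> t \<le> \<phi> m" using m t by auto
          then show ?thesis using False mult_right_mono[OF _ h(2)[of t], of "\<phi> t" "\<phi> m"] by (simp add: mult.commute)
        qed
      qed
    qed
    also have "\<dots> = \<phi> m * (Hh m - Hh s)"
    proof -
      have "(LINT t|Iv m. indicator {0<..<s} t *\<^sub>R h t) = Hh s"
        unfolding Hh_def using m by (intro integral_Iv_indicator[symmetric]) auto
      moreover have "integrable (Iv m) (\<lambda>t. indicator {0<..<s} t *\<^sub>R h t)"
        by (intro hm integrable_indicator_Iv) auto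
      ultimately show ?thesis using hm by (simp add: Hh_def)
    qed
    also have "\<dots> \<le> \<phi> m * (1/2)"
    proof (rule mult_left_mono)
      have "Hh m \<le> Hh m0"
      proof -
        have hm0: "integrable (Iv m0) h" using integrable_Iv_mono[OF h(1)] y by auto
        have "Hh m = (LINT t|Iv m0. indicator {0<..<m} t *\<^sub>R h t)"
          unfolding Hh_def using m by (intro integral_Iv_indicator) auto
        also have "\<dots> \<le> Hh m0"
          unfolding Hh_def by (intro integral_mono hm0 integrable_indicator_Iv) (auto simp: indicator_def h(2))
        finally show ?thesis .
      qed
      then show "Hh m - Hh s \<le> 1/2" using y by simp
    qed (rule nn[OF m'])
    finally have "\<phi> m = 0" using nn[OF m'] by simp
    then show ?thesis using m(2)[OF y(4)] nn[of y] y s by auto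
  qed
  have s0: "\<phi> s = 0" using small[of s s] s by simp
  have "s = r"
  proof (rule ccontr)
    assume "s \<noteq> r"
    then have sr: "s < r" using s by simp
    obtain \<delta> where \<delta>: "0 < \<delta>" "\<And>y. y \<in> {0..r} \<Longrightarrow> dist y s < \<delta> \<Longrightarrow> dist (Hh y) (Hh s) < 1/2"
      using cH[unfolded continuous_on_iff] s by (metis atLeastAtMost_iff half_gt_zero zero_less_one)
    define m0 where "m0 = min r (s + \<delta>/2)"
    have m0: "s < m0" "m0 \<le> r" using sr \<delta> by (auto simp: m0_def)
    have "dist (Hh m0) (Hh s) < 1/2" using m0 s \<delta>(1) by (intro \<delta>(2)) (auto simp: m0_def dist_real_def)
    then have hh: "Hh m0 - Hh s \<le> 1/2" unfolding dist_real_def by linarith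
    have "\<phi> y = 0" if y: "y \<in> {0..m0}" for y
    proof (cases "y < s")
      case True
      then show ?thesis using below y by simp
    next
      case False
      then show ?thesis using small[OF _ m0(2) hh, of y] m0 y by simp
    qed
    then have "m0 \<in> Z" using m0 s by (simp add: Z_def)
    then have "m0 \<le> s" unfolding s_def by (rule cSup_upper[OF _ bdd])
    then show False using m0 by simp
  qed
  then show ?thesis using below[of x] s0 x by (cases "x = s") auto
qed

lemma sum_UNIV_Plus: "(\<Sum>c\<in>(UNIV :: ('a::finite + 'b::finite) set). f c) = (\<Sum>j\<in>UNIV. f (Inl j)) + (\<Sum>j\<in>UNIV. f (Inr j))"
  unfolding UNIV_Plus_UNIV[symmetric] by (subst sum.Plus) auto

lemma LINT_Iv_continuous:
  fixes f :: "real \<Rightarrow> complex"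
  assumes "continuous_on {0..r} f"
  shows "(LINT t|Iv r. f t) = integral {0..r} f"
  using continuous_integrable_Iv[OF assms] by (simp add: Iv_eq_Icc lebesgue_integral_eq_integral)

text \<open>The action of J on indices: J exchanges the two blocks of a vector, as
  \<open>Jmat_mult\<close> states.\<close>

primrec flip :: "'a + 'a \<Rightarrow> 'a + 'a" where
  "flip (Inl a) = Inr a"
| "flip (Inr a) = Inl a"

lemma Jmat_mult: "(Jmat *v y) $ c = y $ flip c"
  by (cases c) (simp_all add: Jmat_def matrix_vector_mult_def vcat_def hcat_def sum_UNIV_Plus mat_def
      if_distrib[of "\<lambda>a. a * _"] cong: if_cong)

lemma mat_mult_vec: "mat a *v y = a *s (y :: complex ^ 'n)"
  by (simp add: vec_eq_iff matrix_vector_mult_def mat_def if_distrib[of "\<lambda>a. a * _"] cong: if_cong)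

lemma bounded_linear_mult_vec_nth: "bounded_linear (\<lambda>M :: complex ^ 'n ^ 'm. (M *v v) $ c)"
  unfolding matrix_vector_mult_def vec_lambda_beta
  by (intro bounded_linear_sum bounded_linear_compose[OF bounded_linear_mult_left]
      bounded_linear_compose[OF bounded_linear_vec_nth bounded_linear_vec_nth])

lemma fundamental_solution_nth:
  assumes w: "fundamental_solution H w" and x: "0 \<le> x"
  shows "z \<noteq> 0 \<Longrightarrow> integrable (Iv x) (\<lambda>t. (H t *v (w t z *v v)) $ c)"
    and "(w x z *v v) $ c = v $ c + \<i> * z * (LINT t|Iv x. (H t *v (w t z *v v)) $ flip c)"
proof -
  let ?M = "\<lambda>t. mat (\<i> * z) ** Jmat ** H t ** w t z"
  have M: "integrable (Iv x) ?M" and W: "w x z = mat 1 + (LINT t|Iv x. ?M t)"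
    using w x unfolding fundamental_solution_def by blast+
  have Mv: "(?M t *v v) $ c = \<i> * z * ((H t *v (w t z *v v)) $ flip c)" for t c
    by (simp add: matrix_vector_mul_assoc[symmetric] mat_mult_vec Jmat_mult)
  have ff: "flip (flip c) = c" for c :: "'p + 'p" by (cases c) auto
  have "integrable (Iv x) (\<lambda>t. (?M t *v v) $ c)" for c
    by (rule integrable_bounded_linear[OF bounded_linear_mult_vec_nth M])
  from integrable_mult_right[OF this[of "flip c"], of "1 / (\<i> * z)"]
  show "integrable (Iv x) (\<lambda>t. (H t *v (w t z *v v)) $ c)" if "z \<noteq> 0"
    using that by (simp add: Mv ff)
  have "(w x z *v v) $ c = v $ c + ((LINT t|Iv x. ?M t) *v v) $ c"
    by (subst W) (simp add: matrix_vector_mult_add_rdistrib)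
  also have "((LINT t|Iv x. ?M t) *v v) $ c = (LINT t|Iv x. (?M t *v v) $ c)"
    by (rule integral_bounded_linear[OF bounded_linear_mult_vec_nth M, symmetric])
  finally show "(w x z *v v) $ c = v $ c + \<i> * z * (LINT t|Iv x. (H t *v (w t z *v v)) $ flip c)"
    by (simp add: Mv)
qed

section \<open>The canonical system solved through the triangular model\<close>

context factored
begin

abbreviation "\<beta> \<equiv> beta_fun d k E"

lemma beta_nth: "\<beta> x $ i $ c = EO (\<pi> c) x $ i"
  by (simp add: beta_fun_def pi_col_def[abs_def])

lemma beta_mult: "\<beta> x *v y = (\<Sum>c\<in>UNIV. y $ c *s EO (\<pi> c) x)"
  by (simp add: vec_eq_iff matrix_vector_mult_def beta_nth mult.commute)

lemma beta_star_mult: "(hermconj (\<beta> x) *v y) $ c = cinner y (EO (\<pi> c) x)"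
  by (simp add: matrix_vector_mult_def hermconj_def beta_nth cinner_def mult.commute)

text \<open>The everywhere defined representative of the Hamiltonian; a member of the class agrees
  with it only almost everywhere.\<close>

definition gram :: "real \<Rightarrow> complex ^ ('p + 'p) ^ ('p + 'p)" where
  "gram x = hermconj (\<beta> x) ** \<beta> x"

lemma gram_nth: "gram x $ c $ c' = cinner (EO (\<pi> c') x) (EO (\<pi> c) x)"
  by (simp add: gram_def matrix_matrix_mult_def hermconj_def beta_nth cinner_def mult.commute)

lemma gram_integrable: "0 < r \<Longrightarrow> integrable (Iv r) (\<lambda>x. gram x $ c $ c')"
  unfolding gram_nth by (intro cinner_integrable E_L2 pi_col_L2)

context
  fixes z :: complex and v :: "complex ^ ('p + 'p)"
begin

text \<open>Below, \<open>uf\<close> is the explicit form of \<open>(I - z A)\<^sup>-\<^sup>1 \<Pi> v\<close>, obtained by solving a scalar linear equation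
  in each component after rescaling \<open>x\<close> by \<open>\<bar>d\<^sub>i\<bar>\<close>, and \<open>Wt\<close> turns out to be \<open>w v\<close>.\<close>

definition Phi :: "'p \<Rightarrow> complex" where
  "Phi i = of_real (d $ i) / 2 * v $ Inl i + v $ Inr i"

definition kapv :: "'p \<Rightarrow> real \<Rightarrow> complex" where
  "kapv i y = (\<Sum>j\<in>UNIV. kap i j y * v $ Inl j)"

text \<open>Variation of constants for V' = Phi - kapv - i z V with V(0) = 0, in the variable y =
  |d_i| x. Its right-hand side is component i of \<open>uf\<close>, so Vf / |d_i| is the primitive
  of that component; see \<open>Vf_deriv\<close> and \<open>LINT_uf\<close>.\<close>

definition Vf :: "'p \<Rightarrow> real \<Rightarrow> complex" where
  "Vf i y = exp (- (\<i> * z * of_real y)) * integral {0..y} (\<lambda>t. exp (\<i> * z * of_real t) * (Phi i - kapv i t))"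

definition uf :: "real \<Rightarrow> complex ^ 'p" where
  "uf x = (\<chi> i. Phi i - kapv i (- (d $ i * x)) - \<i> * z * Vf i (- (d $ i * x)))"

lemma kapv_cont: "continuous_on X (kapv i)"
  unfolding kapv_def by (intro continuous_intros kap_cont)

lemma Vf_deriv:
  assumes "0 \<le> y"
  shows "(Vf i has_vector_derivative (Phi i - kapv i y - \<i> * z * Vf i y)) (at y within {0..})"
proof -
  let ?g = "\<lambda>t. exp (\<i> * z * complex_of_real t) * (Phi i - kapv i t)"
  have "((\<lambda>y. integral {0..y} ?g) has_vector_derivative ?g y) (at y within {0..y + 1})"
    by (rule integral_has_vector_derivative) (use assms in \<open>auto intro!: continuous_intros kapv_cont\<close>)
  then have I: "((\<lambda>y. integral {0..y} ?g) has_vector_derivative ?g y) (at y within {0..})"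
  proof -
    have "at y within {0..y + 1} = at y within {0..}"
      by (rule at_within_nhd[where S="{y - 1<..<y + 1}"]) (use assms in auto)
    then show ?thesis using \<open>((\<lambda>y. integral {0..y} ?g) has_vector_derivative ?g y) (at y within {0..y + 1})\<close> by simp
  qed
  have "((\<lambda>w. exp (- (\<i> * z * w))) has_field_derivative - (\<i> * z) * exp (- (\<i> * z * of_real y))) (at (of_real y))"
    by (auto intro!: derivative_eq_intros)
  then have e: "((\<lambda>y. exp (- (\<i> * z * complex_of_real y))) has_vector_derivative - (\<i> * z) * exp (- (\<i> * z * of_real y))) (at y within {0..})"
    by (rule has_vector_derivative_real_field)
  have "((\<lambda>y. exp (- (\<i> * z * complex_of_real y)) * integral {0..y} ?g) has_vector_derivative
      exp (- (\<i> * z * of_real y)) * ?g y + (- (\<i> * z) * exp (- (\<i> * z * of_real y))) * integral {0..y} ?g) (at y within {0..})"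
    by (rule has_vector_derivative_mult[OF e I])
  moreover have "exp (- (\<i> * z * of_real y)) * ?g y = Phi i - kapv i y"
    by (simp add: exp_minus)
  moreover have "Vf i = (\<lambda>y. exp (- (\<i> * z * complex_of_real y)) * integral {0..y} ?g)"
    by (simp add: Vf_def fun_eq_iff)
  moreover have "(- (\<i> * z) * exp (- (\<i> * z * of_real y))) * integral {0..y} ?g = - (\<i> * z * Vf i y)"
    unfolding Vf_def by simp
  ultimately show ?thesis by (simp only: diff_conv_add_uminus)
qed

lemma Vf_cont: "continuous_on {0..} (Vf i)"
  unfolding continuous_on_eq_continuous_within
  using Vf_deriv has_vector_derivative_continuous by blast

lemma uf_cont: "continuous_on {0..r} uf"
  unfolding uf_def
  by (intro continuous_intros continuous_on_compose2[OF kapv_cont[of UNIV]] continuous_on_compose2[OF Vf_cont])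
     (use neg in \<open>auto intro!: continuous_intros simp: mult_nonpos_nonneg less_imp_le\<close>)

lemma uf_L2: "uf \<in> L2 r" by (rule L2_continuous[OF uf_cont])

lemma LINT_uf: 
  assumes "0 \<le> x"
  shows "(LINT t|Iv x. uf t $ i) = Vf i (- (d $ i * x)) / of_real (- d $ i)"
proof -
  have V0: "Vf i 0 = 0" by (simp add: Vf_def)
  have "((\<lambda>t. uf t $ i) has_integral Vf i (- (d $ i * x)) / of_real (- d $ i) - Vf i (- (d $ i * 0)) / of_real (- d $ i)) {0..x}"
  proof (rule fundamental_theorem_of_calculus[OF assms])
    fix t assume t: "t \<in> {0..x}"
    then have nn: "0 \<le> - (d $ i * t)" using neg[of i] by (simp add: mult_nonpos_nonneg less_imp_le)
    have "(Vf i has_vector_derivative uf t $ i) (at (- (d $ i * t)) within (\<lambda>t. - (d $ i * t)) ` {0..x})"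
    proof -
      have sub: "(\<lambda>t. - (d $ i * t)) ` {0..x} \<subseteq> {0..}"
        using neg[of i] by (auto simp: mult_nonpos_nonneg less_imp_le)
      have e: "uf t $ i = Phi i - kapv i (- (d $ i * t)) - \<i> * z * Vf i (- (d $ i * t))"
        by (simp add: uf_def)
      show ?thesis unfolding e by (rule has_vector_derivative_within_subset[OF Vf_deriv[OF nn] sub])
    qed
    moreover have "((\<lambda>t. - (d $ i * t)) has_vector_derivative - d $ i) (at t within {0..x})"
      by (auto intro!: derivative_eq_intros simp: has_real_derivative_iff_has_vector_derivative[symmetric])
    ultimately have "(Vf i \<circ> (\<lambda>t. - (d $ i * t)) has_vector_derivative (- d $ i) *\<^sub>R (uf t $ i)) (at t within {0..x})"
      by (intro vector_diff_chain_within)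
    from has_vector_derivative_mult_left[OF this, of "1 / of_real (- d $ i)"]
    show "((\<lambda>t. Vf i (- (d $ i * t)) / of_real (- d $ i)) has_vector_derivative uf t $ i) (at t within {0..x})"
      using d_nz[of i] by (simp add: o_def scaleR_conv_of_real)
  qed
  moreover have "continuous_on {0..x} (\<lambda>t. uf t $ i)" by (intro continuous_intros uf_cont)
  ultimately show ?thesis by (simp add: LINT_Iv_continuous integral_unique V0)
qed

lemma uf_equation:
  assumes "0 \<le> x"
  shows "uf x = (\<Sum>c\<in>UNIV. v $ c *s \<pi> c x) + z *s A uf x"
proof (subst vec_eq_iff, rule allI)
  fix i
  have "(\<Sum>c\<in>UNIV. v $ c *s \<pi> c x) $ i = Phi i - kapv i (- (d $ i * x))"
  proof -
    have e1: "v $ Inl j * \<pi> (Inl j) x $ i = (if i = j then of_real (d $ i) / 2 * v $ Inl i else 0) - kap i j (- (d $ i * x)) * v $ Inl j" for j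
      by (simp add: pi_col_Inl[OF assms] right_diff_distrib mult.commute)
    have e2: "v $ Inr j * \<pi> (Inr j) x $ i = (if i = j then v $ Inr i else 0)" for j
      by (simp add: pi_col_Inr)
    have "(\<Sum>c\<in>UNIV. v $ c *s \<pi> c x) $ i = (\<Sum>j\<in>UNIV. v $ Inl j * \<pi> (Inl j) x $ i) + (\<Sum>j\<in>UNIV. v $ Inr j * \<pi> (Inr j) x $ i)"
      by (simp add: sum_UNIV_Plus)
    also have "\<dots> = Phi i - kapv i (- (d $ i * x))"
      unfolding e1 e2 by (simp add: sum_subtractf Phi_def kapv_def)
    finally show ?thesis .
  qed
  moreover have "A uf x $ i = - \<i> * Vf i (- (d $ i * x))"
    using d_nz[of i] by (simp add: A_op_def LINT_uf[OF assms])
  ultimately show "uf x $ i = ((\<Sum>c\<in>UNIV. v $ c *s \<pi> c x) + z *s A uf x) $ i"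
    by (simp add: uf_def)
qed

definition Wt :: "real \<Rightarrow> complex ^ ('p + 'p)" where
  "Wt x = (\<chi> c. v $ c + \<i> * z * B (flip c) uf x)"

text \<open>E is applied to u = Pi v + z A u. The first term becomes beta v, and the triangular
  model turns the second into i z beta J times the vector of all \<open>B c u\<close>. Linearity of
  E is available only modulo \<open>L2_eq\<close>, hence the almost everywhere conclusion.\<close>

lemma E_uf: 
  assumes r: "0 < r"
  shows "AE x in Iv r. EO uf x = \<beta> x *v Wt x"
proof -
  note Eb = E_bounded[OF r]
  let ?p = "\<lambda>x. \<Sum>c\<in>UNIV. v $ c *s \<pi> c x"
  have pL: "?p \<in> L2 r" by (intro L2_sum L2_scale pi_col_L2)
  have AL: "(\<lambda>x. z *s A uf x) \<in> L2 r" by (intro L2_scale A_op_L2 uf_L2)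
  have "L2_eq r (EO uf) (EO (\<lambda>x. ?p x + z *s A uf x))"
    by (intro bounded_op_cong[OF Eb] uf_L2 L2_add pL AL L2_eqI uf_equation) simp
  moreover have "L2_eq r (EO (\<lambda>x. ?p x + z *s A uf x)) (\<lambda>x. EO ?p x + EO (\<lambda>x. z *s A uf x) x)"
    by (rule bounded_op_add[OF Eb pL AL])
  moreover have "L2_eq r (EO ?p) (\<lambda>x. \<Sum>c\<in>UNIV. v $ c *s EO (\<pi> c) x)"
    by (rule bounded_op_sum[OF Eb]) (auto intro: pi_col_L2)
  moreover have "L2_eq r (EO (\<lambda>x. z *s A uf x)) (\<lambda>x. z *s EO (A uf) x)"
    by (rule bounded_op_scale[OF Eb A_op_L2[OF uf_L2]])
  ultimately show ?thesis
    using triangular_model[OF r uf_L2] unfolding L2_eq_def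
  proof eventually_elim
    case (elim x)
    then have "EO uf x = (\<Sum>c\<in>UNIV. v $ c *s EO (\<pi> c) x) + z *s (\<i> *s (\<Sum>j\<in>UNIV. B (Inr j) uf x *s EO (\<pi> (Inl j)) x + B (Inl j) uf x *s EO (\<pi> (Inr j)) x))"
      by simp
    also have "\<dots> = \<beta> x *v Wt x"
      unfolding beta_mult Wt_def
      by (simp add: vec_eq_iff sum_UNIV_Plus sum.distrib sum_distrib_left algebra_simps)
    finally show ?case .
  qed
qed

text \<open>Multiplying \<open>E_uf\<close> by beta^* gives beta^* E u = gram Wt almost everywhere,
  so the terms \<open>B\<close> inside \<open>Wt\<close> are integrals of gram Wt. This is the
  integrated canonical system.\<close>

lemma Wt_equation: "Wt x $ c = v $ c + \<i> * z * (LINT t|Iv x. (gram t *v Wt t) $ flip c)"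
proof -
  have "B (flip c) uf x = (LINT t|Iv x. (gram t *v Wt t) $ flip c)"
  proof (cases "0 < x")
    case True
    show ?thesis unfolding B_def
    proof (rule integral_cong_AE)
      show m: "bden (flip c) uf \<in> borel_measurable (Iv x)"
        using bden_integrable[OF uf_L2 True] by auto
      show ae: "AE t in Iv x. bden (flip c) uf t = (gram t *v Wt t) $ flip c"
        using E_uf[OF True]
        by eventually_elim (simp add: bden_def gram_def matrix_vector_mul_assoc[symmetric] beta_star_mult)
      show "(\<lambda>t. (gram t *v Wt t) $ flip c) \<in> borel_measurable (Iv x)"
      proof -
        have "continuous_on {0..x} (\<lambda>t. Wt t $ c')" for c'
          unfolding Wt_def B_def vec_lambda_beta
          by (intro continuous_intros continuous_on_indefinite_Iv bden_integrable uf_L2 True)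
        then show ?thesis unfolding matrix_vector_mult_def vec_lambda_beta
          by (intro borel_measurable_sum borel_measurable_times continuous_on_measurable_Iv borel_measurable_integrable[OF gram_integrable[OF True]])
      qed
    qed
  qed (simp add: B_def)
  then show ?thesis by (simp add: Wt_def)
qed

text \<open>Uniqueness of solutions: the difference of the two satisfies the homogeneous integral
  equation. For z nonzero the integrability of H w v can be recovered from that of i z J H w, which
  is all the definition of a fundamental solution provides.\<close>

lemma fundamental_eq_Wt:
  assumes H: "AE x in lebesgue_on {0<..}. H x = gram x" and w: "fundamental_solution H w" and z: "z \<noteq> 0" and x: "0 \<le> x"
  shows "w x z *v v = Wt x"
proof -
  define W where "W t = w t z *v v" for t
  define r where "r = x + 1"
  have r: "0 < r" "x \<le> r" "x \<in> {0..r}" using x by (auto simp: r_def)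
  have HI: "AE t in Iv y. H t = gram t" for y
    using H by (auto simp: AE_restrict_space_iff elim!: eventually_mono)
  have Wi: "integrable (Iv y) (\<lambda>t. (H t *v W t) $ c)" if "0 \<le> y" for y c
    unfolding W_def by (rule fundamental_solution_nth(1)[OF w that z])
  have We: "W y $ c = v $ c + \<i> * z * (LINT t|Iv y. (H t *v W t) $ flip c)" if "0 \<le> y" for y c
    unfolding W_def by (rule fundamental_solution_nth(2)[OF w that])
  have Wc: "continuous_on {0..r} (\<lambda>y. W y $ c)" for c
  proof -
    have "continuous_on {0..r} (\<lambda>y. v $ c + \<i> * z * (LINT t|Iv y. (H t *v W t) $ flip c))"
      by (intro continuous_intros continuous_on_indefinite_Iv Wi) (use r in simp)
    then show ?thesis by (rule continuous_on_eq) (use We in auto)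
  qed
  have Wtc: "continuous_on {0..r} (\<lambda>t. Wt t $ c')" for c'
    unfolding Wt_def B_def vec_lambda_beta
    by (intro continuous_intros continuous_on_indefinite_Iv bden_integrable uf_L2 r)
  define \<phi> where "\<phi> y = (\<Sum>c\<in>UNIV. norm (W y $ c - Wt y $ c))" for y
  \<comment> \<open>The sum of the absolute values of all entries bounds the coefficient matrix in
    the norm used for \<open>\<phi>\<close>. It is merely integrable in t, which suffices for
    \<open>Gronwall_zero\<close>.\<close>
  define h where "h t = norm z * (\<Sum>c\<in>UNIV. \<Sum>c'\<in>UNIV. norm (gram t $ c $ c'))" for t
  have h0: "0 \<le> h t" for t by (simp add: h_def sum_nonneg)
  have hi: "integrable (Iv r) h"
    unfolding h_def by (intro integrable_mult_right Bochner_Integration.integrable_sum integrable_norm gram_integrable r)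
  have phi_cont: "continuous_on {0..r} \<phi>"
    unfolding \<phi>_def by (intro continuous_intros Wc Wtc)
  have "\<phi> x = 0"
  proof (rule Gronwall_zero[OF phi_cont _ hi h0 _ r(3)])
    show "0 \<le> \<phi> y" for y by (simp add: \<phi>_def sum_nonneg)
    fix y assume y: "y \<in> {0..r}"
    show "\<phi> y \<le> (LINT t|Iv y. h t * \<phi> t)"
    proof (cases "y = 0")
      case True
      then show ?thesis using We[of 0] Wt_equation[of 0] by (simp add: \<phi>_def)
    next
      case False
      then have y: "0 < y" "y \<le> r" using y by auto
      let ?g = "\<lambda>t c. (gram t *v (W t - Wt t)) $ c"
      have gm: "(\<lambda>t. ?g t c) \<in> borel_measurable (Iv y)" for c
        unfolding matrix_vector_mult_def vec_lambda_beta vector_minus_component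
        by (intro borel_measurable_sum borel_measurable_times borel_measurable_diff borel_measurable_integrable[OF gram_integrable[OF y(1)]]
           continuous_on_measurable_Iv continuous_on_subset[OF Wc] continuous_on_subset[OF Wtc]) (use y in auto)
      have gW: "(\<lambda>t. (gram t *v W t) $ c) \<in> borel_measurable (Iv y)" "(\<lambda>t. (gram t *v Wt t) $ c) \<in> borel_measurable (Iv y)" for c
        unfolding matrix_vector_mult_def vec_lambda_beta vector_minus_component
        by (intro borel_measurable_sum borel_measurable_times borel_measurable_diff borel_measurable_integrable[OF gram_integrable[OF y(1)]]
           continuous_on_measurable_Iv continuous_on_subset[OF Wc] continuous_on_subset[OF Wtc]; use y in auto)+
      have i1: "integrable (Iv y) (\<lambda>t. (gram t *v W t) $ c)" for c
        by (rule integrable_cong_AE_imp[OF Wi gW(1)]) (use y HI[of y] in \<open>auto elim!: eventually_mono\<close>)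
      have i2: "integrable (Iv y) (\<lambda>t. (gram t *v Wt t) $ c)" for c
      proof (rule integrable_cong_AE_imp[OF bden_integrable[OF uf_L2 y(1), of c] gW(2)])
        show "AE t in Iv y. bden c uf t = (gram t *v Wt t) $ c"
          using E_uf[OF y(1)]
          by eventually_elim (simp add: bden_def gram_def matrix_vector_mul_assoc[symmetric] beta_star_mult)
      qed
      have gd: "?g t c = (gram t *v W t) $ c - (gram t *v Wt t) $ c" for t c
        by (simp add: matrix_vector_mult_diff_distrib)
      have gi: "integrable (Iv y) (\<lambda>t. ?g t c)" for c
        unfolding gd by (intro Bochner_Integration.integrable_diff i1 i2)
      have diff: "W y $ c - Wt y $ c = \<i> * z * (LINT t|Iv y. ?g t (flip c))" for c
      proof -
        have "(LINT t|Iv y. (H t *v W t) $ flip c) = (LINT t|Iv y. (gram t *v W t) $ flip c)"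
          by (rule integral_cong_AE) (use y HI[of y] gW(1) borel_measurable_integrable[OF Wi] in \<open>auto elim!: eventually_mono\<close>)
        then show ?thesis
          unfolding gd using i1 i2 y by (simp add: We Wt_equation[of y] right_diff_distrib)
      qed
      have "\<phi> y \<le> (\<Sum>c\<in>UNIV. norm z * (LINT t|Iv y. norm (?g t (flip c))))"
        unfolding \<phi>_def diff norm_mult by (intro sum_mono mult_left_mono integral_norm_bound) (auto intro: mult_left_mono)
      also have "\<dots> = norm z * (LINT t|Iv y. (\<Sum>c\<in>UNIV. norm (?g t (flip c))))"
        using gi by (simp add: sum_distrib_left Bochner_Integration.integral_sum)
      also have "\<dots> = (LINT t|Iv y. norm z * (\<Sum>c\<in>UNIV. norm (?g t (flip c))))" by simp
      also have "\<dots> \<le> (LINT t|Iv y. h t * \<phi> t)"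
      proof (rule integral_mono)
        show "integrable (Iv y) (\<lambda>t. norm z * (\<Sum>c\<in>UNIV. norm (?g t (flip c))))"
          by (intro integrable_mult_right Bochner_Integration.integrable_sum integrable_norm gi)
        have "continuous_on {0..y} \<phi>" by (rule continuous_on_subset[OF phi_cont]) (use y in auto)
        from integrable_continuous_mult_Iv[OF this integrable_Iv_mono[OF hi y(2)]]
        show "integrable (Iv y) (\<lambda>t. h t * \<phi> t)" by (simp add: mult.commute)
        fix t
        have "norm (?g t c) \<le> (\<Sum>c'\<in>UNIV. norm (gram t $ c $ c')) * \<phi> t" for c
        proof -
          have "norm (?g t c) \<le> (\<Sum>c'\<in>UNIV. norm (gram t $ c $ c') * norm ((W t - Wt t) $ c'))"
            unfolding matrix_vector_mult_def vec_lambda_beta norm_mult[symmetric] by (rule norm_sum)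
          also have "\<dots> \<le> (\<Sum>c'\<in>UNIV. norm (gram t $ c $ c') * \<phi> t)"
            unfolding \<phi>_def vector_minus_component[symmetric]
            by (intro sum_mono mult_left_mono member_le_sum[of _ UNIV "\<lambda>c. norm ((W t - Wt t) $ c)"]) auto
          finally show ?thesis by (simp add: sum_distrib_right)
        qed
        then have "(\<Sum>c\<in>UNIV. norm (?g t (flip c))) \<le> (\<Sum>c\<in>UNIV. (\<Sum>c'\<in>UNIV. norm (gram t $ flip c $ c')) * \<phi> t)"
          by (intro sum_mono)
        also have "\<dots> = (\<Sum>c\<in>UNIV. \<Sum>c'\<in>UNIV. norm (gram t $ c $ c')) * \<phi> t"
        proof -
          have fs: "(\<Sum>c\<in>UNIV. g (flip c)) = (\<Sum>c\<in>UNIV. g c)" for g :: "'p + 'p \<Rightarrow> real"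
            by (simp add: sum_UNIV_Plus add.commute)
          show ?thesis unfolding sum_distrib_right[of _ UNIV "\<phi> t", symmetric]
            by (simp only: fs[of "\<lambda>c. \<Sum>c'\<in>UNIV. norm (gram t $ c $ c')"])
        qed
        finally show "norm z * (\<Sum>c\<in>UNIV. norm (?g t (flip c))) \<le> h t * \<phi> t"
          by (simp add: h_def mult.assoc mult_left_mono)
      qed
      finally show ?thesis .
    qed
  qed
  then have "W x $ c = Wt x $ c" for c
    by (auto simp: \<phi>_def sum_nonneg_eq_0_iff)
  then show ?thesis by (simp add: W_def vec_eq_iff)
qed

end

end

section \<open>The Weyl function as a Laplace transform\<close>

lemma hermconj_mult: "hermconj (A ** B) = hermconj B ** hermconj A"
  by (simp add: hermconj_def matrix_matrix_mult_def vec_eq_iff mult.commute)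

lemma column_mult: "column e (A ** B) = A *v column e B"
  by (simp add: column_def matrix_matrix_mult_def matrix_vector_mult_def vec_eq_iff)

lemma mat_mult_nth: "(mat a ** (A :: complex ^ 'n ^ 'm)) $ i $ j = a * A $ i $ j"
  by (simp add: matrix_matrix_mult_def mat_def if_distrib[of "\<lambda>a. a * _"] cong: if_cong)

lemma hermconj_weyl_column:
  "hcat (mat 1) (mat \<i> ** hermconj P) = hermconj (vcat (mat 1) (mat (- \<i>) ** P))"
proof -
  have "hcat (mat 1) (mat \<i> ** hermconj P) $ a $ c = hermconj (vcat (mat 1) (mat (- \<i>) ** P)) $ a $ c" for a c
  proof (cases c)
    case (Inl b)
    then show ?thesis by (simp add: hcat_def vcat_def hermconj_def mat_def)
  next
    case (Inr b)
    then show ?thesis by (simp add: hcat_def vcat_def mat_mult_nth hermconj_def)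
  qed
  then show ?thesis by (simp add: vec_eq_iff)
qed

lemma hermconj_square_nth: "(hermconj Y ** Y) $ e $ e = cinner (column e Y) (column e Y)"
  by (simp add: matrix_matrix_mult_def hermconj_def cinner_def column_def mult.commute)

lemma LINT_Iv_one: "0 \<le> r \<Longrightarrow> (LINT x|Iv r. 1) = (r :: real)"
  by (simp add: measure_restrict_space)

context factored
begin

text \<open>The matrix in the Weyl condition is Y^* Y with Y = beta w (I, -i \<phi>), so its
  diagonal entry (e, e) is |beta w v|^2, which is |E u|^2 by \<open>fundamental_eq_Wt\<close> and
  \<open>E_uf\<close>. Its integral over the half-line is a bound independent of r.\<close>

lemma Weyl_bound:
  assumes H: "AE x in lebesgue_on {0<..}. H x = gram x" and weyl: "weyl_function H \<phi>" and z: "0 < Im z"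
    and v: "v = column e (vcat (mat 1) (mat (- \<i>) ** \<phi> z))"
  shows "\<exists>C. \<forall>r>0. Re (L2_inner r (EO (uf z v)) (EO (uf z v))) \<le> C"
proof -
  let ?V = "vcat (mat 1) (mat (- \<i>) ** \<phi> z)"
  obtain w where w: "fundamental_solution H w" and
    int: "integrable (lebesgue_on {0<..}) (\<lambda>x. hcat (mat 1) (mat \<i> ** hermconj (\<phi> z)) ** hermconj (w x z) ** H x ** w x z ** ?V)"
    using weyl z unfolding weyl_function_def by blast
  have z0: "z \<noteq> 0" using z by auto
  define M where "M x = hcat (mat 1) (mat \<i> ** hermconj (\<phi> z)) ** hermconj (w x z) ** H x ** w x z ** ?V" for x
  have Mi: "integrable (lebesgue_on {0<..}) (\<lambda>x. M x $ e $ e)"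
    using integrable_bounded_linear[OF bounded_linear_compose[OF bounded_linear_vec_nth bounded_linear_vec_nth] int]
    unfolding M_def .
  define C where "C = (LINT x|lebesgue_on {0<..}. norm (M x $ e $ e))"
  have Mn: "AE x in lebesgue_on {0<..}. M x $ e $ e = of_real ((norm (\<beta> x *v (w x z *v v)))\<^sup>2)"
    using H
  proof eventually_elim
    case (elim x)
    let ?Y = "\<beta> x ** w x z ** ?V"
    have "M x = hermconj ?Y ** ?Y"
      unfolding M_def elim gram_def hermconj_weyl_column hermconj_mult by (simp add: matrix_mul_assoc)
    moreover have "column e ?Y = \<beta> x *v (w x z *v v)"
      by (simp add: v matrix_mul_assoc[symmetric] column_mult)
    ultimately have "M x $ e $ e = cinner (\<beta> x *v (w x z *v v)) (\<beta> x *v (w x z *v v))"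
      by (simp only: hermconj_square_nth)
    then show ?case by (simp only: cinner_self)
  qed
  have "Re (L2_inner r (EO (uf z v)) (EO (uf z v))) \<le> C" if r: "0 < r" for r
  proof -
    have uL: "EO (uf z v) \<in> L2 r" by (intro E_L2 uf_L2 r)
    have Mi': "set_integrable lebesgue {0<..} (\<lambda>x. norm (M x $ e $ e))"
      using integrable_norm[OF Mi] by (simp add: set_integrable_def integrable_restrict_space)
    then have Mr: "set_integrable lebesgue {0<..<r} (\<lambda>x. norm (M x $ e $ e))"
      by (rule set_integrable_subset) auto
    have Mn': "AE x in Iv r. M x $ e $ e = of_real ((norm (\<beta> x *v (w x z *v v)))\<^sup>2)"
      using Mn by (auto simp: AE_restrict_space_iff elim!: eventually_mono)
    have pos: "AE x in Iv r. 0 < x" by (intro AE_I2) simp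
    have "Re (L2_inner r (EO (uf z v)) (EO (uf z v))) = (LINT x|Iv r. (norm (EO (uf z v) x))\<^sup>2)"
      by (rule L2_norm_inner[OF uL, symmetric])
    also have "\<dots> \<le> (LINT x|Iv r. norm (M x $ e $ e))"
    proof (rule integral_mono_AE)
      show "integrable (Iv r) (\<lambda>x. (norm (EO (uf z v) x))\<^sup>2)" by (rule L2_norm_integrable[OF uL])
      show "integrable (Iv r) (\<lambda>x. norm (M x $ e $ e))"
        using Mr by (simp add: set_integrable_def integrable_restrict_space)
      show "AE x in Iv r. (norm (EO (uf z v) x))\<^sup>2 \<le> norm (M x $ e $ e)"
        using Mn' E_uf[OF r, of z v] pos
      proof eventually_elim
        case (elim x)
        then show ?case by (simp add: fundamental_eq_Wt[OF H w z0] norm_power)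
      qed
    qed
    also have "\<dots> = (LINT x|lebesgue. indicator {0<..<r} x *\<^sub>R norm (M x $ e $ e))"
      by (simp add: integral_restrict_space)
    also have "\<dots> \<le> (LINT x|lebesgue. indicator {0<..} x *\<^sub>R norm (M x $ e $ e))"
      by (rule integral_mono) (use Mi' Mr in \<open>auto simp: set_integrable_def indicator_def\<close>)
    also have "\<dots> = C" by (simp add: integral_restrict_space C_def)
    finally show ?thesis .
  qed
  then show ?thesis by blast
qed

text \<open>Writing f = S^-1 S f gives <u, f> = <E u, E S f>, and the square norm of E S f is <S f,
  f>. The unknown growth of S^-1 thus enters only through E u.\<close>

lemma test_inequality:
  assumes r: "0 < r" and u: "u \<in> L2 r" and f: "f \<in> L2 r"
  shows "norm (L2_inner r u f) \<le> Re (L2_inner r (EO u) (EO u)) + norm (L2_inner r (S r f) f)"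
proof -
  obtain R where R: "inverse_op r (S r) R"
    and ER: "\<And>f g. f \<in> L2 r \<Longrightarrow> g \<in> L2 r \<Longrightarrow> L2_inner r (EO f) (EO g) = L2_inner r f (R g)"
    using factor_inverse[OF r] by blast
  have SL: "S r f \<in> L2 r" by (rule bounded_op_L2[OF S_bounded[OF r] f])
  have RSL: "R (S r f) \<in> L2 r" and RS: "L2_eq r (R (S r f)) f"
    using R bounded_op_L2[OF _ SL] f unfolding inverse_op_def by blast+
  have c: "L2_inner r g (R (S r f)) = L2_inner r g f" if "g \<in> L2 r" for g
    by (rule L2_inner_cong[OF _ RS that that RSL f]) (simp add: L2_eq_def)
  have "norm (L2_inner r u f) = norm (L2_inner r (EO u) (EO (S r f)))"
    using ER[OF u SL] c[OF u] by simp
  also have "\<dots> \<le> Re (L2_inner r (EO u) (EO u)) + Re (L2_inner r (EO (S r f)) (EO (S r f)))"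
    by (rule norm_L2_inner_le[OF E_L2[OF u r] E_L2[OF SL r]])
  also have "L2_inner r (EO (S r f)) (EO (S r f)) = L2_inner r (S r f) f"
    using ER[OF SL SL] c[OF SL] by simp
  also have "Re (L2_inner r (S r f) f) \<le> norm (L2_inner r (S r f) f)" by (rule complex_Re_le_cmod)
  finally show ?thesis by simp
qed

text \<open>There is no upper cut-off: the bump is used in L2 of (0, r), and its right end is the
  endpoint r of that interval.\<close>

definition bump :: "'p \<Rightarrow> real \<Rightarrow> real \<Rightarrow> complex ^ 'p" where
  "bump i a t = (if t < a then 0 else axis i 1)"

lemma bump_L2: "bump i a \<in> L2 r"
proof (rule L2_bounded)
  fix l
  have "(\<lambda>t. bump i a t $ l) = (\<lambda>t. indicator {a..} t *\<^sub>R (axis i 1 $ l))"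
    by (auto simp: bump_def fun_eq_iff indicator_def)
  moreover have "(\<lambda>t. indicator {a..} t *\<^sub>R (axis i 1 $ l :: complex)) \<in> borel_measurable lebesgue"
    by (intro borel_measurable_scaleR borel_measurable_indicator borel_measurable_const) auto
  ultimately show "(\<lambda>t. bump i a t $ l) \<in> borel_measurable (Iv r)" by (simp add: measurable_restrict_space1)
  show "norm (bump i a x) \<le> 1" for x by (simp add: bump_def norm_axis_one)
qed

text \<open>The form \<open>\<langle>S f, f\<rangle>\<close> of a bump in a single component does not grow when the bump is shifted, because the
  diagonal entries of \<open>S\<close> have difference kernels.\<close>

lemma S_bump_bounded:
  "\<exists>C. \<forall>y\<ge>0. norm (L2_inner ((y + 1) / - d $ i) (S ((y + 1) / - d $ i) (bump i (y / - d $ i))) (bump i (y / - d $ i))) \<le> C"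
proof -
  let ?n = "\<lambda>s. norm (K i i s)"
  have dn: "0 < - d $ i" using neg[of i] by simp
  \<comment> \<open>On the bump, |t - x| < 1 / |d_i|, so the argument d_i (t - x) of the diagonal
    kernel stays in (-1, 1) for every position y. The division by |d_i| is the Jacobian of this
    substitution.\<close>
  define Kc where "Kc = (LINT s|lebesgue. indicator {-1<..<1} s * ?n s) / - d $ i"
  have ni: "integrable lebesgue (\<lambda>s. indicator {-1<..<1} s * ?n s)"
    using integrable_norm[OF set_integrable_loc[OF K_loc, of "-1" 1 i i]] by simp
  have "norm (L2_inner ((y + 1) / - d $ i) (S ((y + 1) / - d $ i) (bump i (y / - d $ i))) (bump i (y / - d $ i))) \<le> (1 + Kc) / - d $ i" if y: "0 \<le> y" for y
  proof -
    define a where "a = y / - d $ i"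
    define r where "r = (y + 1) / - d $ i"
    have ar: "0 \<le> a" "a < r" "0 < r"
      unfolding a_def r_def using y
      by (intro divide_nonneg_pos divide_strict_right_mono divide_pos_pos dn; simp)+
    have ra: "r - a = 1 / - d $ i" by (simp add: a_def r_def diff_divide_distrib[symmetric] del: minus_divide_right)
    have inner: "norm (LINT t|Iv r. K i i (d $ i * t - d $ i * x) * bump i a t $ i) \<le> Kc" if x: "a \<le> x" "x < r" for x
    proof -
      have "norm (LINT t|Iv r. K i i (d $ i * t - d $ i * x) * bump i a t $ i) \<le> (LINT t|Iv r. norm (K i i (d $ i * t - d $ i * x) * bump i a t $ i))"
        by (rule integral_norm_bound)
      also have "\<dots> = (LINT t|lebesgue. indicator {0<..<r} t *\<^sub>R norm (K i i (d $ i * t - d $ i * x) * bump i a t $ i))"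
        by (simp add: integral_restrict_space)
      also have "\<dots> \<le> (LINT t|lebesgue. indicator {-1<..<1} (- (d $ i * x) + d $ i * t) * ?n (- (d $ i * x) + d $ i * t))"
      proof (rule integral_mono')
        show "integrable lebesgue (\<lambda>t. indicator {-1<..<1} (- (d $ i * x) + d $ i * t) * ?n (- (d $ i * x) + d $ i * t))"
          by (rule lebesgue_integrable_real_affine[OF ni d_nz])
        show "0 \<le> indicator {-1<..<1} (- (d $ i * x) + d $ i * t) * ?n (- (d $ i * x) + d $ i * t)" for t by simp
        fix t
        show "indicator {0<..<r} t *\<^sub>R norm (K i i (d $ i * t - d $ i * x) * bump i a t $ i) \<le> indicator {-1<..<1} (- (d $ i * x) + d $ i * t) * ?n (- (d $ i * x) + d $ i * t)"
        proof (cases "a \<le> t \<and> t < r")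
          case True
          then have "\<bar>t - x\<bar> < 1 / - d $ i" using x ra by auto
          then have "- d $ i * \<bar>t - x\<bar> < 1" using dn by (simp add: field_simps)
          then have "\<bar>d $ i * (t - x)\<bar> < 1" using dn by (simp add: abs_mult)
          then have "- (d $ i * x) + d $ i * t \<in> {-1<..<1}" by (auto simp: algebra_simps abs_less_iff)
          then show ?thesis using True by (simp add: bump_def indicator_def)
        next
          case False
          then show ?thesis by (auto simp: bump_def indicator_def)
        qed
      qed
      also have "\<dots> = Kc"
        unfolding Kc_def using lebesgue_integral_real_affine[OF d_nz[of i], of "\<lambda>s. indicator {-1<..<1} s * ?n s" "- (d $ i * x)"] dn
        by (simp add: field_simps)
      finally show ?thesis .
    qed
    have SL: "S r (bump i a) \<in> L2 r" by (rule bounded_op_L2[OF S_bounded[OF ar(3)] bump_L2])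
    have "norm (L2_inner r (S r (bump i a)) (bump i a)) \<le> (LINT x|Iv r. norm (cinner (S r (bump i a) x) (bump i a x)))"
      unfolding L2_inner_cinner by (rule integral_norm_bound)
    also have "\<dots> \<le> (LINT x|Iv r. (1 + Kc) * (1 - indicator {0<..<a} x *\<^sub>R 1))"
    proof (rule integral_mono)
      show "integrable (Iv r) (\<lambda>x. norm (cinner (S r (bump i a) x) (bump i a x)))"
        by (intro integrable_norm cinner_integrable SL bump_L2)
      have c1: "integrable (Iv r) (\<lambda>x. 1::real)" by (intro finite_measure.integrable_const finite_measure_Iv)
      show "integrable (Iv r) (\<lambda>x. (1 + Kc) * (1 - indicator {0<..<a} x *\<^sub>R 1))"
        by (intro integrable_mult_right Bochner_Integration.integrable_diff integrable_indicator_Iv c1) auto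
      fix x assume x: "x \<in> space (Iv r)"
      show "norm (cinner (S r (bump i a) x) (bump i a x)) \<le> (1 + Kc) * (1 - indicator {0<..<a} x *\<^sub>R 1)"
      proof (cases "x < a")
        case True
        then show ?thesis using x by (simp add: bump_def)
      next
        case False
        \<comment> \<open>The bump has only component i, which discards the off-diagonal entries;
          their arguments d_j t - d_i x need not stay bounded when the bump moves.\<close>
        have "(LINT t|Iv r. K i j (d $ j * t - d $ i * x) * bump i a t $ j) = 0" if "j \<noteq> i" for j
        proof -
          have "bump i a t $ j = 0" for t using that by (simp add: bump_def axis_def)
          then show ?thesis by simp
        qed
        then have "(\<Sum>j\<in>UNIV. LINT t|Iv r. K i j (d $ j * t - d $ i * x) * bump i a t $ j) = (LINT t|Iv r. K i i (d $ i * t - d $ i * x) * bump i a t $ i)"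
          by (subst sum.remove[of _ i]) auto
        then have "cinner (S r (bump i a) x) (bump i a x) = 1 + (LINT t|Iv r. K i i (d $ i * t - d $ i * x) * bump i a t $ i)"
          using False by (simp add: bump_def[of i a x] cinner_axis S_op_nth[OF bump_L2])
        also have "norm \<dots> \<le> 1 + Kc"
          using inner[of x] False x by (intro order_trans[OF norm_triangle_ineq] add_mono) auto
        finally show ?thesis using False by simp
      qed
    qed
    also have "\<dots> = (1 + Kc) * (r - a)"
    proof -
      have c1: "integrable (Iv r) (\<lambda>x. 1::real)" by (intro finite_measure.integrable_const finite_measure_Iv)
      have "(LINT x|Iv r. indicator {0<..<a} x *\<^sub>R (1::real)) = a"
        using integral_Iv_indicator[of a r "\<lambda>_. 1::real"] ar LINT_Iv_one[OF ar(1)] by simp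
      moreover have "integrable (Iv r) (\<lambda>x. indicator {0<..<a} x *\<^sub>R (1::real))" by (intro integrable_indicator_Iv c1) auto
      ultimately have "(LINT x|Iv r. 1 - indicator {0<..<a} x *\<^sub>R (1::real)) = r - a"
        using c1 LINT_Iv_one[of r] ar by (simp only: Bochner_Integration.integral_diff) 
      then show ?thesis by (simp only: integral_mult_right_zero)
    qed
    finally show ?thesis unfolding ra by (simp only: a_def r_def times_divide_eq_right mult_1_right)
  qed
  then show ?thesis by blast
qed

text \<open>The pairing of u with the bump on (a, r) is the integral of component i of u, which is
  an increment of Vf divided by |d_i|. The bump has length 1 / |d_i|, so that in the scaled variable
  the increment has length one.\<close>

lemma Vf_increments_bounded:
  assumes C: "\<And>r. 0 < r \<Longrightarrow> Re (L2_inner r (EO (uf z v)) (EO (uf z v))) \<le> C"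
  shows "\<exists>C'. \<forall>y\<ge>0. norm (Vf z v i (y + 1) - Vf z v i y) \<le> C'"
proof -
  have dn: "0 < - d $ i" using neg[of i] by simp
  obtain C1 where C1: "\<And>y. 0 \<le> y \<Longrightarrow> norm (L2_inner ((y + 1) / - d $ i) (S ((y + 1) / - d $ i) (bump i (y / - d $ i))) (bump i (y / - d $ i))) \<le> C1"
    using S_bump_bounded[of i] by blast
  have "norm (Vf z v i (y + 1) - Vf z v i y) \<le> - d $ i * (C + C1)" if y: "0 \<le> y" for y
  proof -
    define a where "a = y / - d $ i"
    define r where "r = (y + 1) / - d $ i"
    have ar: "0 \<le> a" "a \<le> r" "0 < r"
      unfolding a_def r_def using y
      by (intro divide_nonneg_pos divide_right_mono divide_pos_pos dn less_imp_le[OF dn]; simp)+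
    have da: "- (d $ i * a) = y" "- (d $ i * r) = y + 1" using dn by (auto simp: a_def r_def)
    have ui: "integrable (Iv r) (\<lambda>x. uf z v x $ i)" by (rule L2_nth_integrable[OF uf_L2])
    have "L2_inner r (uf z v) (bump i a) = (LINT x|Iv r. uf z v x $ i - indicator {0<..<a} x *\<^sub>R (uf z v x $ i))"
      unfolding L2_inner_cinner
    proof (intro Bochner_Integration.integral_cong refl)
      fix x assume x: "x \<in> space (Iv r)"
      show "cinner (uf z v x) (bump i a x) = uf z v x $ i - indicator {0<..<a} x *\<^sub>R (uf z v x $ i)"
        using x by (cases "x < a") (simp_all add: bump_def cinner_axis)
    qed
    also have "\<dots> = (LINT x|Iv r. uf z v x $ i) - (LINT x|Iv a. uf z v x $ i)"
      using ar ui integrable_indicator_Iv[OF ui, of "{0<..<a}"] integral_Iv_indicator[of a r "\<lambda>x. uf z v x $ i"] by simp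
    also have "\<dots> = (Vf z v i (y + 1) - Vf z v i y) / of_real (- d $ i)"
      using ar by (simp only: LINT_uf less_imp_le da diff_divide_distrib)
    finally have "norm (L2_inner r (uf z v) (bump i a)) = norm (Vf z v i (y + 1) - Vf z v i y) / - d $ i"
      using dn by (simp only: norm_divide norm_of_real abs_of_pos)
    moreover have "norm (L2_inner r (uf z v) (bump i a)) \<le> C + C1"
      using test_inequality[OF ar(3) uf_L2 bump_L2, of z v i a] C[OF ar(3)] C1[OF y] by (simp only: a_def[symmetric] r_def[symmetric])
    ultimately have "norm (Vf z v i (y + 1) - Vf z v i y) / - d $ i \<le> C + C1" by simp
    then show ?thesis using dn by (subst (asm) pos_divide_le_eq) (auto simp: mult.commute)
  qed
  then show ?thesis by blast
qed

text \<open>For v equal to column e of (I, -i \<phi>), \<open>kapv\<close> reduces to the single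
  primitive \<open>kap i e\<close> and \<open>Phi\<close> to the entry (i, e) of D/2 - i \<phi>. The
  limit of the Laplace integral therefore recovers \<phi>.\<close>

theorem Weyl_Laplace:
  assumes H: "AE x in lebesgue_on {0<..}. H x = gram x" and weyl: "weyl_function H \<phi>" and z: "0 < Im z"
  shows "((\<lambda>y. integral {0..y} (\<lambda>t. exp (\<i> * z * of_real t) * kap i e t)) \<longlongrightarrow>
     \<i> * ((if i = e then of_real (d $ i) / 2 else 0) - \<i> * \<phi> z $ i $ e) / z) at_top"
proof -
  define v where "v = column e (vcat (mat 1) (mat (- \<i>) ** \<phi> z))"
  have vl: "v $ Inl j = (if j = e then 1 else 0)" and vr: "v $ Inr j = - \<i> * \<phi> z $ j $ e" for j
    by (simp_all add: v_def column_def vcat_def mat_mult_nth) (simp add: mat_def)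
  have kv: "kapv v i = kap i e"
    by (simp add: fun_eq_iff kapv_def vl if_distrib[of "\<lambda>a. _ * a"] cong: if_cong)
  have ph: "Phi v i = (if i = e then of_real (d $ i) / 2 else 0) - \<i> * \<phi> z $ i $ e"
    by (simp add: Phi_def vl vr)
  obtain C where "\<And>r. 0 < r \<Longrightarrow> Re (L2_inner r (EO (uf z v)) (EO (uf z v))) \<le> C"
    using Weyl_bound[OF H weyl z v_def] by blast
  then obtain C' where C': "\<And>y. 0 \<le> y \<Longrightarrow> norm (Vf z v i (y + 1) - Vf z v i y) \<le> C'"
    using Vf_increments_bounded[of z v C i] by blast
  show ?thesis
    using tendsto_Laplace_of_bounded_increments[OF z kapv_cont[of _ v i] Vf_def C'] unfolding kv ph .
qed

end

section \<open>Uniqueness\<close>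

text \<open>Since c is nonzero, the set is the single ray through sgn c + i |c|: the sign of the
  real part is forced by Im z > 0, and Re z = 0 is excluded because division by zero yields
  0.\<close>

lemma filterlim_ray:
  assumes "c \<noteq> 0"
  obtains \<omega> :: complex where "0 < Im \<omega>"
    "filterlim (\<lambda>\<rho>. of_real \<rho> * \<omega>) (inf at_infinity (principal {z. Im z > 0 \<and> Im z / Re z = c})) at_top"
proof -
  define \<omega> where "\<omega> = Complex (sgn c) \<bar>c\<bar>"
  have s: "sgn c \<noteq> 0" using assms by (simp add: sgn_zero_iff)
  have "c * sgn c = \<bar>c\<bar>" by (simp add: abs_sgn)
  then have c: "\<bar>c\<bar> / sgn c = c" using s by (simp add: field_simps)
  have pos: "0 < Im \<omega>" using assms by (simp add: \<omega>_def)
  have nw: "0 < norm \<omega>" using pos by auto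
  have "filterlim (\<lambda>\<rho>. norm (of_real \<rho> * \<omega>)) at_top at_top"
    unfolding norm_mult norm_of_real
    by (rule filterlim_at_top_mult_tendsto_pos[OF tendsto_const nw filterlim_abs_real])
  then have 1: "filterlim (\<lambda>\<rho>. of_real \<rho> * \<omega>) at_infinity at_top"
    by (rule filterlim_norm_at_top_imp_at_infinity)
  have 2: "\<forall>\<^sub>F \<rho> in at_top. of_real \<rho> * \<omega> \<in> {z. Im z > 0 \<and> Im z / Re z = c}"
    using eventually_gt_at_top[of 0]
  proof eventually_elim
    case (elim \<rho>)
    then show ?case using pos c by (simp add: \<omega>_def)
  qed
  from 1 2 have "filterlim (\<lambda>\<rho>. of_real \<rho> * \<omega>) (inf at_infinity (principal {z. Im z > 0 \<and> Im z / Re z = c})) at_top"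
    by (simp only: filterlim_inf filterlim_principal)
  with pos show ?thesis by (rule that)
qed

section \<open>From the kernel \<open>k\<close> back to the Hamiltonian\<close>

lemma prim_eq_imp_AE_eq:
  assumes "loc_integrable g" "loc_integrable h" and eq: "\<And>x. 0 < x \<Longrightarrow> x \<le> l \<Longrightarrow> prim g x = prim h x"
  shows "AE x in Iv l. g x = h x"
proof (rule AE_eq_of_integrals_Iv)
  show "integrable (Iv l) g" "integrable (Iv l) h" using assms(1,2) by (auto simp: loc_integrable_def)
  show "(LINT t|Iv x. g t) = (LINT t|Iv x. h t)" if "0 < x" "x \<le> l" for x
    using eq[OF that] that by (simp add: prim_nonneg assms)
qed

text \<open>R f = R' T' R f = R' T R f = R' f. Operators act on representatives, so every link of
  this chain holds only modulo \<open>L2_eq\<close>, and boundedness of R' carries the equality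
  through.\<close>

lemma inverse_op_unique:
  assumes R: "inverse_op r T R" and R': "inverse_op r T' R'"
    and TL: "\<And>f. f \<in> L2 r \<Longrightarrow> T f \<in> L2 r" and TL': "\<And>f. f \<in> L2 r \<Longrightarrow> T' f \<in> L2 r"
    and eq: "\<And>f. f \<in> L2 r \<Longrightarrow> L2_eq r (T f) (T' f)" and f: "f \<in> L2 r"
  shows "L2_eq r (R f) (R' f)"
proof -
  have b': "bounded_op r R'" and Rf: "R f \<in> L2 r"
    using R R' f bounded_op_L2 unfolding inverse_op_def by blast+
  have "L2_eq r (T' (R f)) f"
    using eq[OF Rf] R f unfolding inverse_op_def by (blast intro: L2_eq_trans L2_eq_sym)
  then have "L2_eq r (R' (T' (R f))) (R' f)"
    by (rule bounded_op_cong[OF b' TL'[OF Rf] f])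
  moreover have "L2_eq r (R' (T' (R f))) (R f)" using R' Rf unfolding inverse_op_def by blast
  ultimately show ?thesis by (blast intro: L2_eq_trans L2_eq_sym)
qed

lemma class_H_factored:
  fixes d :: "real ^ 'p"
  assumes "\<forall>i. d $ i < 0" "H \<in> class_H d"
  obtains k E where "factored d k E" "AE x in lebesgue_on {0<..}. H x = factored.gram d k E x"
proof -
  obtain k E where adm: "admissible_kernel d k" and tri: "triangular_factor d k E"
    and H: "AE x in lebesgue_on {0<..}. H x = hermconj (beta_fun d k E x) ** beta_fun d k E x"
    using assms(2) unfolding class_H_def by blast
  have F: "factored d k E"
    using assms(1) adm tri by (simp add: factored_def admissible_def factored_axioms_def)
  then have "factored.gram d k E = (\<lambda>x. hermconj (beta_fun d k E x) ** beta_fun d k E x)"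
    by (simp add: factored.gram_def fun_eq_iff)
  with F H show ?thesis by (intro that) auto
qed

text \<open>By \<open>\<integral>\<^sub>0\<^sup>r H = \<Pi>\<^sup>* S\<^sub>r\<^sup>-\<^sup>1 \<Pi>\<close> the Hamiltonian depends on \<open>k\<close> only, and not on the choice of the triangular factor.\<close>

lemma gram_local:
  fixes d :: "real ^ 'p" and k k' :: "real \<Rightarrow> complex ^ 'p ^ 'p"
  assumes F: "factored d k E" and F': "factored d k' E'"
    and kk: "\<And>i j. AE y in lebesgue. \<bar>y\<bar> < l \<longrightarrow> k y $ i $ j = k' y $ i $ j"
    and prim: "\<And>i j y. 0 \<le> y \<Longrightarrow> y < l \<Longrightarrow> prim (\<lambda>y. k y $ i $ j) y = prim (\<lambda>y. k' y $ i $ j) y"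
    and R0: "0 < R0" "\<And>i. \<bar>d $ i\<bar> * R0 \<le> l"
  shows "AE x in Iv R0. factored.gram d k E x = factored.gram d k' E' x"
proof -
  interpret f: factored d k E by (rule F)
  interpret g: factored d k' E' by (rule F')
  \<comment> \<open>Both d_j t and d_i x lie in (-l, 0), so their difference has modulus less than
    l. It is here that R0 may not exceed l / d.\<close>
  have dl: "- l < d $ i * x \<and> d $ i * x < 0" if "0 < x" "x < R0" for i x
  proof -
    have "d $ i * x < 0" using f.neg[of i] that by (simp add: mult_neg_pos)
    moreover have "\<bar>d $ i\<bar> * x < \<bar>d $ i\<bar> * R0" using that f.neg[of i] by (intro mult_strict_left_mono) auto
    then have "\<bar>d $ i\<bar> * x < l" using R0(2)[of i] by linarith
    then have "- (d $ i * x) < l" using f.neg[of i] by simp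
    ultimately show ?thesis by simp
  qed
  have S: "L2_eq r (S_op d k r h) (S_op d k' r h)" if h: "h \<in> L2 r" and r: "r \<le> R0" for r h
  proof (rule L2_eqI)
    fix x assume x: "0 < x" "x < r"
    have "(LINT t|Iv r. k (d $ j * t - d $ i * x) $ i $ j * h t $ j) = (LINT t|Iv r. k' (d $ j * t - d $ i * x) $ i $ j * h t $ j)" for i j
    proof (rule integral_cong_AE)
      have "AE t in lebesgue. \<bar>- (d $ i * x) + d $ j * t\<bar> < l \<longrightarrow> k (- (d $ i * x) + d $ j * t) $ i $ j = k' (- (d $ i * x) + d $ j * t) $ i $ j"
        by (rule AE_lebesgue_affine[OF kk f.d_nz])
      then have "AE t in lebesgue. t \<in> {0<..<r} \<longrightarrow> k (d $ j * t - d $ i * x) $ i $ j * h t $ j = k' (d $ j * t - d $ i * x) $ i $ j * h t $ j"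
      proof eventually_elim
        case (elim t)
        show ?case
        proof
          assume "t \<in> {0<..<r}"
          then have "\<bar>- (d $ i * x) + d $ j * t\<bar> < l"
            using dl[of x i] dl[of t j] x r by (auto simp: abs_less_iff)
          with elim show "k (d $ j * t - d $ i * x) $ i $ j * h t $ j = k' (d $ j * t - d $ i * x) $ i $ j * h t $ j"
            by simp
        qed
      qed
      then show "AE t in Iv r. k (d $ j * t - d $ i * x) $ i $ j * h t $ j = k' (d $ j * t - d $ i * x) $ i $ j * h t $ j"
        by (auto simp: AE_restrict_space_iff)
    qed (intro borel_measurable_integrable f.K_product_integrable g.K_product_integrable h)+
    then show "S_op d k r h x = S_op d k' r h x"
      by (simp add: vec_eq_iff f.S_op_nth[OF h] g.S_op_nth[OF h])
  qed
  have pi: "L2_eq r (pi_col d k c) (pi_col d k' c)" if r: "r \<le> R0" for r c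
  proof (rule L2_eqI)
    fix x assume x: "0 < x" "x < r"
    have "prim (\<lambda>y. k y $ i $ j) (- (d $ i * x)) = prim (\<lambda>y. k' y $ i $ j) (- (d $ i * x))" for i j
      using dl[of x i] x r by (intro prim) auto
    then show "pi_col d k c x = pi_col d k' c x"
      using x by (cases c) (simp_all add: vec_eq_iff f.pi_col_Inl g.pi_col_Inl f.pi_col_Inr g.pi_col_Inr)
  qed
  have gram: "AE x in Iv R0. f.gram x $ c $ c' = g.gram x $ c $ c'" for c c'
  proof (rule AE_eq_of_integrals_Iv)
    show "integrable (Iv R0) (\<lambda>x. f.gram x $ c $ c')" "integrable (Iv R0) (\<lambda>x. g.gram x $ c $ c')"
      using f.gram_integrable g.gram_integrable R0(1) by auto
    fix r assume r: "0 < r" "r \<le> R0"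
    \<comment> \<open>The inverse changes with r while E does not; the integral of the Hamiltonian
      over (0, r) is thus a pairing with the inverse of S_r, for each r separately.\<close>
    obtain R where R: "inverse_op r (S_op d k r) R"
      "\<And>f g. f \<in> L2 r \<Longrightarrow> g \<in> L2 r \<Longrightarrow> L2_inner r (E_op E f) (E_op E g) = L2_inner r f (R g)"
      using f.factor_inverse[OF r(1)] by blast
    obtain R' where R': "inverse_op r (S_op d k' r) R'"
      "\<And>f g. f \<in> L2 r \<Longrightarrow> g \<in> L2 r \<Longrightarrow> L2_inner r (E_op E' f) (E_op E' g) = L2_inner r f (R' g)"
      using g.factor_inverse[OF r(1)] by blast
    have b: "bounded_op r R" "bounded_op r R'" using R R' unfolding inverse_op_def by blast+
    have "L2_eq r (R (pi_col d k c)) (R' (pi_col d k c))"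
      by (rule inverse_op_unique[OF R(1) R'(1) bounded_op_L2[OF f.S_bounded[OF r(1)]] bounded_op_L2[OF g.S_bounded[OF r(1)]] S[OF _ r(2)] f.pi_col_L2])
    moreover have "L2_eq r (R' (pi_col d k c)) (R' (pi_col d k' c))"
      by (rule bounded_op_cong[OF b(2) f.pi_col_L2 g.pi_col_L2 pi[OF r(2)]])
    ultimately have Req: "L2_eq r (R (pi_col d k c)) (R' (pi_col d k' c))" by (rule L2_eq_trans)
    have "(LINT t|Iv r. f.gram t $ c $ c') = L2_inner r (pi_col d k c') (R (pi_col d k c))"
      unfolding f.gram_nth L2_inner_cinner[symmetric] by (rule R(2)[OF f.pi_col_L2 f.pi_col_L2])
    also have "\<dots> = L2_inner r (pi_col d k' c') (R' (pi_col d k' c))"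
      by (rule L2_inner_cong[OF pi[OF r(2)] Req f.pi_col_L2 g.pi_col_L2 bounded_op_L2[OF b(1) f.pi_col_L2] bounded_op_L2[OF b(2) g.pi_col_L2]])
    also have "\<dots> = (LINT t|Iv r. g.gram t $ c $ c')"
      unfolding g.gram_nth L2_inner_cinner[symmetric] by (rule R'(2)[OF g.pi_col_L2 g.pi_col_L2, symmetric])
    finally show "(LINT t|Iv r. f.gram t $ c $ c') = (LINT t|Iv r. g.gram t $ c $ c')" .
  qed
  have "AE x in Iv R0. \<forall>c\<in>UNIV. \<forall>c'\<in>UNIV. f.gram x $ c $ c' = g.gram x $ c $ c'"
    by (intro AE_finite_allI gram) auto
  then show ?thesis by eventually_elim (simp add: vec_eq_iff)
qed

theorem theorem4p5:
  fixes d :: "real ^ 'p"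
    and H H' :: "real \<Rightarrow> complex ^ ('p + 'p) ^ ('p + 'p)"
    and \<phi> \<phi>' :: "complex \<Rightarrow> complex ^ 'p ^ 'p"
    and l c :: real
  assumes "\<forall>i. d $ i < 0"
    and "H \<in> class_H d" and "H' \<in> class_H d"
    and "weyl_function H \<phi>" and "weyl_function H' \<phi>'"
    and "l > 0" and "c \<noteq> 0"
    and "\<forall>a<l. \<forall>i j.
           (\<lambda>z. exp (- (\<i> * z * complex_of_real a)) * (\<phi> z - \<phi>' z) $ i $ j)
             \<in> O[inf at_infinity (principal {z. Im z > 0 \<and> Im z / Re z = c})](\<lambda>_. 1)"
  shows "AE x in lebesgue_on {0<..<l / Max (range (\<lambda>i. \<bar>d $ i\<bar>))}. H x = H' x"
proof -
  obtain k E where F: "factored d k E" and HG: "AE x in lebesgue_on {0<..}. H x = factored.gram d k E x"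
    by (rule class_H_factored[OF assms(1,2)])
  obtain k' E' where F': "factored d k' E'" and HG': "AE x in lebesgue_on {0<..}. H' x = factored.gram d k' E' x"
    by (rule class_H_factored[OF assms(1,3)])
  interpret f: factored d k E by (rule F)
  interpret g: factored d k' E' by (rule F')
  let ?fil = "inf at_infinity (principal {z. Im z > 0 \<and> Im z / Re z = c})"
  obtain \<omega> where \<omega>: "0 < Im \<omega>" and ray: "filterlim (\<lambda>\<rho>. of_real \<rho> * \<omega>) ?fil at_top"
    by (rule filterlim_ray[OF \<open>c \<noteq> 0\<close>])
  have prim_eq: "f.kap i j x = g.kap i j x" if x: "0 \<le> x" "x < l" for i j x
  proof -
    define q where "q t = f.kap i j t - g.kap i j t" for t
    \<comment> \<open>In the difference of the two Laplace formulas the terms D/2 cancel, and i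
      times -i equals 1.\<close>
    define \<Delta> where "\<Delta> z = (\<phi> z - \<phi>' z) $ i $ j / z" for z
    have qc: "continuous_on X q" for X unfolding q_def by (intro continuous_intros f.kap_cont g.kap_cont)
    have lim: "((\<lambda>y. integral {0..y} (\<lambda>t. exp (\<i> * z * of_real t) * q t)) \<longlongrightarrow> \<Delta> z) at_top" if z: "0 < Im z" for z
    proof (rule tendsto_eq_rhs)
      have "integral {0..y} (\<lambda>t. exp (\<i> * z * of_real t) * q t) =
         integral {0..y} (\<lambda>t. exp (\<i> * z * of_real t) * f.kap i j t) - integral {0..y} (\<lambda>t. exp (\<i> * z * of_real t) * g.kap i j t)" for y
        unfolding q_def right_diff_distrib
        by (intro integral_diff integrable_continuous_real continuous_intros f.kap_cont g.kap_cont)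
      then show "((\<lambda>y. integral {0..y} (\<lambda>t. exp (\<i> * z * of_real t) * q t)) \<longlongrightarrow>
          \<i> * ((if i = j then of_real (d $ i) / 2 else 0) - \<i> * \<phi> z $ i $ j) / z - \<i> * ((if i = j then of_real (d $ i) / 2 else 0) - \<i> * \<phi>' z $ i $ j) / z) at_top"
        by (simp only:) (intro tendsto_diff f.Weyl_Laplace[OF HG assms(4) z] g.Weyl_Laplace[OF HG' assms(5) z])
      show "\<i> * ((if i = j then of_real (d $ i) / 2 else 0) - \<i> * \<phi> z $ i $ j) / z - \<i> * ((if i = j then of_real (d $ i) / 2 else 0) - \<i> * \<phi>' z $ i $ j) / z = \<Delta> z"
        unfolding \<Delta>_def diff_divide_distrib[symmetric] by (simp add: right_diff_distrib)
    qed
    \<comment> \<open>The growth relation is available only for exponents below l, while x must lie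
      in [0, a]; the midpoint satisfies both and is positive even for x = 0.\<close>
    define a where "a = (x + l) / 2"
    have a: "0 < a" "a < l" "x \<in> {0..a}" using x by (auto simp: a_def)
    have "(\<lambda>z. exp (- (\<i> * z * complex_of_real a)) * (\<phi> z - \<phi>' z) $ i $ j) \<in> O[?fil](\<lambda>_. 1)"
      using assms(8) a by blast
    then obtain C where C: "\<forall>\<^sub>F z in ?fil. norm (exp (- (\<i> * z * complex_of_real a)) * (\<phi> z - \<phi>' z) $ i $ j) \<le> C * norm (1::complex)"
      by (elim landau_o.bigE)
    \<comment> \<open>Away from the unit disc the factor 1/z in \<Delta> only improves the
      bound.\<close>
    have "\<forall>\<^sub>F z in at_infinity. 1 \<le> norm (z::complex)" by (auto simp: eventually_at_infinity)
    then have "\<forall>\<^sub>F z in ?fil. 1 \<le> norm z" by (rule filter_leD[OF inf_le1])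
    with C have "\<forall>\<^sub>F z in ?fil. norm (exp (- (\<i> * z * of_real a)) * \<Delta> z) \<le> C"
    proof eventually_elim
      case (elim z)
      have "norm (exp (- (\<i> * z * of_real a)) * \<Delta> z) = norm (exp (- (\<i> * z * complex_of_real a)) * (\<phi> z - \<phi>' z) $ i $ j) / norm z"
        by (simp only: \<Delta>_def times_divide_eq_right norm_divide)
      also have "\<dots> \<le> norm (exp (- (\<i> * z * complex_of_real a)) * (\<phi> z - \<phi>' z) $ i $ j) / 1"
        using elim by (intro divide_left_mono) auto
      finally show ?case using elim by simp
    qed
    then have "\<forall>\<^sub>F \<rho> in at_top. norm (exp (- (\<i> * (of_real \<rho> * \<omega>) * of_real a)) * \<Delta> (of_real \<rho> * \<omega>)) \<le> C"
      using ray by (rule eventually_compose_filterlim)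
    then have "q x = 0"
      using Laplace_ray_uniqueness[OF qc lim \<omega> a(1) _ a(3)] by blast
    then show ?thesis by (simp add: q_def)
  qed
  \<comment> \<open>The endpoint x = l is added by continuity, because
    \<open>prim_eq_imp_AE_eq\<close> compares primitives on the closed side.\<close>
  have prim_eq': "f.kap i j x = g.kap i j x" if x: "0 < x" "x \<le> l" for i j x
  proof -
    have "continuous_on {0..l} (\<lambda>t. f.kap i j t - g.kap i j t)" by (intro continuous_intros f.kap_cont g.kap_cont)
    then have "(\<lambda>t. f.kap i j t - g.kap i j t) ` closure {0..<l} \<subseteq> {0}"
      using \<open>l > 0\<close> prim_eq by (intro image_closure_subset) auto
    moreover have "x \<in> closure {0..<l}" using x \<open>l > 0\<close> by simp
    ultimately have "f.kap i j x - g.kap i j x = 0" by blast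
    then show ?thesis by simp
  qed
  have kk: "AE y in lebesgue. \<bar>y\<bar> < l \<longrightarrow> k y $ i $ j = k' y $ i $ j" for i j
  proof -
    have pos: "AE y in lebesgue. y \<in> {0<..<l} \<longrightarrow> k y $ i $ j = k' y $ i $ j" for i j
      using prim_eq_imp_AE_eq[OF f.K_loc g.K_loc prim_eq'] by (simp add: AE_restrict_space_iff)
    \<comment> \<open>Equality on (-l, 0) follows from that on (0, l) for the transposed entry,
      through the symmetry of both kernels.\<close>
    have neg: "AE y in lebesgue. - y \<in> {0<..<l} \<longrightarrow> k (- y) $ j $ i = k' (- y) $ j $ i"
      using AE_lebesgue_affine[OF pos[of j i], of "-1" 0] by simp
    have hf: "AE y in lebesgue. k y $ i $ j = cnj (k (- y) $ j $ i)" "AE y in lebesgue. k' y $ i $ j = cnj (k' (- y) $ j $ i)"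
      using AE_lebesgue_affine[OF f.K_herm[of i j], of "-1" 0] AE_lebesgue_affine[OF g.K_herm[of i j], of "-1" 0] by simp_all
    have "AE y in lebesgue. y \<noteq> (0::real)" by (simp add: AE_completion AE_lborel_singleton)
    with pos[of i j] neg hf show ?thesis
      by eventually_elim (auto simp: abs_less_iff)
  qed
  define D where "D = Max (range (\<lambda>i. \<bar>d $ i\<bar>))"
  have D: "\<bar>d $ i\<bar> \<le> D" for i unfolding D_def by (intro Max_ge) auto
  \<comment> \<open>Any index serves to show that the maximum is positive; index types are
    nonempty.\<close>
  have "0 < \<bar>d $ undefined\<bar>" using f.neg[of undefined] by simp
  then have D0: "0 < D" using D[of undefined] by linarith
  have "AE x in Iv (l / D). f.gram x = g.gram x"
  proof (rule gram_local[OF F F' kk prim_eq])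
    show "0 < l / D" using D0 \<open>l > 0\<close> by simp
    show "\<bar>d $ i\<bar> * (l / D) \<le> l" for i
      using D[of i] D0 \<open>l > 0\<close> by (simp add: field_simps)
  qed
  moreover have "AE x in Iv (l / D). H x = f.gram x"
    using HG by (auto simp: AE_restrict_space_iff elim!: eventually_mono)
  moreover have "AE x in Iv (l / D). H' x = g.gram x"
    using HG' by (auto simp: AE_restrict_space_iff elim!: eventually_mono)
  ultimately have "AE x in Iv (l / D). H x = H' x" by eventually_elim simp
  then show ?thesis unfolding D_def .
qed

end
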